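(* Let $\epsilon,\delta\in(0,1)$. Suppose the training set $S=\{(x_i,y_i)\}_{i=1}^n$ is drawn i.i.d. from $\mathcal{D}_\kappa$ with large enough $\kappa\in(0,\infty)$, and $$n\ =\ \frac{\Omega(\kappa^2)}{\epsilon^4}\Big(1+\log\frac1\epsilon+\log\frac1\delta\Big).$$ Then, with probability at least $1-\delta$ (over $S$ and the mixing coefficients), the Mixup loss $\mathcal{L}_S^{\mathrm{mix}}$ has a unique minimizer $\hat w^*_{\mathrm{mix},S}$ over $\mathbb{R}^d$ and $\mathrm{sim}(\hat w^*_{\mathrm{mix},S},\Sigma^{-1}\mu)\ge1-\epsilon$. Here $\Omega(\kappa^2)$ describes growth as $\kappa\to\infty$, hides factors not depending on $\kappa,\epsilon,\delta,n$ (those related to $d,\mu,\Sigma$ and the fixed mixing scheme $\Lambda,g$), and displays only the dominant factor in $\kappa$, so that $\kappa^2\,\mathrm{polylog}(\kappa)$ counts as $\Theta(\kappa^2)$. That is: there are $\kappa_0>1$ and a function $h(\kappa)=C\kappa^2\,\mathrm{polylog}(\kappa)$, determined by $d,\mu,\Sigma,\Lambda,g$ only, such that the conclusion holds for all $\kappa\ge\kappa_0$, all $\epsilon,\delta\in(0,1)$ and all integers $n\ge2$ with $n\ge\frac{h(\kappa)}{\epsilon^4}\big(1+\log\frac1\epsilon+\log\frac1\delta\big)$.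
   Context: Fix $d\ge 1$, a nonzero vector $\mu\in\mathbb{R}^d$ and a (symmetric) positive definite matrix $\Sigma\in\mathbb{R}^{d\times d}$ with $\|\mu\|^2=\|\Sigma\|$ ($\ell_2$ norm for vectors, spectral norm for matrices). For $\kappa\in(0,\infty)$, $\mathcal{D}_\kappa$ is the distribution of $(x,y)\in\mathbb{R}^d\times\{0,1\}$ with $y$ uniform on $\{0,1\}$, $x\mid y=1\sim N(\mu,\kappa^{-1}\Sigma)$ and $x\mid y=0\sim N(-\mu,\kappa^{-1}\Sigma)$. Let $l(z)=\log(1+e^{-z})$. Mixup: $\Lambda$ is a probability distribution with support contained in $[0,1]$ and $g:[0,1]\to[0,1]$ is a function such that $g(z)>\frac12$ if and only if $z>\frac12$, and $\mathbb{P}_{\lambda\sim\Lambda}[\lambda\notin\{0,1\}\text{ and }g(\lambda)\ne\frac12]>0$. Let $\lambda_{i,j}$ ($1\le i,j\le n$) be i.i.d. from $\Lambda$, independent of $S$, and $$\tilde x_{i,j}=g(\lambda_{i,j})x_i+(1-g(\lambda_{i,j}))x_j,\qquad \tilde y_{i,j}=\lambda_{i,j}y_i+(1-\lambda_{i,j})y_j.$$ The Mixup loss is $$\mathcal{L}_S^{\mathrm{mix}}(w)=\frac1{n^2}\sum_{i,j=1}^n\big[\tilde y_{i,j}\,l(w^\top\tilde x_{i,j})+(1-\tilde y_{i,j})\,l(-w^\top\tilde x_{i,j})\big],\quad w\in\mathbb{R}^d.$$ For nonzero $u,v\in\mathbb{R}^d$, $\mathrm{sim}(u,v)=\frac{u^\top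 v}{\|u\|\|v\|}$ (the assertion about $\mathrm{sim}$ includes that the minimizer is nonzero). *)

theory Defs
  imports "HOL-Probability.Probability"
begin

definition pos_def :: "real^'d^'d \<Rightarrow> bool" where
  "pos_def A \<longleftrightarrow> transpose A = A \<and> (\<forall>x. x \<noteq> 0 \<longrightarrow> 0 < x \<bullet> (A *v x))"

(* The multivariate normal N(m, A); only meaningful for positive definite A. *)
definition mvnormal :: "real^'d \<Rightarrow> real^'d^'d \<Rightarrow> (real^'d) measure" where
  "mvnormal m A = density lborel (\<lambda>x. ennreal
     (exp (- ((x - m) \<bullet> (matrix_inv A *v (x - m))) / 2) / sqrt ((2 * pi) ^ CARD('d) * det A)))"

(* D_kappa: first draw the label y (a real number, 0 or 1), then x given y. *)
definition data_dist :: "real^'d \<Rightarrow> real^'d^'d \<Rightarrow> real \<Rightarrow> ((real^'d) \<times> real) measure" where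
  "data_dist \<mu> \<Sigma> \<kappa> =
     measure_pmf (pmf_of_set {0, 1}) \<bind>
       (\<lambda>y. distr (mvnormal (if y = 1 then \<mu> else - \<mu>) ((1 / \<kappa>) *\<^sub>R \<Sigma>))
                  (borel \<Otimes>\<^sub>M borel) (\<lambda>x. (x, y)))"

(* Joint law of the training set S (indices 0..n-1) and the mixing coefficients:
   all pairs (x_i, y_i) and all lambda_{i,j} are independent. *)
definition mixup_space ::
  "nat \<Rightarrow> real^'d \<Rightarrow> real^'d^'d \<Rightarrow> real \<Rightarrow> real measure \<Rightarrow>
     ((nat \<Rightarrow> (real^'d) \<times> real) \<times> (nat \<times> nat \<Rightarrow> real)) measure" where
  "mixup_space n \<mu> \<Sigma> \<kappa> \<Lambda> =
     (\<Pi>\<^sub>M i\<in>{..<n}. data_dist \<mu> \<Sigma> \<kappa>) \<Otimes>\<^sub>M (\<Pi>\<^sub>M ij\<in>{..<n} \<times> {..<n}. \<Lambda>)"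

definition logistic_loss :: "real \<Rightarrow> real" where
  "logistic_loss z = ln (1 + exp (- z))"

definition mix_x ::
  "(real \<Rightarrow> real) \<Rightarrow> (nat \<Rightarrow> (real^'d) \<times> real) \<Rightarrow> (nat \<times> nat \<Rightarrow> real) \<Rightarrow> nat \<Rightarrow> nat \<Rightarrow> real^'d" where
  "mix_x g S lam i j = g (lam (i, j)) *\<^sub>R fst (S i) + (1 - g (lam (i, j))) *\<^sub>R fst (S j)"

definition mix_y ::
  "(nat \<Rightarrow> (real^'d) \<times> real) \<Rightarrow> (nat \<times> nat \<Rightarrow> real) \<Rightarrow> nat \<Rightarrow> nat \<Rightarrow> real" where
  "mix_y S lam i j = lam (i, j) * snd (S i) + (1 - lam (i, j)) * snd (S j)"

definition mixup_loss ::
  "(real \<Rightarrow> real) \<Rightarrow> nat \<Rightarrow> (nat \<Rightarrow> (real^'d) \<times> real) \<Rightarrow> (nat \<times> nat \<Rightarrow> real) \<Rightarrow> real^'d \<Rightarrow> real" where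
  "mixup_loss g n S lam w = 1 / (real n)\<^sup>2 *
     (\<Sum>i<n. \<Sum>j<n. mix_y S lam i j * logistic_loss (w \<bullet> mix_x g S lam i j)
                 + (1 - mix_y S lam i j) * logistic_loss (- (w \<bullet> mix_x g S lam i j)))"

definition sim :: "real^'d \<Rightarrow> real^'d \<Rightarrow> real" where
  "sim u v = (u \<bullet> v) / (norm u * norm v)"

end

theory Submission imports Defs begin

text \<open>Write \<open>u = \<Sigma>\<inverse>\<mu>\<close>. The population Mixup gradient at \<open>c u\<close> is a multiple of \<open>\<mu>\<close>, because the reflection
  fixing \<open>\<mu>\<close> preserves both class distributions; its slope along \<open>u\<close> is, up to \<open>O(1 / sqrt \<kappa>)\<close>, that of the
  noiseless problem, which is negative at a small \<open>c0\<close> and positive at a large \<open>c1\<close>, both independent of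
  \<open>\<kappa>\<close>. Hence the population gradient vanishes at some \<open>c u\<close> with \<open>c0 \<le> c \<le> c1\<close>. Near that point the
  empirical loss is strongly convex with constant of order \<open>1/\<kappa>\<close>, as soon as the truncated second
  moments of the mixed points concentrate, and its gradient there is at most of order \<open>\<epsilon>/\<kappa>\<close>; both hold
  outside an event of probability \<open>exp (- \<theta> n \<epsilon>\<^sup>2 / \<kappa>\<^sup>2)\<close> times a constant. So the unique empirical minimizer
  lies within \<open>O(\<epsilon>)\<close> of \<open>c u\<close>. No logarithm of \<open>\<kappa>\<close> is needed.\<close>

section \<open>Gaussian measures under linear maps\<close>

text \<open>The curvature is only of order \<open>1/\<kappa>\<close> because the mixed points
  approach the line spanned by \<mu> as \<kappa> grows: in a direction orthogonal to \<mu> nothing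
  but the noise, of variance of order \<open>1/\<kappa>\<close>, moves them. A gradient error of
  order \<open>\<epsilon>/\<kappa>\<close> is therefore what confines the minimizer to a relative
  distance of order \<epsilon>, and its square is the rate in the exponent. Two obstacles shape the
  concentration argument. The \<open>n * n\<close> terms of the loss share sample points, so they
  are grouped into families of disjoint index pairs, inside which they are independent. The terms
  with \<open>i = j\<close> are not mixed and need not have mean zero at the population critical
  point; they are an error term, \<open>n\<close> of them against \<open>n * n\<close>. Logistic
  curvature is bounded below only for bounded arguments, hence the truncation of the second moments.
  Without mixing, the noiseless loss would decrease along \<open>dir\<close> for ever; pairs with
  opposite labels prevent this through the positive mean \<open>P0\<close> of \<open>gap\<close>,
  and this makes \<open>c1\<close> finite and independent of \<kappa>.\<close>

lemma nn_integral_lborel_shear: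
  fixes f :: "'a::euclidean_space \<Rightarrow> ennreal"
  assumes [measurable]: "f \<in> borel_measurable borel"
    and b: "b \<in> Basis" "e \<in> Basis" "e \<noteq> b"
  shows "(\<integral>\<^sup>+x. f (x + (c * (x \<bullet> e)) *\<^sub>R b) \<partial>lborel) = integral\<^sup>N lborel f"
proof -
  interpret product_sigma_finite "\<lambda>_::'a. lborel::real measure" ..
  define B where "B = Basis - {b}"
  have B: "Basis = insert b B" "b \<notin> B" "finite B" "e \<in> B"
    using b by (auto simp: B_def)
  let ?P = "\<lambda>I. \<Pi>\<^sub>M i\<in>I. (lborel::real measure)"
  have [measurable]: "(\<lambda>x. \<Sum>i\<in>Basis. x i *\<^sub>R i) \<in> ?P Basis \<rightarrow>\<^sub>M (borel :: 'a measure)"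
    by simp
  have expand: "integral\<^sup>N lborel h = (\<integral>\<^sup>+x. \<integral>\<^sup>+y. h ((\<Sum>i\<in>B. x i *\<^sub>R i) + y *\<^sub>R b) \<partial>lborel \<partial>?P B)"
    if [measurable]: "h \<in> borel_measurable borel" for h :: "'a \<Rightarrow> ennreal"
  proof -
    have "integral\<^sup>N lborel h = (\<integral>\<^sup>+x. h (\<Sum>i\<in>Basis. x i *\<^sub>R i) \<partial>?P Basis)"
      by (subst lborel_eq) (simp add: nn_integral_distr)
    also have "\<dots> = (\<integral>\<^sup>+x. \<integral>\<^sup>+y. h (\<Sum>i\<in>Basis. (x(b := y)) i *\<^sub>R i) \<partial>lborel \<partial>?P B)"
      using B(2,3) unfolding B(1) by (subst product_nn_integral_insert) auto
    also have "\<dots> = (\<integral>\<^sup>+x. \<integral>\<^sup>+y. h ((\<Sum>i\<in>B. x i *\<^sub>R i) + y *\<^sub>R b) \<partial>lborel \<partial>?P B)"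
    proof -
      have "(\<Sum>i\<in>Basis. (x(b := y)) i *\<^sub>R i) = y *\<^sub>R b + (\<Sum>i\<in>B. (x(b := y)) i *\<^sub>R i)" for x y
        using B(2,3) unfolding B(1) by simp
      moreover have "(\<Sum>i\<in>B. (x(b := y)) i *\<^sub>R i) = (\<Sum>i\<in>B. x i *\<^sub>R i)" for x y
        using B(2) by (intro sum.cong) auto
      ultimately have "(\<Sum>i\<in>Basis. (x(b := y)) i *\<^sub>R i) = (\<Sum>i\<in>B. x i *\<^sub>R i) + y *\<^sub>R b" for x y
        by (simp add: add.commute)
      then show ?thesis by simp
    qed
    finally show ?thesis .
  qed
  have e_inner: "((\<Sum>i\<in>B. x i *\<^sub>R i) + y *\<^sub>R b) \<bullet> e = x e" for x y
  proof -
    have "((\<Sum>i\<in>B. x i *\<^sub>R i) + y *\<^sub>R b) \<bullet> e = (\<Sum>i\<in>B. x i * (i \<bullet> e)) + y * (b \<bullet> e)"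
      by (simp add: inner_add_left inner_sum_left)
    also have "\<dots> = (\<Sum>i\<in>B. if i = e then x i else 0)"
    proof -
      have "b \<bullet> e = 0" using b by (simp add: inner_Basis)
      moreover have "(\<Sum>i\<in>B. x i * (i \<bullet> e)) = (\<Sum>i\<in>B. if i = e then x i else 0)"
        using b by (intro sum.cong) (auto simp: B_def inner_Basis)
      ultimately show ?thesis by simp
    qed
    also have "\<dots> = x e" using B by simp
    finally show ?thesis .
  qed
  have "(\<integral>\<^sup>+x. f (x + (c * (x \<bullet> e)) *\<^sub>R b) \<partial>lborel) =
     (\<integral>\<^sup>+x. \<integral>\<^sup>+y. f ((\<Sum>i\<in>B. x i *\<^sub>R i) + (c * x e + y) *\<^sub>R b) \<partial>lborel \<partial>?P B)"
    by (subst expand) (simp_all only: e_inner, simp_all add: algebra_simps)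
  also have "\<dots> = (\<integral>\<^sup>+x. \<integral>\<^sup>+y. f ((\<Sum>i\<in>B. x i *\<^sub>R i) + y *\<^sub>R b) \<partial>lborel \<partial>?P B)"
  \<comment> \<open>With the other coordinates fixed, the shear is a translation by
    \<open>c * x e\<close>, which does not involve \<open>y\<close> because
    \<open>e \<noteq> b\<close>; the inner integral is invariant under it.\<close>
  proof (rule nn_integral_cong)
    fix x
    have "(\<integral>\<^sup>+y. f ((\<Sum>i\<in>B. x i *\<^sub>R i) + y *\<^sub>R b) \<partial>lborel) =
       (\<integral>\<^sup>+y. f ((\<Sum>i\<in>B. x i *\<^sub>R i) + y *\<^sub>R b) \<partial>distr lborel borel ((+) (c * x e)))"
      by (simp add: lborel_distr_plus)
    then show "(\<integral>\<^sup>+y. f ((\<Sum>i\<in>B. x i *\<^sub>R i) + (c * x e + y) *\<^sub>R b) \<partial>lborel) =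
       (\<integral>\<^sup>+y. f ((\<Sum>i\<in>B. x i *\<^sub>R i) + y *\<^sub>R b) \<partial>lborel)"
      by (simp add: nn_integral_distr)
  qed
  also have "\<dots> = integral\<^sup>N lborel f" by (rule expand[symmetric]) simp
  finally show ?thesis .
qed

lemma borel_measurable_matrix_vector_mult [measurable]:
  fixes A :: "real^'n^'m"
  shows "f \<in> borel_measurable M \<Longrightarrow> (\<lambda>x. A *v f x) \<in> borel_measurable M"
  by (rule measurable_compose[where N=borel])
     (auto intro!: borel_measurable_continuous_onI linear_continuous_on matrix_vector_mul_bounded_linear)

text \<open>Induction over elementary matrices: a swap permutes coordinates, a diagonal matrix
  rescales them, and the remaining case is the shear above. The predicate \<open>P\<close>
  quantifies over all integrands, because the factor \<open>B\<close> of a product is applied to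
  \<open>f\<close> composed with \<open>A\<close>, and it carries \<open>det A \<noteq> 0\<close> as
  a premise, which makes the case of a zero row vacuous.\<close>

lemma nn_integral_lborel_matrix:
  fixes A :: "real^'n^'n" and f :: "real^'n \<Rightarrow> ennreal"
  assumes "f \<in> borel_measurable borel" "det A \<noteq> 0"
  shows "ennreal \<bar>det A\<bar> * (\<integral>\<^sup>+x. f (A *v x) \<partial>lborel) = integral\<^sup>N lborel f"
proof -
  define P :: "real^'n^'n \<Rightarrow> bool" where "P A \<longleftrightarrow> (det A \<noteq> 0 \<longrightarrow> (\<forall>f\<in>borel_measurable borel.
     ennreal \<bar>det A\<bar> * (\<integral>\<^sup>+x. f (A *v x) \<partial>lborel) = integral\<^sup>N lborel f))" for A
  have "P A"
  proof (rule induct_matrix_elementary)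
    fix A B assume AB: "P A" "P B"
    show "P (A ** B)" unfolding P_def
    proof (intro impI ballI)
      fix f :: "real^'n \<Rightarrow> ennreal" assume d: "det (A ** B) \<noteq> 0" and [measurable]: "f \<in> borel_measurable borel"
      have "ennreal \<bar>det (A ** B)\<bar> * (\<integral>\<^sup>+x. f ((A ** B) *v x) \<partial>lborel) =
         ennreal \<bar>det A\<bar> * (ennreal \<bar>det B\<bar> * (\<integral>\<^sup>+x. f (A *v (B *v x)) \<partial>lborel))"
        by (simp add: det_mul abs_mult ennreal_mult matrix_vector_mul_assoc mult.assoc)
      also have "ennreal \<bar>det B\<bar> * (\<integral>\<^sup>+x. f (A *v (B *v x)) \<partial>lborel) = (\<integral>\<^sup>+x. f (A *v x) \<partial>lborel)"
        using AB(2) d unfolding P_def by (auto simp: det_mul)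
      also have "ennreal \<bar>det A\<bar> * \<dots> = integral\<^sup>N lborel f"
        using AB(1) d unfolding P_def by (auto simp: det_mul)
      finally show "ennreal \<bar>det (A ** B)\<bar> * (\<integral>\<^sup>+x. f ((A ** B) *v x) \<partial>lborel) = integral\<^sup>N lborel f" .
    qed
  next
    fix A :: "real^'n^'n" and i assume "row i A = 0"
    then show "P A" by (simp add: P_def det_zero_row)
  next
    fix A :: "real^'n^'n" assume A: "\<And>i j. i \<noteq> j \<Longrightarrow> A $ i $ j = 0"
    show "P A" unfolding P_def
    proof (intro impI ballI)
      fix f :: "real^'n \<Rightarrow> ennreal" assume d: "det A \<noteq> 0" and [measurable]: "f \<in> borel_measurable borel"
      have det: "det A = (\<Prod>i\<in>UNIV. A $ i $ i)" using A by (rule det_diagonal)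
      define c where "c = (\<lambda>b::real^'n. b \<bullet> (A *v b))"
      have c_axis: "c (axis i 1) = A $ i $ i" for i
        by (simp add: c_def inner_axis' matrix_vector_mult_basis column_def)
      have cnz: "c j \<noteq> 0" if "j \<in> Basis" for j
        using that d unfolding det by (auto simp: Basis_vec_def c_axis)
      have prod: "(\<Prod>j\<in>Basis. \<bar>c j\<bar>) = \<bar>det A\<bar>"
      proof -
        have eqB: "(Basis :: (real^'n) set) = (\<lambda>i. axis i 1) ` UNIV" by (auto simp: Basis_vec_def)
        have inj: "inj (\<lambda>i::'n. axis i (1::real))" by (auto simp: inj_on_def axis_eq_axis)
        have "(\<Prod>j\<in>Basis. \<bar>c j\<bar>) = (\<Prod>i\<in>UNIV. \<bar>A $ i $ i\<bar>)"
          unfolding eqB by (simp add: prod.reindex[OF inj] c_axis)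
        then show ?thesis by (simp add: det abs_prod)
      qed
      have mv: "A *v x = 0 + (\<Sum>j\<in>Basis. (c j * (x \<bullet> j)) *\<^sub>R j)" for x
      proof -
        have eqB: "(Basis :: (real^'n) set) = (\<lambda>i. axis i 1) ` UNIV" by (auto simp: Basis_vec_def)
        have inj: "inj (\<lambda>i::'n. axis i (1::real))" by (auto simp: inj_on_def axis_eq_axis)
        have "(\<Sum>j\<in>Basis. (c j * (x \<bullet> j)) *\<^sub>R j) = (\<Sum>i\<in>UNIV. (A $ i $ i * x $ i) *\<^sub>R axis i 1)"
          unfolding eqB by (simp add: sum.reindex[OF inj] c_axis inner_axis)
        also have "\<dots> = A *v x"
        proof -
          have "(\<Sum>j\<in>UNIV. A $ i $ j * x $ j) = A $ i $ i * x $ i" for i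
            by (subst sum.remove[of _ i]) (auto simp: A)
          then show ?thesis
            by (auto simp: vec_eq_iff matrix_vector_mult_def axis_def if_distrib cong: if_cong)
        qed
        finally show ?thesis by simp
      qed
      have "integral\<^sup>N lborel f = (\<integral>\<^sup>+x. f x \<partial>density (distr lborel borel (\<lambda>x. 0 + (\<Sum>j\<in>Basis. (c j * (x \<bullet> j)) *\<^sub>R j))) (\<lambda>_. (\<Prod>j\<in>Basis. \<bar>c j\<bar>)))"
        by (subst lborel_affine_euclidean[where c=c and t=0, OF cnz]) auto
      also have "\<dots> = ennreal \<bar>det A\<bar> * (\<integral>\<^sup>+x. f (A *v x) \<partial>lborel)"
        unfolding prod mv by (simp add: nn_integral_density nn_integral_distr nn_integral_cmult)
      finally show "ennreal \<bar>det A\<bar> * (\<integral>\<^sup>+x. f (A *v x) \<partial>lborel) = integral\<^sup>N lborel f" by simp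
    qed
  next
    fix m n :: 'n assume mn: "m \<noteq> n"
    let ?\<tau> = "Transposition.transpose m n"
    let ?S = "\<chi> i j. (mat 1 :: real^'n^'n) $ i $ ?\<tau> j"
    have mv: "?S *v x = (\<chi> i. x $ ?\<tau> i)" for x :: "real^'n"
    proof -
      have "(\<Sum>j\<in>UNIV. (mat 1 :: real^'n^'n) $ i $ ?\<tau> j * x $ j) = (\<Sum>j\<in>UNIV. if j = ?\<tau> i then x $ j else 0)" for i
        by (rule sum.cong) (auto simp: mat_def)
      then show ?thesis by (simp add: matrix_vector_mult_def)
    qed
    have det: "\<bar>det ?S\<bar> = 1"
    proof -
      have "det ?S = of_int (sign ?\<tau>) * det (mat 1 :: real^'n^'n)"
        by (rule det_permute_columns) (auto intro: permutes_swap_id)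
      then show ?thesis by (simp add: sign_swap_id mn)
    qed
    have "(\<lambda>x. ?S *v x) \<in> borel \<rightarrow>\<^sub>M borel"
      by (rule borel_measurable_matrix_vector_mult) simp
    then have h [measurable]: "(\<lambda>x::real^'n. \<chi> i. x $ ?\<tau> i) \<in> borel \<rightarrow>\<^sub>M borel"
      by (simp only: mv)
    have "lborel = distr lborel borel (\<lambda>x::real^'n. \<chi> i. x $ ?\<tau> i)" (is "_ = distr _ _ ?h")
    proof (rule lborel_eqI)
      fix l u :: "real^'n" assume le: "\<And>b. b \<in> Basis \<Longrightarrow> l \<bullet> b \<le> u \<bullet> b"
      have le': "l $ i \<le> u $ i" for i using le[of "axis i 1"] by (simp add: inner_axis)
      have "?h -` box l u = box (?h l) (?h u)"
      proof (intro set_eqI iffI)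
        fix x assume "x \<in> ?h -` box l u"
        then have "l $ ?\<tau> i < ?h x $ ?\<tau> i \<and> ?h x $ ?\<tau> i < u $ ?\<tau> i" for i
          by (simp only: vimage_eq mem_box_cart)
        then show "x \<in> box (?h l) (?h u)" by (simp add: mem_box_cart)
      next
        fix x assume "x \<in> box (?h l) (?h u)"
        then have "l $ ?\<tau> (?\<tau> i) < x $ ?\<tau> i \<and> x $ ?\<tau> i < u $ ?\<tau> (?\<tau> i)" for i
          unfolding mem_box_cart by (metis vec_lambda_beta)
        then show "x \<in> ?h -` box l u" by (simp add: mem_box_cart)
      qed
      then have "emeasure (distr lborel borel ?h) (box l u) = emeasure lborel (box (?h l) (?h u))"
        by (subst emeasure_distr) auto
      also have "\<dots> = ennreal (\<Prod>b\<in>Basis. (?h u - ?h l) \<bullet> b)"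
        by (subst emeasure_lborel_box) (auto simp: Basis_vec_def inner_axis le')
      also have "(\<Prod>b\<in>Basis. (?h u - ?h l) \<bullet> b) = (\<Prod>b\<in>Basis. (u - l) \<bullet> b)"
      proof -
        have eqB: "(Basis :: (real^'n) set) = (\<lambda>i. axis i 1) ` UNIV" by (auto simp: Basis_vec_def)
        have inj: "inj (\<lambda>i::'n. axis i (1::real))" by (auto simp: inj_on_def axis_eq_axis)
        have "(\<Prod>i\<in>UNIV. u $ ?\<tau> i - l $ ?\<tau> i) = (\<Prod>i\<in>UNIV. u $ i - l $ i)"
          by (rule prod.reindex_bij_betw) (auto intro: bij_transpose)
        then show ?thesis unfolding eqB by (simp add: prod.reindex[OF inj] inner_axis)
      qed
      finally show "emeasure (distr lborel borel ?h) (box l u) = ennreal (\<Prod>b\<in>Basis. (u - l) \<bullet> b)" .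
    qed simp
    note eq = this
    have "(\<integral>\<^sup>+x. f (?S *v x) \<partial>lborel) = integral\<^sup>N lborel f"
      if [measurable]: "f \<in> borel_measurable borel" for f :: "real^'n \<Rightarrow> ennreal"
      unfolding mv by (subst (2) eq) (rule nn_integral_distr[symmetric], simp_all)
    then show "P ?S" unfolding P_def det by simp
  next
    fix m n :: 'n and c assume mn: "m \<noteq> n"
    let ?S = "(\<chi> i j. if i = m \<and> j = n then c else of_bool (i = j)) :: real^'n^'n"
    have mv: "?S *v x = x + (c * (x \<bullet> axis n 1)) *\<^sub>R axis m 1" for x :: "real^'n"
    proof -
      have "(\<Sum>j\<in>UNIV. (if i = m \<and> j = n then c else of_bool (i = j)) * x $ j) =
          (\<Sum>j\<in>UNIV. (if j = i then x $ j else 0) + (if j = n then (if i = m then c * x $ j else 0) else 0))" for i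
        using mn by (intro sum.cong) auto
      moreover have "x \<bullet> axis n 1 = x $ n" by (simp add: inner_axis)
      ultimately show ?thesis
        by (auto simp: vec_eq_iff matrix_vector_mult_def sum.distrib axis_def)
    qed
    have "det ?S = 1"
    proof -
      have "?S = (\<chi> k. if k = m then row m (mat 1) + c *s row n (mat 1) else row k (mat 1))"
        using mn by (auto simp: vec_eq_iff row_def mat_def)
      then have "det ?S = det (mat 1 :: real^'n^'n)"
        using det_row_operation[OF mn, of "mat 1" c] by simp
      then show ?thesis by simp
    qed
    then show "P ?S" unfolding P_def mv using mn
      by (auto intro!: nn_integral_lborel_shear simp: axis_eq_axis Basis_vec_def)
  qed
  then show ?thesis using assms by (simp add: P_def)
qed

section \<open>Positive definite matrices and their factors\<close>

lemma inner_symmetric_matrix: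
  fixes A :: "real^'n^'n"
  assumes "transpose A = A"
  shows "x \<bullet> (A *v y) = y \<bullet> (A *v x)"
  by (metis assms dot_lmul_matrix inner_commute vector_transpose_matrix)

text \<open>Gram-Schmidt for the inner product of \<open>A\<close>, over growing subsets of the
  index type. A new vector exists as long as an index is left, since fewer than
  \<open>CARD('n)\<close> vectors cannot span the space.\<close>

lemma pos_def_orthonormal:
  fixes A :: "real^'n^'n"
  assumes A: "pos_def A" and "finite I"
  shows "\<exists>f :: 'n \<Rightarrow> real^'n. \<forall>i\<in>I. \<forall>j\<in>I. f i \<bullet> (A *v f j) = (if i = j then 1 else 0)"
  using \<open>finite I\<close>
proof (induction I rule: finite_induct)
  case (insert k I)
  then obtain f where f: "\<And>i j. i \<in> I \<Longrightarrow> j \<in> I \<Longrightarrow> f i \<bullet> (A *v f j) = (if i = j then 1 else 0)"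
    by blast
  have sym: "x \<bullet> (A *v y) = y \<bullet> (A *v x)" for x y
    using A by (intro inner_symmetric_matrix) (simp add: pos_def_def)
  have "card (f ` I) < DIM(real^'n)"
  proof -
    have "card (f ` I) \<le> card I" using insert.hyps by (simp add: card_image_le)
    also have "card I < CARD('n)"
      using insert.hyps by (intro psubset_card_mono) auto
    finally show ?thesis by simp
  qed
  then have "dim (f ` I) < DIM(real^'n)"
    using dim_le_card'[of "f ` I"] insert.hyps(1) by simp
  then have "span (f ` I) \<noteq> UNIV"
    using dim_span[of "f ` I"] dim_UNIV[where 'a="real^'n"] by force
  then obtain x where x: "x \<notin> span (f ` I)" by blast
  define y where "y = x - (\<Sum>j\<in>I. (f j \<bullet> (A *v x)) *\<^sub>R f j)"
  have "(\<Sum>j\<in>I. (f j \<bullet> (A *v x)) *\<^sub>R f j) \<in> span (f ` I)"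
    by (intro span_sum span_scale span_base) auto
  then have "y \<noteq> 0" using x by (auto simp: y_def)
  then have N: "0 < y \<bullet> (A *v y)" using A by (simp add: pos_def_def)
  have orth: "f i \<bullet> (A *v y) = 0" if "i \<in> I" for i
  proof -
    have "f i \<bullet> (A *v y) = f i \<bullet> (A *v x) - (\<Sum>j\<in>I. (f j \<bullet> (A *v x)) * (f i \<bullet> (A *v f j)))"
      by (simp add: y_def matrix_vector_mult_diff_distrib matrix_vector_mult_scaleR
          linear_sum[OF matrix_vector_mul_linear] inner_diff_right inner_sum_right)
    also have "(\<Sum>j\<in>I. (f j \<bullet> (A *v x)) * (f i \<bullet> (A *v f j))) = (\<Sum>j\<in>I. if j = i then f j \<bullet> (A *v x) else 0)"
      using that by (intro sum.cong) (auto simp: f)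
    also have "\<dots> = f i \<bullet> (A *v x)" using that insert.hyps by simp
    finally show ?thesis by simp
  qed
  then have orth': "y \<bullet> (A *v f i) = 0" if "i \<in> I" for i
    using sym[of y "f i"] that by simp
  define g where "g = f(k := (1 / sqrt (y \<bullet> (A *v y))) *\<^sub>R y)"
  have "g i \<bullet> (A *v g j) = (if i = j then 1 else 0)" if "i \<in> insert k I" "j \<in> insert k I" for i j
  proof -
    have "((1 / sqrt (y \<bullet> (A *v y))) *\<^sub>R y) \<bullet> (A *v ((1 / sqrt (y \<bullet> (A *v y))) *\<^sub>R y)) = 1"
      using N by (simp add: matrix_vector_mult_scaleR)
    then show ?thesis
      using that insert.hyps f orth orth'
      by (auto simp: g_def matrix_vector_mult_scaleR)
  qed
  then show ?case by blast
qed auto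

lemma matrix_inv_unique:
  fixes A B :: "real^'n^'n"
  assumes "A ** B = mat 1"
  shows "matrix_inv A = B"
proof -
  have BA: "B ** A = mat 1" using assms by (simp add: matrix_left_right_inverse)
  have "\<exists>A'. A ** A' = mat 1 \<and> A' ** A = mat 1" using assms BA by blast
  from someI_ex[OF this] have "A ** matrix_inv A = mat 1" unfolding matrix_inv_def by blast
  then have "B ** (A ** matrix_inv A) = B" by simp
  then show ?thesis by (simp add: matrix_mul_assoc BA)
qed

lemma invertible_matrix_inv:
  fixes A :: "real^'n^'n"
  assumes "invertible A"
  shows "A ** matrix_inv A = mat 1" "matrix_inv A ** A = mat 1"
proof -
  obtain B where "A ** B = mat 1" "B ** A = mat 1" using assms by (auto simp: invertible_def)
  then show "A ** matrix_inv A = mat 1" "matrix_inv A ** A = mat 1"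
    by (simp_all add: matrix_inv_unique)
qed

text \<open>With an \<open>A\<close>-orthonormal basis as the columns of \<open>T\<close>,
  \<open>transpose T ** (A ** T)\<close> is the identity, so the inverse of
  \<open>transpose T\<close> is a factor. Any factor will do, as the normal law built from it
  depends on \<open>C ** transpose C\<close> only.\<close>

lemma pos_def_factor:
  fixes A :: "real^'n^'n"
  assumes A: "pos_def A"
  obtains C :: "real^'n^'n" where "invertible C" "C ** transpose C = A"
proof -
  obtain f :: "'n \<Rightarrow> real^'n" where f: "\<And>i j. f i \<bullet> (A *v f j) = (if i = j then 1 else 0)"
    using pos_def_orthonormal[OF A, of UNIV] by auto
  define T :: "real^'n^'n" where "T = transpose (\<chi> i. f i)"
  have Tcol: "T *v axis j 1 = f j" for j
    by (simp add: T_def matrix_vector_mult_basis row_def vec_eq_iff)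
  have TAT: "transpose T ** (A ** T) = mat 1"
  proof -
    have "(transpose T ** (A ** T)) $ i $ j = mat 1 $ i $ j" for i j
    proof -
      have "(transpose T ** (A ** T)) $ i $ j = axis i 1 \<bullet> ((transpose T ** (A ** T)) *v axis j 1)"
        by (simp add: inner_axis' matrix_vector_mult_basis column_def)
      also have "\<dots> = (T *v axis i 1) \<bullet> (A *v (T *v axis j 1))"
        by (metis dot_lmul_matrix matrix_vector_mul_assoc vector_transpose_matrix)
      finally show ?thesis by (simp add: Tcol f mat_def)
    qed
    then show ?thesis by (simp add: vec_eq_iff)
  qed
  have invT: "invertible T" "invertible (transpose T)"
  proof -
    show "invertible (transpose T)" using TAT by (auto simp: invertible_right_inverse)
    then show "invertible T" using transpose_invertible[of "transpose T"] by simp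
  qed
  define C where "C = matrix_inv (transpose T)"
  have C: "C ** transpose T = mat 1" "transpose T ** C = mat 1"
    unfolding C_def using invertible_matrix_inv[OF invT(2)] by auto
  have C': "T ** transpose C = mat 1"
    by (metis C(1) matrix_transpose_mul transpose_mat transpose_transpose)
  have "A = (C ** transpose T) ** A ** (T ** transpose C)" by (simp add: C C')
  also have "\<dots> = C ** (transpose T ** (A ** T)) ** transpose C" by (simp add: matrix_mul_assoc)
  finally have "C ** transpose C = A" by (simp add: TAT)
  moreover have "invertible C" using C by (auto simp: invertible_def)
  ultimately show ?thesis using that by blast
qed

section \<open>The multivariate normal law as an affine image of the standard one\<close>

lemma sets_mvnormal [measurable_cong, simp]: "sets (mvnormal m A) = sets borel"
  by (simp add: mvnormal_def)

lemma space_mvnormal [simp]: "space (mvnormal m A) = UNIV"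
  by (simp add: mvnormal_def)

abbreviation std_mvnormal :: "(real^'n) measure" where
  "std_mvnormal \<equiv> mvnormal 0 (mat 1)"

lemma std_mvnormal_eq:
  "std_mvnormal = density lborel (\<lambda>x::real^'n. ennreal (exp (- (x \<bullet> x) / 2) / sqrt ((2 * pi) ^ CARD('n))))"
  by (simp add: mvnormal_def matrix_inv_unique[of "mat 1" "mat 1"])

text \<open>The substitution \<open>x = m + C *v u\<close> turns the quadratic form of the inverse
  covariance into \<open>u \<bullet> u\<close>, and the Jacobian \<open>\<bar>det C\<bar>\<close>
  cancels against the square root of \<open>det (C ** transpose C)\<close>. Every later estimate on
  \<open>mvnormal\<close> passes through this lemma.\<close>

lemma mvnormal_eq_distr:
  fixes C :: "real^'n^'n"
  assumes C: "invertible C"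
  shows "mvnormal m (C ** transpose C) = distr std_mvnormal borel (\<lambda>u. m + C *v u)"
proof (rule measure_eqI)
  fix X assume "X \<in> sets (mvnormal m (C ** transpose C))"
  then have [measurable]: "X \<in> sets borel" by simp
  define p where "p = (\<lambda>x. ennreal
     (exp (- ((x - m) \<bullet> (matrix_inv (C ** transpose C) *v (x - m))) / 2) / sqrt ((2 * pi) ^ CARD('n) * det (C ** transpose C))))"
  have [measurable]: "p \<in> borel_measurable borel"
    unfolding p_def by measurable
  have d: "det C \<noteq> 0" using C by (simp add: invertible_det_nz)
  define D where "D = matrix_inv C"
  have D: "D ** C = mat 1" "C ** D = mat 1" using invertible_matrix_inv[OF C] by (auto simp: D_def)
  have "transpose C ** transpose D = mat 1" by (metis D(1) matrix_transpose_mul transpose_mat)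
  then have inv: "matrix_inv (C ** transpose C) = transpose D ** D"
    by (intro matrix_inv_unique) (metis D(2) matrix_mul_assoc matrix_mul_rid)
  have quad: "(C *v u) \<bullet> (matrix_inv (C ** transpose C) *v (C *v u)) = u \<bullet> u" for u
  proof -
    have "(C *v u) \<bullet> ((transpose D ** D) *v (C *v u)) = (D *v (C *v u)) \<bullet> (D *v (C *v u))"
      by (metis dot_lmul_matrix matrix_vector_mul_assoc transpose_transpose vector_transpose_matrix)
    also have "D *v (C *v u) = u" by (simp add: matrix_vector_mul_assoc D)
    finally show ?thesis by (simp add: inv)
  qed
  have dens: "ennreal \<bar>det C\<bar> * p (m + C *v u) = ennreal (exp (- (u \<bullet> u) / 2) / sqrt ((2 * pi) ^ CARD('n)))" for u
    using d by (simp add: p_def quad det_mul ennreal_mult[symmetric] real_sqrt_mult)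
  have "emeasure (mvnormal m (C ** transpose C)) X = (\<integral>\<^sup>+x. p x * indicator X x \<partial>lborel)"
    unfolding mvnormal_def p_def[symmetric] by (rule emeasure_density) auto
  also have "\<dots> = (\<integral>\<^sup>+x. p x * indicator X x \<partial>distr lborel borel ((+) m))"
    by (simp add: lborel_distr_plus)
  also have "\<dots> = (\<integral>\<^sup>+x. p (m + x) * indicator X (m + x) \<partial>lborel)"
    by (subst nn_integral_distr) auto
  also have "\<dots> = ennreal \<bar>det C\<bar> * (\<integral>\<^sup>+x. p (m + C *v x) * indicator X (m + C *v x) \<partial>lborel)"
    by (rule nn_integral_lborel_matrix[symmetric]) (use d in auto)
  also have "\<dots> = (\<integral>\<^sup>+x. (ennreal \<bar>det C\<bar> * p (m + C *v x)) * indicator X (m + C *v x) \<partial>lborel)"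
    by (simp add: nn_integral_cmult mult.assoc)
  also have "\<dots> = (\<integral>\<^sup>+x. indicator X (m + C *v x) \<partial>std_mvnormal)"
    unfolding std_mvnormal_eq dens by (subst nn_integral_density) auto
  also have "\<dots> = (\<integral>\<^sup>+x. indicator X x \<partial>distr std_mvnormal borel (\<lambda>u. m + C *v u))"
    by (subst nn_integral_distr) auto
  finally show "emeasure (mvnormal m (C ** transpose C)) X = emeasure (distr std_mvnormal borel (\<lambda>u. m + C *v u)) X"
    by simp
qed simp

lemma nn_integral_gaussian:
  fixes \<sigma> :: real
  assumes "0 < \<sigma>"
  shows "(\<integral>\<^sup>+(x::real^'n). ennreal (exp (- (x \<bullet> x) / (2 * \<sigma>\<^sup>2))) \<partial>lborel) = ennreal (sqrt ((2 * pi * \<sigma>\<^sup>2) ^ CARD('n)))"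
proof -
  have one: "(\<integral>\<^sup>+t. ennreal (exp (- t\<^sup>2 / (2 * \<sigma>\<^sup>2))) \<partial>lborel) = ennreal (sqrt (2 * pi * \<sigma>\<^sup>2))"
  proof -
    have "(\<integral>\<^sup>+t. ennreal (exp (- t\<^sup>2 / (2 * \<sigma>\<^sup>2))) \<partial>lborel) = (\<integral>\<^sup>+t. ennreal (sqrt (2 * pi * \<sigma>\<^sup>2)) * ennreal (normal_density 0 \<sigma> t) \<partial>lborel)"
      using assms by (intro nn_integral_cong) (simp add: normal_density_def ennreal_mult[symmetric])
    also have "\<dots> = ennreal (sqrt (2 * pi * \<sigma>\<^sup>2)) * (\<integral>\<^sup>+t. ennreal (normal_density 0 \<sigma> t) \<partial>lborel)"
      by (rule nn_integral_cmult) simp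
    also have "(\<integral>\<^sup>+t. ennreal (normal_density 0 \<sigma> t) \<partial>lborel) = 1"
      using assms by (subst nn_integral_eq_integral) auto
    finally show ?thesis by simp
  qed
  have "(\<integral>\<^sup>+(x::real^'n). ennreal (exp (- (x \<bullet> x) / (2 * \<sigma>\<^sup>2))) \<partial>lborel) =
      (\<integral>\<^sup>+(x::real^'n). (\<Prod>b\<in>Basis. ennreal (exp (- (x \<bullet> b)\<^sup>2 / (2 * \<sigma>\<^sup>2)))) \<partial>lborel)"
    by (intro nn_integral_cong)
      (simp add: prod_ennreal exp_sum[symmetric] sum_negf sum_divide_distrib[symmetric] euclidean_inner[of x x for x] power2_eq_square)
  also have "\<dots> = (\<Prod>b\<in>(Basis::(real^'n) set). \<integral>\<^sup>+t. ennreal (exp (- t\<^sup>2 / (2 * \<sigma>\<^sup>2))) \<partial>lborel)"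
    by (rule nn_integral_lborel_prod) auto
  also have "\<dots> = ennreal (sqrt (2 * pi * \<sigma>\<^sup>2)) ^ CARD('n)"
    unfolding one by simp
  finally show ?thesis by (simp add: ennreal_power real_sqrt_power)
qed

lemma prob_space_std_mvnormal: "prob_space (std_mvnormal :: (real^'n) measure)"
proof
  have "emeasure (std_mvnormal :: (real^'n) measure) UNIV =
     (\<integral>\<^sup>+(x::real^'n). ennreal (1 / sqrt ((2 * pi) ^ CARD('n))) * ennreal (exp (- (x \<bullet> x) / 2)) \<partial>lborel)"
    unfolding std_mvnormal_eq by (subst emeasure_density) (auto simp: ennreal_mult[symmetric])
  also have "\<dots> = ennreal (1 / sqrt ((2 * pi) ^ CARD('n))) * ennreal (sqrt ((2 * pi) ^ CARD('n)))"
    using nn_integral_gaussian[where 'n='n, of 1] by (subst nn_integral_cmult) auto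
  also have "\<dots> = 1" by (simp add: ennreal_mult[symmetric])
  finally show "emeasure (std_mvnormal :: (real^'n) measure) (space std_mvnormal) = 1" by simp
qed

text \<open>Since \<open>(a - norm u / 2)^2\<close> is nonnegative, half of the Gaussian exponent
  absorbs \<open>a * norm u\<close> at the price of \<open>a^2\<close>; what remains is a Gaussian
  of variance 2.\<close>

lemma std_mvnormal_exp_moment:
  fixes a :: real
  obtains K where "0 < K" "(\<integral>\<^sup>+(u::real^'n). ennreal (exp (a * norm u)) \<partial>std_mvnormal) \<le> ennreal K"
proof -
  define c where "c = sqrt ((2 * pi) ^ CARD('n))"
  have c: "0 < c" by (simp add: c_def)
  have "(\<integral>\<^sup>+(u::real^'n). ennreal (exp (a * norm u)) \<partial>std_mvnormal) =
     (\<integral>\<^sup>+(u::real^'n). ennreal (exp (- (u \<bullet> u) / 2) / c) * ennreal (exp (a * norm u)) \<partial>lborel)"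
    unfolding std_mvnormal_eq c_def by (subst nn_integral_density) auto
  also have "\<dots> \<le> (\<integral>\<^sup>+(u::real^'n). ennreal (exp (a\<^sup>2) / c) * ennreal (exp (- (u \<bullet> u) / (2 * (sqrt 2)\<^sup>2))) \<partial>lborel)"
  proof (intro nn_integral_mono)
    fix u :: "real^'n"
    have "0 \<le> (a - norm u / 2)\<^sup>2" by simp
    then have "- (u \<bullet> u) / 2 + a * norm u \<le> a\<^sup>2 - (u \<bullet> u) / 4"
      by (simp add: power2_eq_square algebra_simps power2_norm_eq_inner[symmetric])
    then have "exp (- (u \<bullet> u) / 2 + a * norm u) \<le> exp (a\<^sup>2 - (u \<bullet> u) / 4)" by simp
    then have "exp (- (u \<bullet> u) / 2) / c * exp (a * norm u) \<le> exp (a\<^sup>2) / c * exp (- (u \<bullet> u) / (2 * (sqrt 2)\<^sup>2))"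
      using c by (simp add: exp_add[symmetric] divide_right_mono)
    then show "ennreal (exp (- (u \<bullet> u) / 2) / c) * ennreal (exp (a * norm u)) \<le>
       ennreal (exp (a\<^sup>2) / c) * ennreal (exp (- (u \<bullet> u) / (2 * (sqrt 2)\<^sup>2)))"
      using c by (simp add: ennreal_mult[symmetric] del: real_sqrt_pow2 real_sqrt_power)
  qed
  also have "\<dots> = ennreal (exp (a\<^sup>2) / c) * ennreal (sqrt ((2 * pi * (sqrt 2)\<^sup>2) ^ CARD('n)))"
    using nn_integral_gaussian[where 'n='n, of "sqrt 2"] by (subst nn_integral_cmult) auto
  also have "\<dots> = ennreal (exp (a\<^sup>2) / c * sqrt ((2 * pi * (sqrt 2)\<^sup>2) ^ CARD('n)))"
    using c by (simp add: ennreal_mult[symmetric])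
  finally show ?thesis using c by (intro that[of "exp (a\<^sup>2) / c * sqrt ((2 * pi * (sqrt 2)\<^sup>2) ^ CARD('n))"]) auto
qed

text \<open>A bound uniform in the direction: inside the ball \<open>norm x \<le> 3/2\<close>, so
  the density is at least its value at that radius, whence the exponent \<open>9 / 8\<close>. It
  later gives every direction a fixed share of the noise.\<close>

lemma std_mvnormal_ball:
  obtains q where "0 < q" "\<And>v::real^'n. norm v = 1 \<Longrightarrow> q \<le> measure std_mvnormal (ball v (1/2))"
proof -
  interpret prob_space "std_mvnormal :: (real^'n) measure" by (rule prob_space_std_mvnormal)
  define c where "c = exp (- 9 / 8) / sqrt ((2 * pi) ^ CARD('n))"
  define V where "V = unit_ball_vol (DIM(real^'n)) * (1/2) ^ DIM(real^'n)"
  have pos: "0 < c" "0 < V" by (auto simp: c_def V_def unit_ball_vol_def)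
  have "c * V \<le> measure std_mvnormal (ball v (1/2))" if "norm v = 1" for v :: "real^'n"
  proof -
    have "ennreal (c * V) = (\<integral>\<^sup>+x. ennreal c * indicator (ball v (1/2)) x \<partial>lborel)"
    proof -
      have "emeasure lborel (ball v (1/2)) = ennreal V" by (simp only: emeasure_ball V_def)
      then show ?thesis using pos by (simp add: ennreal_mult nn_integral_cmult_indicator)
    qed
    also have "\<dots> \<le> (\<integral>\<^sup>+x. ennreal (exp (- (x \<bullet> x) / 2) / sqrt ((2 * pi) ^ CARD('n))) * indicator (ball v (1/2)) x \<partial>lborel)"
    proof (rule nn_integral_mono)
      fix x :: "real^'n"
      show "ennreal c * indicator (ball v (1/2)) x \<le> ennreal (exp (- (x \<bullet> x) / 2) / sqrt ((2 * pi) ^ CARD('n))) * indicator (ball v (1/2)) x"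
      proof (cases "x \<in> ball v (1/2)")
        case True
        have "norm x \<le> norm v + norm (v - x)" by (metis norm_minus_commute norm_triangle_sub)
        also have "\<dots> \<le> 3/2" using True that by (simp add: dist_norm)
        finally have "(norm x)\<^sup>2 \<le> (3/2)\<^sup>2" by (intro power_mono) auto
        then have "x \<bullet> x \<le> 9/4" using power2_norm_eq_inner[of x] by (simp add: power_divide)
        then have "c \<le> exp (- (x \<bullet> x) / 2) / sqrt ((2 * pi) ^ CARD('n))"
          unfolding c_def by (intro divide_right_mono) auto
        then show ?thesis by (intro mult_right_mono ennreal_leI) auto
      qed simp
    qed
    also have "\<dots> = emeasure std_mvnormal (ball v (1/2))"
      unfolding std_mvnormal_eq by (subst emeasure_density) auto
    finally show ?thesis by (simp add: emeasure_eq_measure)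
  qed
  then show ?thesis using pos by (intro that[of "c * V"]) auto
qed

section \<open>The data distribution\<close>

lemma ennreal_add_self_half:
  assumes "0 \<le> a"
  shows "(ennreal a + ennreal a) / 2 = ennreal a"
proof -
  have "(ennreal a + ennreal a) / 2 = ennreal (2 * a) / ennreal 2"
    using assms by (simp flip: ennreal_plus)
  also have "\<dots> = ennreal a" using assms by (subst divide_ennreal) auto
  finally show ?thesis .
qed

text \<open>The noise of both classes is a standard normal vector, mapped by a factor of \<Sigma>
  and scaled by \<open>1 / sqrt \<kappa>\<close>. Thus \<kappa> enters through a scalar only, which
  is what makes the later bounds uniform in \<kappa>. The freedom to take any factor
  \<open>C\<close> is used for the reflection.\<close>

lemma nn_integral_data_dist:
  fixes C :: "real^'d^'d"
  assumes C: "invertible C" and \<kappa>: "0 < \<kappa>"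
    and [measurable]: "f \<in> borel_measurable (borel \<Otimes>\<^sub>M borel)"
  shows "integral\<^sup>N (data_dist \<mu> (C ** transpose C) \<kappa>) f =
    ((\<integral>\<^sup>+u. f (\<mu> + (1 / sqrt \<kappa>) *\<^sub>R (C *v u), 1) \<partial>std_mvnormal) +
     (\<integral>\<^sup>+u. f (- \<mu> + (1 / sqrt \<kappa>) *\<^sub>R (C *v u), 0) \<partial>std_mvnormal)) / 2"
    and "prob_space (data_dist \<mu> (C ** transpose C) \<kappa>)"
    and "sets (data_dist \<mu> (C ** transpose C) \<kappa>) = sets (borel \<Otimes>\<^sub>M borel)"
proof -
  interpret std: prob_space "std_mvnormal :: (real^'d) measure" by (rule prob_space_std_mvnormal)
  define E where "E = (1 / sqrt \<kappa>) *\<^sub>R C"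
  have "invertible E" unfolding E_def using C \<kappa> by (intro scalar_invertible) auto
  have "E ** transpose E = (1 / \<kappa>) *\<^sub>R (C ** transpose C)"
    using \<kappa> by (simp add: E_def transpose_scalar scalar_matrix_assoc[symmetric] matrix_scalar_ac)
  then have mvn: "mvnormal m ((1 / \<kappa>) *\<^sub>R (C ** transpose C)) = distr std_mvnormal borel (\<lambda>u. m + (1 / sqrt \<kappa>) *\<^sub>R (C *v u))" for m
    using mvnormal_eq_distr[OF \<open>invertible E\<close>, of m]
    by (simp add: E_def scaleR_matrix_vector_assoc[symmetric])
  define N where "N = (\<lambda>y::real. distr (mvnormal (if y = 1 then \<mu> else - \<mu>) ((1 / \<kappa>) *\<^sub>R (C ** transpose C)))
                  (borel \<Otimes>\<^sub>M borel) (\<lambda>x. (x, y)))"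
  have N: "N y = distr std_mvnormal (borel \<Otimes>\<^sub>M borel) (\<lambda>u. ((if y = 1 then \<mu> else - \<mu>) + (1 / sqrt \<kappa>) *\<^sub>R (C *v u), y))" for y
    unfolding N_def mvn by (subst distr_distr) (auto simp: o_def)
  have probN: "prob_space (N y)" for y
    unfolding N by (rule std.prob_space_distr) simp
  have setsN: "sets (N y) = sets (borel \<Otimes>\<^sub>M borel)" for y by (simp add: N)
  have D: "data_dist \<mu> (C ** transpose C) \<kappa> = measure_pmf (pmf_of_set {0, 1}) \<bind> N"
    by (simp add: data_dist_def N_def)
  have N_meas: "N \<in> measure_pmf (pmf_of_set {0, 1}) \<rightarrow>\<^sub>M subprob_algebra (borel \<Otimes>\<^sub>M borel)"
    using probN setsN by (auto simp: space_subprob_algebra prob_space_imp_subprob_space)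
  have N_meas': "N \<in> count_space UNIV \<rightarrow>\<^sub>M prob_algebra (borel \<Otimes>\<^sub>M borel)"
    using probN setsN by (auto simp: space_prob_algebra)
  have M: "measure_pmf (pmf_of_set {0, 1::real}) \<in> space (prob_algebra (count_space UNIV))"
    by (auto simp: space_prob_algebra prob_space_measure_pmf)
  have "integral\<^sup>N (data_dist \<mu> (C ** transpose C) \<kappa>) f = (\<integral>\<^sup>+y. \<integral>\<^sup>+z. f z \<partial>N y \<partial>measure_pmf (pmf_of_set {0, 1}))"
    unfolding D by (rule nn_integral_bind) (use N_meas in auto)
  also have "\<dots> = (\<Sum>y\<in>{0, 1}. \<integral>\<^sup>+z. f z \<partial>N y) / 2"
    by (subst nn_integral_pmf_of_set) auto
  also have "\<dots> = ((\<integral>\<^sup>+z. f z \<partial>N 1) + (\<integral>\<^sup>+z. f z \<partial>N 0)) / 2"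
    by (simp add: add.commute)
  finally show "integral\<^sup>N (data_dist \<mu> (C ** transpose C) \<kappa>) f =
    ((\<integral>\<^sup>+u. f (\<mu> + (1 / sqrt \<kappa>) *\<^sub>R (C *v u), 1) \<partial>std_mvnormal) +
     (\<integral>\<^sup>+u. f (- \<mu> + (1 / sqrt \<kappa>) *\<^sub>R (C *v u), 0) \<partial>std_mvnormal)) / 2"
    by (simp add: N nn_integral_distr)
  show "prob_space (data_dist \<mu> (C ** transpose C) \<kappa>)"
    unfolding D using M N_meas' by (rule prob_space_bind')
  show "sets (data_dist \<mu> (C ** transpose C) \<kappa>) = sets (borel \<Otimes>\<^sub>M borel)"
    unfolding D using M N_meas' by (rule sets_bind')
qed

lemma prob_space_data_dist:
  fixes \<Sigma> :: "real^'d^'d"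
  assumes "pos_def \<Sigma>" "0 < \<kappa>"
  shows "prob_space (data_dist \<mu> \<Sigma> \<kappa>)"
proof -
  obtain C :: "real^'d^'d" where "invertible C" "C ** transpose C = \<Sigma>" using pos_def_factor[OF assms(1)] by blast
  then show ?thesis using nn_integral_data_dist(2)[of C \<kappa> "\<lambda>_. 0" \<mu>] assms(2) by auto
qed

lemma sets_data_dist:
  fixes \<Sigma> :: "real^'d^'d"
  assumes "pos_def \<Sigma>" "0 < \<kappa>"
  shows "sets (data_dist \<mu> \<Sigma> \<kappa>) = sets (borel \<Otimes>\<^sub>M borel)"
proof -
  obtain C :: "real^'d^'d" where "invertible C" "C ** transpose C = \<Sigma>" using pos_def_factor[OF assms(1)] by blast
  then show ?thesis using nn_integral_data_dist(3)[of C \<kappa> "\<lambda>_. 0" \<mu>] assms(2) by auto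
qed

lemma nn_integral_data_dist_label:
  fixes \<Sigma> :: "real^'d^'d"
  assumes "pos_def \<Sigma>" "0 < \<kappa>" and [measurable]: "f \<in> borel_measurable borel"
  shows "(\<integral>\<^sup>+z. f (snd z) \<partial>data_dist \<mu> \<Sigma> \<kappa>) = (f 1 + f 0) / 2"
proof -
  interpret std: prob_space "std_mvnormal :: (real^'d) measure" by (rule prob_space_std_mvnormal)
  obtain C :: "real^'d^'d" where "invertible C" "C ** transpose C = \<Sigma>" using pos_def_factor[OF assms(1)] by blast
  then show ?thesis using nn_integral_data_dist(1)[of C \<kappa> "\<lambda>z. f (snd z)" \<mu>] assms(2)
    by (auto simp: std.emeasure_space_1[simplified])
qed

lemma AE_data_dist_label:
  fixes \<Sigma> :: "real^'d^'d"
  assumes "pos_def \<Sigma>" "0 < \<kappa>"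
  shows "AE z in data_dist \<mu> \<Sigma> \<kappa>. snd z = 0 \<or> snd z = 1"
proof -
  have "(\<integral>\<^sup>+z. indicator (- {0, 1}) (snd z) \<partial>data_dist \<mu> \<Sigma> \<kappa>) = 0"
    by (subst nn_integral_data_dist_label[OF assms]) auto
  moreover have "(\<lambda>z. indicator (- {0, 1}) (snd z) :: ennreal) \<in> borel_measurable (data_dist \<mu> \<Sigma> \<kappa>)"
    by (subst measurable_cong_sets[OF sets_data_dist[OF assms] refl]) measurable
  ultimately have "AE z in data_dist \<mu> \<Sigma> \<kappa>. indicator (- {0, 1}) (snd z) = (0::ennreal)"
    by (simp add: nn_integral_0_iff_AE)
  then show ?thesis by eventually_elim (auto simp: indicator_def split: if_splits)
qed

section \<open>Estimates for the data that are uniform in the noise level\<close>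

lemma norm_matrix_vector_le:
  fixes C :: "real^'n^'m"
  obtains c where "0 < c" "\<And>u. norm (C *v u) \<le> c * norm u"
  using bounded_linear.pos_bounded[OF matrix_vector_mul_bounded_linear[of C]]
  by (metis mult.commute)

text \<open>For \<open>1 \<le> \<kappa>\<close> the noise vector is no longer than at
  \<open>\<kappa> = 1\<close>, so one constant serves all \<kappa>.\<close>

lemma data_dist_exp_moment:
  fixes \<Sigma> :: "real^'d^'d"
  assumes \<Sigma>: "pos_def \<Sigma>" and a: "0 \<le> a"
  obtains K where "1 \<le> K" "\<And>\<kappa>. 1 \<le> \<kappa> \<Longrightarrow> (\<integral>\<^sup>+z. ennreal (exp (a * norm (fst z))) \<partial>data_dist \<mu> \<Sigma> \<kappa>) \<le> ennreal K"
proof -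
  obtain C :: "real^'d^'d" where C: "invertible C" "C ** transpose C = \<Sigma>" using pos_def_factor[OF \<Sigma>] by blast
  obtain c where c: "0 < c" "\<And>u. norm (C *v u) \<le> c * norm u" using norm_matrix_vector_le[of C] by blast
  obtain K0 where K0: "0 < K0" "(\<integral>\<^sup>+(u::real^'d). ennreal (exp ((a * c) * norm u)) \<partial>std_mvnormal) \<le> ennreal K0"
    using std_mvnormal_exp_moment[of "a * c"] by blast
  define K where "K = max 1 (exp (a * norm \<mu>) * K0)"
  have "(\<integral>\<^sup>+z. ennreal (exp (a * norm (fst z))) \<partial>data_dist \<mu> \<Sigma> \<kappa>) \<le> ennreal K" if \<kappa>: "1 \<le> \<kappa>" for \<kappa>
  proof -
    have le: "(\<integral>\<^sup>+u. ennreal (exp (a * norm (m + (1 / sqrt \<kappa>) *\<^sub>R (C *v u)))) \<partial>std_mvnormal) \<le> ennreal K"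
      if m: "norm m = norm \<mu>" for m
    proof -
      have "(\<integral>\<^sup>+u. ennreal (exp (a * norm (m + (1 / sqrt \<kappa>) *\<^sub>R (C *v u)))) \<partial>std_mvnormal) \<le>
         (\<integral>\<^sup>+(u::real^'d). ennreal (exp (a * norm \<mu>)) * ennreal (exp ((a * c) * norm u)) \<partial>std_mvnormal)"
      proof (rule nn_integral_mono)
        fix u :: "real^'d"
        have "norm (m + (1 / sqrt \<kappa>) *\<^sub>R (C *v u)) \<le> norm m + norm ((1 / sqrt \<kappa>) *\<^sub>R (C *v u))"
          by (rule norm_triangle_ineq)
        also have "norm ((1 / sqrt \<kappa>) *\<^sub>R (C *v u)) \<le> 1 * norm (C *v u)"
          unfolding norm_scaleR using \<kappa> by (intro mult_right_mono) auto
        also have "\<dots> \<le> c * norm u" using c(2) by simp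
        finally have "a * norm (m + (1 / sqrt \<kappa>) *\<^sub>R (C *v u)) \<le> a * (norm \<mu> + c * norm u)"
          using a m by (intro mult_left_mono) auto
        then show "ennreal (exp (a * norm (m + (1 / sqrt \<kappa>) *\<^sub>R (C *v u)))) \<le> ennreal (exp (a * norm \<mu>)) * ennreal (exp ((a * c) * norm u))"
          by (simp add: ennreal_mult[symmetric] exp_add[symmetric] algebra_simps)
      qed
      also have "\<dots> = ennreal (exp (a * norm \<mu>)) * (\<integral>\<^sup>+(u::real^'d). ennreal (exp ((a * c) * norm u)) \<partial>std_mvnormal)"
        by (rule nn_integral_cmult) measurable
      also have "\<dots> \<le> ennreal (exp (a * norm \<mu>)) * ennreal K0"
        by (intro mult_left_mono K0) simp
      also have "\<dots> \<le> ennreal K" using K0 by (simp add: K_def ennreal_mult[symmetric])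
      finally show ?thesis .
    qed
    have "(\<integral>\<^sup>+z. ennreal (exp (a * norm (fst z))) \<partial>data_dist \<mu> \<Sigma> \<kappa>) \<le> (ennreal K + ennreal K) / 2"
      using nn_integral_data_dist(1)[OF C(1), of \<kappa> "\<lambda>z. ennreal (exp (a * norm (fst z)))" \<mu>] le[of \<mu>] le[of "- \<mu>"] \<kappa>
      unfolding C(2) by (auto intro!: divide_right_mono_ennreal add_mono)
    also have "\<dots> = ennreal K"
      by (rule ennreal_add_self_half) (simp add: K_def)
    finally show ?thesis .
  qed
  then show ?thesis by (intro that[of K]) (auto simp: K_def)
qed

text \<open>\<open>(2 * snd z - 1) *\<^sub>R \<mu>\<close> is the centre of the class of
  \<open>z\<close>, so the integrand is the length of the noise, which scales like
  \<open>1 / sqrt \<kappa>\<close>. Its first moment is bounded by the exponential one.\<close>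

lemma data_dist_noise:
  fixes \<Sigma> :: "real^'d^'d"
  assumes \<Sigma>: "pos_def \<Sigma>"
  obtains K where "0 < K" "\<And>\<kappa>. 1 \<le> \<kappa> \<Longrightarrow> (\<integral>\<^sup>+z. ennreal (norm (fst z - (2 * snd z - 1) *\<^sub>R \<mu>)) \<partial>data_dist \<mu> \<Sigma> \<kappa>) \<le> ennreal (K / sqrt \<kappa>)"
proof -
  obtain C :: "real^'d^'d" where C: "invertible C" "C ** transpose C = \<Sigma>" using pos_def_factor[OF \<Sigma>] by blast
  obtain c where c: "0 < c" "\<And>u. norm (C *v u) \<le> c * norm u" using norm_matrix_vector_le[of C] by blast
  obtain K0 where K0: "0 < K0" "(\<integral>\<^sup>+(u::real^'d). ennreal (exp (c * norm u)) \<partial>std_mvnormal) \<le> ennreal K0"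
    using std_mvnormal_exp_moment[of c] by blast
  have "(\<integral>\<^sup>+z. ennreal (norm (fst z - (2 * snd z - 1) *\<^sub>R \<mu>)) \<partial>data_dist \<mu> \<Sigma> \<kappa>) \<le> ennreal (K0 / sqrt \<kappa>)" if \<kappa>: "1 \<le> \<kappa>" for \<kappa>
  proof -
    have le: "(\<integral>\<^sup>+u. ennreal (norm ((1 / sqrt \<kappa>) *\<^sub>R (C *v u))) \<partial>std_mvnormal) \<le> ennreal (K0 / sqrt \<kappa>)"
    proof -
      have "(\<integral>\<^sup>+u. ennreal (norm ((1 / sqrt \<kappa>) *\<^sub>R (C *v u))) \<partial>std_mvnormal) \<le>
         (\<integral>\<^sup>+(u::real^'d). ennreal (1 / sqrt \<kappa>) * ennreal (exp (c * norm u)) \<partial>std_mvnormal)"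
      proof (rule nn_integral_mono)
        fix u :: "real^'d"
        have "norm (C *v u) \<le> exp (c * norm u)"
          using c(2)[of u] exp_ge_add_one_self[of "c * norm u"] by linarith
        then show "ennreal (norm ((1 / sqrt \<kappa>) *\<^sub>R (C *v u))) \<le> ennreal (1 / sqrt \<kappa>) * ennreal (exp (c * norm u))"
          using \<kappa> by (simp add: ennreal_mult[symmetric] divide_right_mono)
      qed
      also have "\<dots> = ennreal (1 / sqrt \<kappa>) * (\<integral>\<^sup>+(u::real^'d). ennreal (exp (c * norm u)) \<partial>std_mvnormal)"
        by (rule nn_integral_cmult) measurable
      also have "\<dots> \<le> ennreal (1 / sqrt \<kappa>) * ennreal K0"
        by (intro mult_left_mono K0) simp
      also have "\<dots> = ennreal (K0 / sqrt \<kappa>)" using K0 \<kappa> by (simp add: ennreal_mult[symmetric])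
      finally show ?thesis .
    qed
    have "(\<integral>\<^sup>+z. ennreal (norm (fst z - (2 * snd z - 1) *\<^sub>R \<mu>)) \<partial>data_dist \<mu> \<Sigma> \<kappa>) \<le> (ennreal (K0 / sqrt \<kappa>) + ennreal (K0 / sqrt \<kappa>)) / 2"
      using nn_integral_data_dist(1)[OF C(1), of \<kappa> "\<lambda>z. ennreal (norm (fst z - (2 * snd z - 1) *\<^sub>R \<mu>))" \<mu>] le \<kappa>
      unfolding C(2) by (auto intro!: divide_right_mono_ennreal add_mono)
    also have "\<dots> = ennreal (K0 / sqrt \<kappa>)"
      using K0 \<kappa> by (intro ennreal_add_self_half) simp
    finally show ?thesis .
  qed
  then show ?thesis using K0 by (intro that[of K0]) auto
qed

text \<open>The source of the curvature of order \<open>1/\<kappa>\<close>: along each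
  \<open>v\<close> the noise displaces a point by a multiple of
  \<open>norm v / sqrt \<kappa>\<close> with a probability that depends neither on \<open>v\<close>
  nor on \<kappa>. The bound on \<open>norm (fst z)\<close> belongs to the same event because
  curvature will be counted on bounded points only.\<close>

lemma data_dist_spread:
  fixes \<Sigma> :: "real^'d^'d"
  assumes \<Sigma>: "pos_def \<Sigma>"
  obtains B r q where "0 < B" "0 < r" "0 < q"
    "\<And>\<kappa> v. 1 \<le> \<kappa> \<Longrightarrow> q \<le> measure (data_dist \<mu> \<Sigma> \<kappa>)
       {z. snd z = 1 \<and> norm (fst z) \<le> B \<and> r * norm v / sqrt \<kappa> \<le> v \<bullet> (fst z - \<mu>)}"
proof -
  obtain C :: "real^'d^'d" where C: "invertible C" "C ** transpose C = \<Sigma>" using pos_def_factor[OF \<Sigma>] by blast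
  obtain c where c: "0 < c" "\<And>u. norm (C *v u) \<le> c * norm u" using norm_matrix_vector_le[of C] by blast
  obtain e where e: "0 < e" "\<And>v. norm (matrix_inv (transpose C) *v v) \<le> e * norm v"
    using norm_matrix_vector_le[of "matrix_inv (transpose C)"] by blast
  obtain q where q: "0 < q" "\<And>v::real^'d. norm v = 1 \<Longrightarrow> q \<le> measure std_mvnormal (ball v (1/2))"
    using std_mvnormal_ball by blast
  interpret std: prob_space "std_mvnormal :: (real^'d) measure" by (rule prob_space_std_mvnormal)
  define B where "B = norm \<mu> + c * (3/2)"
  define r where "r = 1 / (2 * e)"
  have "q / 2 \<le> measure (data_dist \<mu> \<Sigma> \<kappa>)
       {z. snd z = 1 \<and> norm (fst z) \<le> B \<and> r * norm v / sqrt \<kappa> \<le> v \<bullet> (fst z - \<mu>)}" (is "_ \<le> measure ?D ?A")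
    if \<kappa>: "1 \<le> \<kappa>" for \<kappa> v
  proof -
    interpret D: prob_space ?D using \<Sigma> \<kappa> by (intro prob_space_data_dist) auto
    have "{z \<in> space (borel \<Otimes>\<^sub>M borel). snd z = (1::real) \<and> norm (fst z) \<le> B \<and> r * norm v / sqrt \<kappa> \<le> v \<bullet> (fst z - \<mu>)}
        \<in> sets (borel \<Otimes>\<^sub>M borel)"
      by measurable
    then have A: "?A \<in> sets (borel \<Otimes>\<^sub>M borel)" by (simp add: space_pair_measure)
    define v' where "v' = transpose C *v v"
    have v': "norm v \<le> e * norm v'"
      using e(2)[of v'] invertible_matrix_inv(2)[OF transpose_invertible[OF C(1)]]
      by (simp add: v'_def matrix_vector_mul_assoc del: transpose_matrix_vector)
    \<comment> \<open>The direction of \<open>transpose C *v v\<close>, or any unit vector if that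
      vector vanishes. A noise vector within \<open>1/2\<close> of \<open>w\<close> has
      \<open>1/2 \<le> w \<bullet> u\<close>, so a ball around \<open>w\<close> is enough.\<close>
    obtain w where w: "norm w = 1" "v' = norm v' *\<^sub>R w"
    proof (cases "v' = 0")
      case True
      obtain b :: "real^'d" where "b \<in> Basis" using nonempty_Basis by blast
      then show ?thesis using True by (intro that[of b]) auto
    next
      case False
      then show ?thesis by (intro that[of "v' /\<^sub>R norm v'"]) auto
    qed
    have "ball w (1/2) \<subseteq> {u. (\<mu> + (1 / sqrt \<kappa>) *\<^sub>R (C *v u), 1) \<in> ?A}"
    proof
      fix u assume u: "u \<in> ball w (1/2)"
      have "norm u \<le> norm w + norm (w - u)" by (metis norm_minus_commute norm_triangle_sub)
      then have nu: "norm u \<le> 3/2" using u w by (simp add: dist_norm)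
      have "norm (\<mu> + (1 / sqrt \<kappa>) *\<^sub>R (C *v u)) \<le> norm \<mu> + norm ((1 / sqrt \<kappa>) *\<^sub>R (C *v u))"
        by (rule norm_triangle_ineq)
      also have "norm ((1 / sqrt \<kappa>) *\<^sub>R (C *v u)) \<le> 1 * norm (C *v u)"
        unfolding norm_scaleR using \<kappa> by (intro mult_right_mono) auto
      also have "\<dots> \<le> c * (3/2)" using c(2)[of u] nu c(1) by (smt (verit) mult_left_mono)
      finally have 1: "norm (\<mu> + (1 / sqrt \<kappa>) *\<^sub>R (C *v u)) \<le> B" by (simp add: B_def)
      have "w \<bullet> (w - u) \<le> norm w * norm (w - u)" by (rule norm_cauchy_schwarz)
      then have "1/2 \<le> w \<bullet> u" using u w power2_norm_eq_inner[of w] by (simp add: dist_norm inner_diff_right)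
      then have "norm v' * (1/2) \<le> norm v' * (w \<bullet> u)" by (intro mult_left_mono) auto
      also have "\<dots> = v' \<bullet> u" by (subst (2) w(2)) simp
      also have "\<dots> = v \<bullet> (C *v u)" by (simp add: v'_def dot_lmul_matrix)
      finally have "norm v' / 2 \<le> v \<bullet> (C *v u)" by simp
      moreover have "r * norm v \<le> norm v' / 2" using v' e(1) by (simp add: r_def field_simps)
      ultimately have "r * norm v / sqrt \<kappa> \<le> v \<bullet> (C *v u) / sqrt \<kappa>"
        using \<kappa> by (intro divide_right_mono) auto
      then show "u \<in> {u. (\<mu> + (1 / sqrt \<kappa>) *\<^sub>R (C *v u), 1) \<in> ?A}" using 1 by simp
    qed
    moreover have "{u. (\<mu> + (1 / sqrt \<kappa>) *\<^sub>R (C *v u), 1) \<in> ?A} \<in> sets (std_mvnormal :: (real^'d) measure)"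
    proof -
      have "(\<lambda>u. (\<mu> + (1 / sqrt \<kappa>) *\<^sub>R (C *v u), 1::real)) -` ?A \<inter> space std_mvnormal \<in> sets (std_mvnormal :: (real^'d) measure)"
        by (rule measurable_sets[OF _ A]) measurable
      then show ?thesis by (simp add: vimage_def)
    qed
    ultimately have "measure std_mvnormal (ball w (1/2)) \<le> measure std_mvnormal {u. (\<mu> + (1 / sqrt \<kappa>) *\<^sub>R (C *v u), 1) \<in> ?A}"
      by (intro std.finite_measure_mono) auto
    then have "q \<le> measure std_mvnormal {u. (\<mu> + (1 / sqrt \<kappa>) *\<^sub>R (C *v u), 1) \<in> ?A}" using q(2)[OF w(1)] by simp
    then have "ennreal q \<le> emeasure std_mvnormal {u. (\<mu> + (1 / sqrt \<kappa>) *\<^sub>R (C *v u), 1) \<in> ?A}"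
      by (simp add: std.emeasure_eq_measure)
    also have "\<dots> = (\<integral>\<^sup>+u. indicator {u. (\<mu> + (1 / sqrt \<kappa>) *\<^sub>R (C *v u), 1) \<in> ?A} u \<partial>std_mvnormal)"
      using \<open>_ \<in> sets std_mvnormal\<close> by simp
    also have "\<dots> = (\<integral>\<^sup>+u. indicator ?A (\<mu> + (1 / sqrt \<kappa>) *\<^sub>R (C *v u), 1) \<partial>std_mvnormal)"
      by (intro nn_integral_cong) (simp add: indicator_def)
    finally have "ennreal q \<le> \<dots>" .
    \<comment> \<open>Only the class with label 1 is kept, at the price of a factor 2.\<close>
    then have "ennreal q / 2 \<le> integral\<^sup>N ?D (indicator ?A)"
      using nn_integral_data_dist(1)[OF C(1), of \<kappa> "indicator ?A" \<mu>] \<kappa> A unfolding C(2)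
      by (auto intro!: divide_right_mono_ennreal add_increasing2)
    also have "\<dots> = emeasure ?D ?A"
      by (rule nn_integral_indicator) (use sets_data_dist[OF \<Sigma>, of \<kappa> \<mu>] A \<kappa> in auto)
    finally have "ennreal (q / 2) \<le> ennreal (measure ?D ?A)"
      using q(1) by (simp add: D.emeasure_eq_measure divide_ennreal[symmetric])
    then show ?thesis by simp
  qed
  moreover have "0 < B" using c(1) unfolding B_def by (intro add_nonneg_pos) auto
  ultimately show ?thesis using q(1) e(1) by (intro that[of B r "q / 2"]) (auto simp: r_def)
qed

text \<open>On the points, \<open>R\<close> is a linear involution that fixes \<mu>. If
  \<open>T\<close> is its matrix, then \<open>T ** \<Sigma> ** transpose T = \<Sigma>\<close>, so
  \<open>T ** C\<close> is another factor of \<Sigma>, and the two factors give two representations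
  of the same law that differ exactly by \<open>T\<close>.\<close>

lemma data_dist_reflection:
  fixes \<Sigma> :: "real^'d^'d"
  assumes \<Sigma>: "pos_def \<Sigma>" and \<kappa>: "0 < \<kappa>" and w: "\<Sigma> *v w = \<mu>" "w \<noteq> 0"
  defines "R \<equiv> \<lambda>z. ((2 * (w \<bullet> fst z) / (w \<bullet> \<mu>)) *\<^sub>R \<mu> - fst z, snd z)"
  shows "distr (data_dist \<mu> \<Sigma> \<kappa>) (borel \<Otimes>\<^sub>M borel) R = data_dist \<mu> \<Sigma> \<kappa>"
proof -
  obtain C :: "real^'d^'d" where C: "invertible C" "C ** transpose C = \<Sigma>" using pos_def_factor[OF \<Sigma>] by blast
  define \<rho> where "\<rho> = (\<lambda>x. (2 * (w \<bullet> x) / (w \<bullet> \<mu>)) *\<^sub>R \<mu> - x)"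
  have M: "0 < w \<bullet> \<mu>" using \<Sigma> w by (auto simp: pos_def_def)
  have lin: "linear \<rho>"
    by (rule linearI) (simp_all add: \<rho>_def inner_add_right algebra_simps add_divide_distrib)
  define T where "T = matrix \<rho>"
  have T: "T *v x = \<rho> x" for x using matrix_vector_mul(2)[OF lin] by (simp add: T_def fun_eq_iff)
  have invol: "\<rho> (\<rho> x) = x" for x
    using M by (simp add: \<rho>_def inner_diff_right algebra_simps)
  have "T ** T = mat 1"
    by (intro matrix_eq[THEN iffD2]) (simp add: matrix_vector_mul_assoc[symmetric] T invol)
  then have TC: "invertible (T ** C)"
    using C(1) by (intro invertible_mult) (auto simp: invertible_def)
  have transT: "transpose T *v x = (2 * (\<mu> \<bullet> x) / (w \<bullet> \<mu>)) *\<^sub>R w - x" (is "_ = ?r") for x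
  proof (rule vector_eq_ldot[THEN iffD1], rule allI)
    fix y
    have "y \<bullet> (transpose T *v x) = (T *v y) \<bullet> x"
      by (metis dot_lmul_matrix transpose_transpose vector_transpose_matrix)
    also have "\<dots> = y \<bullet> ?r"
      using M by (simp add: T \<rho>_def inner_diff_left inner_diff_right inner_commute)
    finally show "y \<bullet> (transpose T *v x) = y \<bullet> ?r" .
  qed
  have w\<Sigma>: "w \<bullet> (\<Sigma> *v x) = \<mu> \<bullet> x" for x
    using inner_symmetric_matrix[of \<Sigma> w x] \<Sigma> w by (simp add: pos_def_def inner_commute)
  have "(T ** C) ** transpose (T ** C) = \<Sigma>"
  proof (intro matrix_eq[THEN iffD2] allI)
    fix x
    have "((T ** C) ** transpose (T ** C)) *v x = \<rho> (\<Sigma> *v (transpose T *v x))"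
      by (simp add: C(2)[symmetric] matrix_transpose_mul matrix_vector_mul_assoc[symmetric] T del: transpose_matrix_vector)
    also have "\<Sigma> *v (transpose T *v x) = (2 * (\<mu> \<bullet> x) / (w \<bullet> \<mu>)) *\<^sub>R \<mu> - \<Sigma> *v x"
      unfolding transT by (simp add: matrix_vector_mult_diff_distrib matrix_vector_mult_scaleR w)
    also have "\<rho> \<dots> = \<Sigma> *v x"
      using M by (simp add: \<rho>_def inner_diff_right w\<Sigma> inner_commute algebra_simps)
    finally show "((T ** C) ** transpose (T ** C)) *v x = \<Sigma> *v x" .
  qed
  note D' = nn_integral_data_dist(1)[OF TC \<kappa>, unfolded this]
  note D = nn_integral_data_dist(1)[OF C(1) \<kappa>, unfolded C(2)]
  have R [measurable]: "R \<in> borel \<Otimes>\<^sub>M borel \<rightarrow>\<^sub>M borel \<Otimes>\<^sub>M borel"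
    unfolding R_def by measurable
  have R1: "R (\<mu> + x, y) = (\<mu> + T *v x, y)" "R (- \<mu> + x, y) = (- \<mu> + T *v x, y)" for x and y :: real
  proof -
    have "\<rho> \<mu> = \<mu>" using M by (simp add: \<rho>_def scaleR_2)
    then have "\<rho> (\<mu> + x) = \<mu> + \<rho> x" "\<rho> (- \<mu> + x) = - \<mu> + \<rho> x"
      by (simp_all only: linear_add[OF lin] linear_neg[OF lin])
    moreover have "R (x, y) = (\<rho> x, y)" for x y by (simp add: R_def \<rho>_def)
    ultimately show "R (\<mu> + x, y) = (\<mu> + T *v x, y)" "R (- \<mu> + x, y) = (- \<mu> + T *v x, y)"
      by (simp_all only: T)
  qed
  show ?thesis
  proof (rule measure_eqI)
    fix X assume "X \<in> sets (distr (data_dist \<mu> \<Sigma> \<kappa>) (borel \<Otimes>\<^sub>M borel) R)"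
    then have X [measurable]: "X \<in> sets (borel \<Otimes>\<^sub>M borel)" by simp
    have R': "R \<in> data_dist \<mu> \<Sigma> \<kappa> \<rightarrow>\<^sub>M borel \<Otimes>\<^sub>M borel"
      by (subst measurable_cong_sets[OF sets_data_dist[OF \<Sigma> \<kappa>] refl]) measurable
    have "emeasure (distr (data_dist \<mu> \<Sigma> \<kappa>) (borel \<Otimes>\<^sub>M borel) R) X =
        (\<integral>\<^sup>+z. indicator X z \<partial>distr (data_dist \<mu> \<Sigma> \<kappa>) (borel \<Otimes>\<^sub>M borel) R)"
      by (simp add: X)
    also have "\<dots> = (\<integral>\<^sup>+z. indicator X (R z) \<partial>data_dist \<mu> \<Sigma> \<kappa>)"
      by (rule nn_integral_distr[OF R']) measurable
    also have "\<dots> = (\<integral>\<^sup>+z. indicator X z \<partial>data_dist \<mu> \<Sigma> \<kappa>)"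
      by (subst D, measurable, subst D', measurable)
         (simp only: R1 matrix_vector_mult_scaleR matrix_vector_mul_assoc)
    also have "\<dots> = emeasure (data_dist \<mu> \<Sigma> \<kappa>) X"
      using X by (simp add: sets_data_dist[OF \<Sigma> \<kappa>])
    finally show "emeasure (distr (data_dist \<mu> \<Sigma> \<kappa>) (borel \<Otimes>\<^sub>M borel) R) X = emeasure (data_dist \<mu> \<Sigma> \<kappa>) X" .
  qed (simp add: sets_data_dist[OF \<Sigma> \<kappa>])
qed

section \<open>Concentration of averages over pairs\<close>

lemma exp_le_quadratic:
  fixes x :: real
  shows "exp x \<le> 1 + x + x\<^sup>2 * exp \<bar>x\<bar>"
proof -
  obtain t where t: "\<bar>t\<bar> \<le> \<bar>x\<bar>" "exp x = (\<Sum>m<2. x ^ m / fact m) + exp t / fact 2 * x ^ 2"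
    using Maclaurin_exp_le[of x 2] by blast
  have "exp t * x\<^sup>2 \<le> exp \<bar>x\<bar> * x\<^sup>2" using t(1) by (intro mult_right_mono) auto
  moreover have "0 \<le> exp t * x\<^sup>2" by simp
  ultimately show ?thesis using t(2) by (simp add: numeral_2_eq_2 algebra_simps)
qed

text \<open>The linear term of the expansion has mean zero, and for \<open>t \<le> 1\<close> the
  quadratic one is dominated through \<open>y^2 * exp \<bar>t * y\<bar> \<le> 2 * exp (2 *
  \<bar>y\<bar>)\<close>. The condition is an exponential moment and not boundedness, since Gaussian
  points are unbounded.\<close>

lemma (in prob_space) nn_integral_exp_centred_le:
  fixes X :: "'a \<Rightarrow> real"
  assumes [measurable]: "X \<in> borel_measurable M"
    and K: "(\<integral>\<^sup>+x. ennreal (exp (2 * \<bar>X x\<bar>)) \<partial>M) \<le> ennreal K" "0 \<le> K"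
    and mean: "expectation X = 0" and t: "0 \<le> t" "t \<le> 1"
  shows "(\<integral>\<^sup>+x. ennreal (exp (t * X x)) \<partial>M) \<le> ennreal (exp (2 * K * t\<^sup>2))"
proof -
  have int2: "integrable M (\<lambda>x. exp (2 * \<bar>X x\<bar>))"
    using K by (intro integrableI_nonneg) (auto intro: le_less_trans)
  have E2: "expectation (\<lambda>x. exp (2 * \<bar>X x\<bar>)) \<le> K"
    using K by (simp add: integral_eq_nn_integral enn2real_leI)
  have dom: "\<bar>y\<bar> \<le> exp (2 * \<bar>y\<bar>)" "exp (t * y) \<le> exp (2 * \<bar>y\<bar>)" for y :: real
  proof -
    show "\<bar>y\<bar> \<le> exp (2 * \<bar>y\<bar>)" using exp_ge_add_one_self[of "2 * \<bar>y\<bar>"] by linarith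
    have "t * y \<le> t * \<bar>y\<bar>" using t by (intro mult_left_mono) auto
    also have "\<dots> \<le> 2 * \<bar>y\<bar>" using t by (intro mult_right_mono) auto
    finally show "exp (t * y) \<le> exp (2 * \<bar>y\<bar>)" by simp
  qed
  have intX: "integrable M X"
    by (rule Bochner_Integration.integrable_bound[OF int2]) (auto simp: dom)
  have intE: "integrable M (\<lambda>x. exp (t * X x))"
    by (rule Bochner_Integration.integrable_bound[OF int2])
      (auto intro!: AE_I2 dom(2) simp del: exp_le_cancel_iff)
  have pt: "exp (t * y) \<le> 1 + t * y + 2 * t\<^sup>2 * exp (2 * \<bar>y\<bar>)" for y :: real
  proof -
    have "y\<^sup>2 \<le> 2 * exp \<bar>y\<bar>" using exp_lower_Taylor_quadratic[of "\<bar>y\<bar>"] by simp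
    moreover have "exp \<bar>t * y\<bar> \<le> exp \<bar>y\<bar>" using t by (simp add: abs_mult mult_left_le_one_le)
    ultimately have "y\<^sup>2 * exp \<bar>t * y\<bar> \<le> (2 * exp \<bar>y\<bar>) * exp \<bar>y\<bar>" by (intro mult_mono) auto
    also have "\<dots> = 2 * exp (2 * \<bar>y\<bar>)" by (simp add: exp_add[symmetric])
    finally have "t\<^sup>2 * (y\<^sup>2 * exp \<bar>t * y\<bar>) \<le> t\<^sup>2 * (2 * exp (2 * \<bar>y\<bar>))" by (intro mult_left_mono) auto
    then show ?thesis using exp_le_quadratic[of "t * y"] by (simp add: power_mult_distrib algebra_simps)
  qed
  have "expectation (\<lambda>x. exp (t * X x)) \<le> expectation (\<lambda>x. 1 + t * X x + 2 * t\<^sup>2 * exp (2 * \<bar>X x\<bar>))"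
    using intX int2 intE by (intro integral_mono pt) auto
  also have "\<dots> = 1 + 2 * t\<^sup>2 * expectation (\<lambda>x. exp (2 * \<bar>X x\<bar>))"
    using intX int2 mean by (simp add: prob_space)
  also have "\<dots> \<le> 1 + 2 * t\<^sup>2 * K" using E2 by (intro add_left_mono mult_left_mono) auto
  also have "\<dots> \<le> exp (2 * K * t\<^sup>2)" using exp_ge_add_one_self[of "2 * K * t\<^sup>2"] by (simp add: algebra_simps)
  finally show ?thesis
    using intE by (subst nn_integral_eq_integral) (auto intro: ennreal_leI)
qed

section \<open>Independence along disjoint index pairs\<close>

lemma nn_integral_pair_prob_space:
  assumes "prob_space M'" "f \<in> borel_measurable (M \<Otimes>\<^sub>M M')"
  shows "integral\<^sup>N (M \<Otimes>\<^sub>M M') f = (\<integral>\<^sup>+x. \<integral>\<^sup>+y. f (x, y) \<partial>M' \<partial>M)"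
proof -
  interpret prob_space M' by fact
  show ?thesis by (rule nn_integral_fst[symmetric]) fact
qed

text \<open>Integrating out the two coordinates of one pair leaves the other factors alone, because
  no other pair meets it. \<open>I\<close> varies in the induction as it shrinks to
  \<open>J\<close>.\<close>

lemma nn_integral_prod_matching:
  fixes D :: "'a measure" and \<psi> :: "'a \<times> 'a \<Rightarrow> ennreal" and P :: "('i \<times> 'i) set"
  assumes D: "prob_space D" and "finite P" "finite I" "P \<subseteq> I \<times> I"
    and "\<And>i j. (i, j) \<in> P \<Longrightarrow> i \<noteq> j"
    and "\<And>i j k l. (i, j) \<in> P \<Longrightarrow> (k, l) \<in> P \<Longrightarrow> (i, j) \<noteq> (k, l) \<Longrightarrow> {i, j} \<inter> {k, l} = {}"
    and \<psi> [measurable]: "\<psi> \<in> borel_measurable (D \<Otimes>\<^sub>M D)"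
  shows "(\<integral>\<^sup>+S. (\<Prod>p\<in>P. \<psi> (S (fst p), S (snd p))) \<partial>(\<Pi>\<^sub>M i\<in>I. D)) = (integral\<^sup>N (D \<Otimes>\<^sub>M D) \<psi>) ^ card P"
  using assms(2-6)
proof (induction P arbitrary: I rule: finite_induct)
  case empty
  interpret D: prob_space D by fact
  interpret product_prob_space "\<lambda>_::'i. D" ..
  have "prob_space (\<Pi>\<^sub>M i\<in>I. D)" by (intro prob_space_PiM D)
  then show ?case by (simp add: prob_space.emeasure_space_1)
next
  case (insert p P)
  interpret D: prob_space D by fact
  interpret product_prob_space "\<lambda>_::'i. D" ..
  interpret DD: pair_sigma_finite D D ..
  obtain i j where p: "p = (i, j)" by (cases p)
  define J where "J = I - {i, j}"
  have ij: "i \<noteq> j" using insert.prems(3) p by auto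
  have I: "I = insert i (insert j J)" "i \<notin> insert j J" "j \<notin> J" "finite J"
    using insert.prems(1,2) p ij by (auto simp: J_def)
  have dis: "k \<noteq> i" "k \<noteq> j" "l \<noteq> i" "l \<noteq> j" if "(k, l) \<in> P" for k l
    using insert.prems(4)[of k l i j] that insert.hyps(2) p by auto
  have PJ: "P \<subseteq> J \<times> J"
  proof (rule subrelI)
    fix k l assume "(k, l) \<in> P"
    then show "(k, l) \<in> J \<times> J" using insert.prems(2) dis[of k l] by (auto simp: J_def)
  qed
  define \<Phi> where "\<Phi> = (\<lambda>S. \<Prod>p\<in>P. \<psi> (S (fst p), S (snd p)))"
  have PJ': "fst p \<in> J" "snd p \<in> J" if "p \<in> P" for p using PJ that by auto
  have [measurable]: "\<Phi> \<in> borel_measurable (\<Pi>\<^sub>M i\<in>J. D)"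
    unfolding \<Phi>_def by (intro borel_measurable_prod_ennreal measurable_compose[OF _ \<psi>] measurable_Pair measurable_component_singleton PJ')
  have [measurable]: "\<Phi> \<in> borel_measurable (\<Pi>\<^sub>M i\<in>insert j J. D)"
    unfolding \<Phi>_def by (intro borel_measurable_prod_ennreal measurable_compose[OF _ \<psi>] measurable_Pair measurable_component_singleton) (use PJ' in auto)
  have [measurable]: "\<Phi> \<in> borel_measurable (\<Pi>\<^sub>M i\<in>insert i (insert j J). D)"
    unfolding \<Phi>_def by (intro borel_measurable_prod_ennreal measurable_compose[OF _ \<psi>] measurable_Pair measurable_component_singleton) (use PJ' in auto)
  have upd: "\<Phi> (S(k := y)) = \<Phi> S" if "k = i \<or> k = j" for S k y
  proof -
    have "(S(k := y)) (fst p) = S (fst p) \<and> (S(k := y)) (snd p) = S (snd p)" if "p \<in> P" for p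
      using dis[of "fst p" "snd p"] that \<open>k = i \<or> k = j\<close> by auto
    then show ?thesis unfolding \<Phi>_def by (intro prod.cong) auto
  qed
  have "(\<integral>\<^sup>+S. (\<Prod>p\<in>insert p P. \<psi> (S (fst p), S (snd p))) \<partial>(\<Pi>\<^sub>M i\<in>I. D)) =
      (\<integral>\<^sup>+S. \<psi> (S i, S j) * \<Phi> S \<partial>(\<Pi>\<^sub>M i\<in>I. D))"
    using insert.hyps by (simp add: p \<Phi>_def)
  also have "\<dots> = (\<integral>\<^sup>+S. \<integral>\<^sup>+y. \<psi> (y, S j) * \<Phi> S \<partial>D \<partial>(\<Pi>\<^sub>M i\<in>insert j J. D))"
    using I(2,4) ij unfolding I(1) by (subst product_nn_integral_insert) (auto simp: upd)
  also have "\<dots> = (\<integral>\<^sup>+S. (\<integral>\<^sup>+y. \<psi> (y, S j) \<partial>D) * \<Phi> S \<partial>(\<Pi>\<^sub>M i\<in>insert j J. D))"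
    by (intro nn_integral_cong nn_integral_multc) (auto simp: space_PiM PiE_def)
  also have "\<dots> = (\<integral>\<^sup>+S. \<integral>\<^sup>+y'. (\<integral>\<^sup>+y. \<psi> (y, y') \<partial>D) * \<Phi> S \<partial>D \<partial>(\<Pi>\<^sub>M i\<in>J. D))"
    using I(3,4) by (subst product_nn_integral_insert) (auto simp: upd)
  also have "\<dots> = (\<integral>\<^sup>+S. integral\<^sup>N (D \<Otimes>\<^sub>M D) \<psi> * \<Phi> S \<partial>(\<Pi>\<^sub>M i\<in>J. D))"
    by (simp add: nn_integral_multc DD.nn_integral_snd)
  also have "\<dots> = integral\<^sup>N (D \<Otimes>\<^sub>M D) \<psi> * integral\<^sup>N (\<Pi>\<^sub>M i\<in>J. D) \<Phi>"
    by (rule nn_integral_cmult) measurable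
  also have "integral\<^sup>N (\<Pi>\<^sub>M i\<in>J. D) \<Phi> = (integral\<^sup>N (D \<Otimes>\<^sub>M D) \<psi>) ^ card P"
    unfolding \<Phi>_def
  proof (intro insert.IH I(4) PJ)
    show "k \<noteq> l" if "(k, l) \<in> P" for k l using insert.prems(3)[of k l] that by auto
    show "{k, l} \<inter> {k', l'} = {}" if "(k, l) \<in> P" "(k', l') \<in> P" "(k, l) \<noteq> (k', l')" for k l k' l'
      using insert.prems(4)[of k l k' l'] that by blast
  qed
  finally show ?case using insert.hyps by simp
qed

text \<open>Sample points and mixing coefficients in the abstract, with laws \<open>D\<close> and
  \<open>L\<close>; \<open>entry\<close> collects what a single term of the loss depends on.\<close>

locale pair_sampling = D: prob_space D + L: prob_space L
  for D :: "'a measure" and L :: "'b measure" +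
  fixes n :: nat
  assumes n_pos: "0 < n"
begin

definition Pr :: "((nat \<Rightarrow> 'a) \<times> (nat \<times> nat \<Rightarrow> 'b)) measure" where
  "Pr = (\<Pi>\<^sub>M i\<in>{..<n}. D) \<Otimes>\<^sub>M (\<Pi>\<^sub>M ij\<in>{..<n} \<times> {..<n}. L)"

definition offdiag :: "(nat \<times> nat) set" where
  "offdiag = {(i, j). i < n \<and> j < n \<and> i \<noteq> j}"

definition entry :: "((nat \<Rightarrow> 'a) \<times> (nat \<times> nat \<Rightarrow> 'b)) \<Rightarrow> nat \<times> nat \<Rightarrow> 'a \<times> 'a \<times> 'b" where
  "entry \<omega> p = (fst \<omega> (fst p), fst \<omega> (snd p), snd \<omega> p)"

sublocale PD: product_prob_space "\<lambda>_::nat. D" "{..<n}" ..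
sublocale PL: product_prob_space "\<lambda>_::nat \<times> nat. L" "{..<n} \<times> {..<n}" ..
sublocale DL: pair_prob_space D L ..
sublocale Q: pair_prob_space D "D \<Otimes>\<^sub>M L" ..
sublocale prod: pair_prob_space "\<Pi>\<^sub>M i\<in>{..<n}. D" "\<Pi>\<^sub>M ij\<in>{..<n} \<times> {..<n}. L" ..
sublocale Pr: prob_space Pr unfolding Pr_def by (rule prod.prob_space_axioms)

lemma finite_offdiag: "finite offdiag"
  by (rule finite_subset[of _ "{..<n} \<times> {..<n}"]) (auto simp: offdiag_def)

lemma measurable_fst_Pr [measurable]: "i < n \<Longrightarrow> (\<lambda>\<omega>. fst \<omega> i) \<in> Pr \<rightarrow>\<^sub>M D"
  unfolding Pr_def by measurable

lemma measurable_snd_Pr [measurable]: "i < n \<Longrightarrow> j < n \<Longrightarrow> (\<lambda>\<omega>. snd \<omega> (i, j)) \<in> Pr \<rightarrow>\<^sub>M L"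
  unfolding Pr_def by measurable

lemma measurable_entry:
  "fst p < n \<Longrightarrow> snd p < n \<Longrightarrow> (\<lambda>\<omega>. entry \<omega> p) \<in> Pr \<rightarrow>\<^sub>M D \<Otimes>\<^sub>M D \<Otimes>\<^sub>M L"
  by (cases p) (simp add: entry_def)

lemma measurable_entry_offdiag:
  "p \<in> offdiag \<Longrightarrow> (\<lambda>\<omega>. entry \<omega> p) \<in> Pr \<rightarrow>\<^sub>M D \<Otimes>\<^sub>M D \<Otimes>\<^sub>M L"
  by (rule measurable_entry) (auto simp: offdiag_def)

text \<open>Given the sample, the mixing coefficients of distinct pairs are independent, so they are
  integrated out first; what is left is a product, over disjoint pairs, of a function of two sample
  points.\<close>

lemma nn_integral_matching:
  assumes P: "P \<subseteq> {..<n} \<times> {..<n}" "\<And>i j. (i, j) \<in> P \<Longrightarrow> i \<noteq> j"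
    "\<And>i j k l. (i, j) \<in> P \<Longrightarrow> (k, l) \<in> P \<Longrightarrow> (i, j) \<noteq> (k, l) \<Longrightarrow> {i, j} \<inter> {k, l} = {}"
    and \<phi> [measurable]: "\<phi> \<in> borel_measurable (D \<Otimes>\<^sub>M D \<Otimes>\<^sub>M L)"
  shows "(\<integral>\<^sup>+\<omega>. (\<Prod>p\<in>P. \<phi> (entry \<omega> p)) \<partial>Pr) = (integral\<^sup>N (D \<Otimes>\<^sub>M D \<Otimes>\<^sub>M L) \<phi>) ^ card P"
proof -
  let ?I = "{..<n} \<times> {..<n}"
  have fin: "finite P" using P(1) by (rule finite_subset) auto
  have "p \<in> P \<Longrightarrow> fst p < n \<and> snd p < n" for p using P(1) by auto
  then have meas: "(\<lambda>\<omega>. \<Prod>p\<in>P. \<phi> (entry \<omega> p)) \<in> borel_measurable Pr"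
    by (intro borel_measurable_prod_ennreal measurable_compose[OF measurable_entry \<phi>]) auto
  define \<psi> where "\<psi> = (\<lambda>z. \<integral>\<^sup>+l. \<phi> (fst z, snd z, l) \<partial>L)"
  have [measurable]: "\<psi> \<in> borel_measurable (D \<Otimes>\<^sub>M D)" unfolding \<psi>_def by measurable
  have "(\<integral>\<^sup>+\<omega>. (\<Prod>p\<in>P. \<phi> (entry \<omega> p)) \<partial>Pr) =
     (\<integral>\<^sup>+S. \<integral>\<^sup>+lam. (\<Prod>p\<in>P. \<phi> (S (fst p), S (snd p), lam p)) \<partial>(\<Pi>\<^sub>M ij\<in>?I. L) \<partial>(\<Pi>\<^sub>M i\<in>{..<n}. D))"
    unfolding Pr_def by (subst nn_integral_pair_prob_space[OF prob_space_PiM[OF L.prob_space_axioms] meas[unfolded Pr_def]]) (simp add: entry_def)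
  also have "\<dots> = (\<integral>\<^sup>+S. (\<Prod>p\<in>P. \<psi> (S (fst p), S (snd p))) \<partial>(\<Pi>\<^sub>M i\<in>{..<n}. D))"
  proof (rule nn_integral_cong)
    fix S assume S: "S \<in> space (\<Pi>\<^sub>M i\<in>{..<n}. D)"
    \<comment> \<open>The value 1 outside \<open>P\<close> lets the product run over the whole index
      set of the mixing coefficients.\<close>
    define h where "h = (\<lambda>p l. if p \<in> P then \<phi> (S (fst p), S (snd p), l) else 1)"
    have Sp: "S (fst p) \<in> space D" "S (snd p) \<in> space D" if "p \<in> P" for p
      using S that P(1) by (auto simp: space_PiM PiE_def Pi_def)
    have h: "h p \<in> borel_measurable L" for p
    proof (cases "p \<in> P")
      case True
      note [measurable] = measurable_const[OF Sp(1)[OF True]] measurable_const[OF Sp(2)[OF True]]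
      show ?thesis using True unfolding h_def by simp
    qed (simp add: h_def)
    have "(\<integral>\<^sup>+lam. (\<Prod>p\<in>P. \<phi> (S (fst p), S (snd p), lam p)) \<partial>(\<Pi>\<^sub>M ij\<in>?I. L)) =
       (\<integral>\<^sup>+lam. (\<Prod>p\<in>?I. h p (lam p)) \<partial>(\<Pi>\<^sub>M ij\<in>?I. L))"
      using P(1) by (intro nn_integral_cong prod.mono_neutral_cong_left) (auto simp: h_def)
    also have "\<dots> = (\<Prod>p\<in>?I. integral\<^sup>N L (h p))"
      by (rule PL.product_nn_integral_prod) (auto simp: h)
    also have "\<dots> = (\<Prod>p\<in>P. \<psi> (S (fst p), S (snd p)))"
      using P(1) by (intro prod.mono_neutral_cong_right) (auto simp: h_def \<psi>_def L.emeasure_space_1)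
    finally show "(\<integral>\<^sup>+lam. (\<Prod>p\<in>P. \<phi> (S (fst p), S (snd p), lam p)) \<partial>(\<Pi>\<^sub>M ij\<in>?I. L)) =
       (\<Prod>p\<in>P. \<psi> (S (fst p), S (snd p)))" .
  qed
  also have "\<dots> = (integral\<^sup>N (D \<Otimes>\<^sub>M D) \<psi>) ^ card P"
    by (rule nn_integral_prod_matching[OF D.prob_space_axioms fin _ P]) auto
  also have "integral\<^sup>N (D \<Otimes>\<^sub>M D) \<psi> = integral\<^sup>N (D \<Otimes>\<^sub>M D \<Otimes>\<^sub>M L) \<phi>"
  proof -
    have "integral\<^sup>N (D \<Otimes>\<^sub>M D) \<psi> = (\<integral>\<^sup>+z. \<integral>\<^sup>+z'. \<integral>\<^sup>+l. \<phi> (z, z', l) \<partial>L \<partial>D \<partial>D)"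
      by (subst D.nn_integral_fst[symmetric]) (auto simp: \<psi>_def)
    also have "\<dots> = (\<integral>\<^sup>+z. \<integral>\<^sup>+w. \<phi> (z, w) \<partial>(D \<Otimes>\<^sub>M L) \<partial>D)"
      by (intro nn_integral_cong L.nn_integral_fst) measurable
    also have "\<dots> = integral\<^sup>N (D \<Otimes>\<^sub>M D \<Otimes>\<^sub>M L) \<phi>"
      by (rule nn_integral_pair_prob_space[symmetric]) (auto intro: DL.prob_space_axioms)
    finally show ?thesis .
  qed
  finally show ?thesis .
qed

text \<open>The sum modulo \<open>n\<close> alone would put \<open>(i, j)\<close> and
  \<open>(j, i)\<close> into one class although they share both indices; the order of the entries
  separates them.\<close>

definition matching_class :: "nat \<times> nat \<Rightarrow> nat \<times> bool" where
  "matching_class p = ((fst p + snd p) mod n, fst p < snd p)"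

definition matching :: "nat \<times> bool \<Rightarrow> (nat \<times> nat) set" where
  "matching y = {p \<in> offdiag. matching_class p = y}"

lemma add_mod_cancel:
  assumes "(i + j) mod n = (i + l) mod n" "j < n" "l < n"
  shows "j = l"
proof -
  have le: "a = b" if "(i + a) mod n = (i + b) mod n" "a < n" "b \<le> a" for a b
  proof -
    have "n dvd (i + a) - (i + b)" using that by (subst mod_eq_dvd_iff_nat[symmetric]) auto
    then have "n dvd a - b" by simp
    then show ?thesis using that by (auto dest!: dvd_imp_le)
  qed
  show ?thesis using le[of j l] le[of l j] assms by (cases "l \<le> j") auto
qed

text \<open>Within a class, either index of a pair determines the other, because the sum modulo
  \<open>n\<close> is fixed. Two pairs with a common index in the same position are therefore equal,
  and in opposite positions they are reversals of each other, which the order excludes. As the first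
  index is injective, a class has at most \<open>n\<close> pairs.\<close>

lemma matching:
  shows "matching y \<subseteq> {..<n} \<times> {..<n}"
    and "(i, j) \<in> matching y \<Longrightarrow> i \<noteq> j"
    and "(i, j) \<in> matching y \<Longrightarrow> (k, l) \<in> matching y \<Longrightarrow> (i, j) \<noteq> (k, l) \<Longrightarrow> {i, j} \<inter> {k, l} = {}"
    and "card (matching y) \<le> n"
proof -
  show "matching y \<subseteq> {..<n} \<times> {..<n}" by (auto simp: matching_def offdiag_def)
  show "(i, j) \<in> matching y \<Longrightarrow> i \<noteq> j" by (auto simp: matching_def offdiag_def)
  show dis: "{i, j} \<inter> {k, l} = {}" if "(i, j) \<in> matching y" "(k, l) \<in> matching y" "(i, j) \<noteq> (k, l)" for i j k l
  proof -
    have b: "i < n" "j < n" "k < n" "l < n" "i \<noteq> j" "k \<noteq> l" and s: "(i + j) mod n = (k + l) mod n" "i < j \<longleftrightarrow> k < l"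
      using that(1,2) by (auto simp: matching_def offdiag_def matching_class_def)
    have "i \<noteq> k" using add_mod_cancel[of i j l] b s that(3) by auto
    moreover have "j \<noteq> l" using add_mod_cancel[of j i k] b s that(3) by (auto simp: add.commute)
    moreover have "i \<noteq> l" using add_mod_cancel[of i j k] b s by (auto simp: add.commute)
    moreover have "j \<noteq> k" using add_mod_cancel[of j i l] b s by (auto simp: add.commute)
    ultimately show ?thesis by auto
  qed
  have "inj_on fst (matching y)"
  proof (rule inj_onI)
    fix p q assume pq: "p \<in> matching y" "q \<in> matching y" "fst p = fst q"
    show "p = q"
    proof (rule ccontr)
      assume "p \<noteq> q"
      then have "{fst p, snd p} \<inter> {fst q, snd q} = {}" using pq(1,2) dis[of "fst p" "snd p" "fst q" "snd q"] by (simp only: prod.collapse simp_thms)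
      then show False using pq(3) by auto
    qed
  qed
  moreover have "fst ` matching y \<subseteq> {..<n}" by (auto simp: matching_def offdiag_def)
  ultimately show "card (matching y) \<le> n" using card_inj_on_le[of fst "matching y" "{..<n}"] by auto
qed

lemma sum_offdiag: "(\<Sum>p\<in>offdiag. h p) = (\<Sum>y\<in>{..<n} \<times> UNIV. \<Sum>p\<in>matching y. h p)" for h :: "_ \<Rightarrow> real"
  unfolding matching_def using n_pos finite_offdiag
  by (intro sum.group[symmetric]) (auto simp: matching_class_def)

lemma exp_average_le:
  fixes a :: "'c \<Rightarrow> real"
  assumes "finite Y" "Y \<noteq> {}"
  shows "exp ((\<Sum>y\<in>Y. a y) / card Y) \<le> (\<Sum>y\<in>Y. exp (a y)) / card Y"
proof -
  have "exp (\<Sum>y\<in>Y. (1 / card Y) *\<^sub>R a y) \<le> (\<Sum>y\<in>Y. (1 / card Y) * exp (a y))"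
    using assms by (intro convex_on_sum[where C=UNIV]) (auto intro: exp_convex)
  then show ?thesis by (simp add: sum_divide_distrib)
qed

text \<open>The class of a pair under \<^term>\<open>(i + j) mod n\<close> and the order of its entries is a matching, so
  the terms within one class are independent, and Jensen's inequality averages over the
  \<^term>\<open>2 * n\<close> classes.\<close>

lemma offdiag_tail:
  assumes F [measurable]: "F \<in> borel_measurable (D \<Otimes>\<^sub>M D \<Otimes>\<^sub>M L)"
    and K: "(\<integral>\<^sup>+x. ennreal (exp (2 * \<bar>F x\<bar>)) \<partial>(D \<Otimes>\<^sub>M D \<Otimes>\<^sub>M L)) \<le> ennreal K" "1 \<le> K"
    and mean: "(\<integral>x. F x \<partial>(D \<Otimes>\<^sub>M D \<Otimes>\<^sub>M L)) = 0" and \<gamma>: "0 < \<gamma>" "\<gamma> \<le> 1"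
  shows "Pr.prob {\<omega> \<in> space Pr. \<gamma> * (real n)\<^sup>2 \<le> (\<Sum>p\<in>offdiag. F (entry \<omega> p))} \<le> exp (- \<gamma>\<^sup>2 * n / (32 * K))"
proof -
  \<comment> \<open>The final exponent is
    \<open>- \<beta> * \<gamma> * n / 2 + 2 * K * \<beta>^2 * n\<close>; this \<beta> minimizes it,
    with value \<open>- \<gamma>^2 * n / (32 * K)\<close>.\<close>
  define \<beta> where "\<beta> = \<gamma> / (8 * K)"
  have \<beta>: "0 < \<beta>" "\<beta> \<le> 1" using \<gamma> K(2) by (auto simp: \<beta>_def field_simps)
  \<comment> \<open>Dividing by the number \<open>2 * n\<close> of classes makes \<theta> times the
    full sum the average of \<beta> times the class sums, the form to which convexity
    applies.\<close>
  define \<theta> where "\<theta> = \<beta> / (2 * n)"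
  have \<theta>: "0 < \<theta>" using \<beta> n_pos by (simp add: \<theta>_def)
  let ?Y = "{..<n} \<times> (UNIV :: bool set)"
  have cY: "card ?Y = 2 * n" by (simp add: card_cartesian_product)
  have Yne: "?Y \<noteq> {}" using n_pos by auto
  have mF: "(\<lambda>\<omega>. F (entry \<omega> p)) \<in> borel_measurable Pr" if "p \<in> offdiag" for p
    by (rule measurable_compose[OF measurable_entry_offdiag[OF that] F])
  have mo: "p \<in> matching y \<Longrightarrow> p \<in> offdiag" for p y by (simp add: matching_def)
  have mS: "(\<lambda>\<omega>. \<Sum>p\<in>offdiag. F (entry \<omega> p)) \<in> borel_measurable Pr"
    by (intro borel_measurable_sum mF)
  have mgf: "(\<integral>\<^sup>+x. ennreal (exp (\<beta> * F x)) \<partial>(D \<Otimes>\<^sub>M D \<Otimes>\<^sub>M L)) \<le> ennreal (exp (2 * K * \<beta>\<^sup>2))"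
    by (rule Q.nn_integral_exp_centred_le) (use K mean \<beta> in auto)
  have cls_bound: "(\<integral>\<^sup>+\<omega>. ennreal (exp (\<beta> * (\<Sum>p\<in>matching y. F (entry \<omega> p)))) \<partial>Pr) \<le> ennreal (exp (2 * K * \<beta>\<^sup>2 * n))" for y
  proof -
    have "finite (matching y)" using finite_offdiag by (simp add: matching_def)
    then have "(\<integral>\<^sup>+\<omega>. ennreal (exp (\<beta> * (\<Sum>p\<in>matching y. F (entry \<omega> p)))) \<partial>Pr) =
       (\<integral>\<^sup>+\<omega>. (\<Prod>p\<in>matching y. ennreal (exp (\<beta> * F (entry \<omega> p)))) \<partial>Pr)"
      by (simp add: sum_distrib_left exp_sum prod_ennreal)
    also have "\<dots> = (\<integral>\<^sup>+x. ennreal (exp (\<beta> * F x)) \<partial>(D \<Otimes>\<^sub>M D \<Otimes>\<^sub>M L)) ^ card (matching y)"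
      by (rule nn_integral_matching[OF matching(1-3)]) auto
    also have "\<dots> \<le> ennreal (exp (2 * K * \<beta>\<^sup>2)) ^ card (matching y)"
      by (intro power_mono mgf) auto
    also have "\<dots> = ennreal (exp (2 * K * \<beta>\<^sup>2 * card (matching y)))"
      by (simp add: ennreal_power exp_of_nat_mult[symmetric] mult.commute)
    also have "\<dots> \<le> ennreal (exp (2 * K * \<beta>\<^sup>2 * n))"
      using matching(4)[of y] K(2) by (intro ennreal_leI) (auto intro!: mult_left_mono)
    finally show ?thesis .
  qed
  have "(\<integral>\<^sup>+\<omega>. ennreal (exp (\<theta> * (\<Sum>p\<in>offdiag. F (entry \<omega> p)))) \<partial>Pr) \<le>
     (\<integral>\<^sup>+\<omega>. ennreal (1 / (2 * n)) * (\<Sum>y\<in>?Y. ennreal (exp (\<beta> * (\<Sum>p\<in>matching y. F (entry \<omega> p))))) \<partial>Pr)"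
  proof (rule nn_integral_mono)
    fix \<omega>
    have "exp (\<theta> * (\<Sum>p\<in>offdiag. F (entry \<omega> p))) = exp ((\<Sum>y\<in>?Y. \<beta> * (\<Sum>p\<in>matching y. F (entry \<omega> p))) / card ?Y)"
      unfolding cY by (simp add: sum_offdiag \<theta>_def sum_distrib_left sum_divide_distrib)
    also have "\<dots> \<le> (\<Sum>y\<in>?Y. exp (\<beta> * (\<Sum>p\<in>matching y. F (entry \<omega> p)))) / card ?Y"
      by (rule exp_average_le) (use Yne in auto)
    finally have "ennreal (exp (\<theta> * (\<Sum>p\<in>offdiag. F (entry \<omega> p)))) \<le>
        ennreal (1 / (2 * n) * (\<Sum>y\<in>?Y. exp (\<beta> * (\<Sum>p\<in>matching y. F (entry \<omega> p)))))"
      unfolding cY by (intro ennreal_leI) (simp add: mult.commute)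
    then show "ennreal (exp (\<theta> * (\<Sum>p\<in>offdiag. F (entry \<omega> p)))) \<le>
        ennreal (1 / (2 * n)) * (\<Sum>y\<in>?Y. ennreal (exp (\<beta> * (\<Sum>p\<in>matching y. F (entry \<omega> p)))))"
      unfolding sum_ennreal[OF exp_ge_zero] by (subst ennreal_mult[symmetric]) (auto intro: sum_nonneg)
  qed
  also have "\<dots> = ennreal (1 / (2 * n)) * (\<Sum>y\<in>?Y. \<integral>\<^sup>+\<omega>. ennreal (exp (\<beta> * (\<Sum>p\<in>matching y. F (entry \<omega> p)))) \<partial>Pr)"
  proof -
    have "(\<lambda>\<omega>. ennreal (exp (\<beta> * (\<Sum>p\<in>matching y. F (entry \<omega> p))))) \<in> borel_measurable Pr" for y
    proof -
      have [measurable]: "(\<lambda>\<omega>. \<Sum>p\<in>matching y. F (entry \<omega> p)) \<in> borel_measurable Pr"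
        by (intro borel_measurable_sum mF mo)
      show ?thesis by measurable
    qed
    then show ?thesis by (simp add: nn_integral_cmult nn_integral_sum del: sum_ennreal)
  qed
  also have "\<dots> \<le> ennreal (1 / (2 * n)) * (\<Sum>y\<in>?Y. ennreal (exp (2 * K * \<beta>\<^sup>2 * n)))"
    by (intro mult_left_mono sum_mono cls_bound) simp
  also have "\<dots> = ennreal (exp (2 * K * \<beta>\<^sup>2 * n))"
    using n_pos unfolding sum_constant cY
    by (simp add: ennreal_of_nat_eq_real_of_nat ennreal_mult[symmetric] del: of_nat_mult)
  finally have mgf_total: "(\<integral>\<^sup>+\<omega>. ennreal (exp (\<theta> * (\<Sum>p\<in>offdiag. F (entry \<omega> p)))) \<partial>Pr) \<le> ennreal (exp (2 * K * \<beta>\<^sup>2 * n))" .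
  let ?A = "{\<omega> \<in> space Pr. \<gamma> * (real n)\<^sup>2 \<le> (\<Sum>p\<in>offdiag. F (entry \<omega> p))}"
  have A: "?A \<in> sets Pr" using mS by measurable
  have "emeasure Pr ?A = (\<integral>\<^sup>+\<omega>. indicator ?A \<omega> \<partial>Pr)" using A by simp
  also have "\<dots> \<le> (\<integral>\<^sup>+\<omega>. ennreal (exp (- \<theta> * \<gamma> * (real n)\<^sup>2)) * ennreal (exp (\<theta> * (\<Sum>p\<in>offdiag. F (entry \<omega> p)))) \<partial>Pr)"
  proof (rule nn_integral_mono)
    fix \<omega>
    show "indicator ?A \<omega> \<le> ennreal (exp (- \<theta> * \<gamma> * (real n)\<^sup>2)) * ennreal (exp (\<theta> * (\<Sum>p\<in>offdiag. F (entry \<omega> p))))"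
    proof (cases "\<omega> \<in> ?A")
      case True
      then have "\<theta> * (\<gamma> * (real n)\<^sup>2) \<le> \<theta> * (\<Sum>p\<in>offdiag. F (entry \<omega> p))" using \<theta> by (intro mult_left_mono) auto
      then have "1 \<le> exp (- \<theta> * \<gamma> * (real n)\<^sup>2 + \<theta> * (\<Sum>p\<in>offdiag. F (entry \<omega> p)))"
        by (simp add: mult.assoc)
      then show ?thesis using True by (simp add: ennreal_mult[symmetric] exp_add[symmetric])
    qed simp
  qed
  also have "\<dots> = ennreal (exp (- \<theta> * \<gamma> * (real n)\<^sup>2)) * (\<integral>\<^sup>+\<omega>. ennreal (exp (\<theta> * (\<Sum>p\<in>offdiag. F (entry \<omega> p)))) \<partial>Pr)"
    by (rule nn_integral_cmult) (use mS in measurable)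
  also have "\<dots> \<le> ennreal (exp (- \<theta> * \<gamma> * (real n)\<^sup>2)) * ennreal (exp (2 * K * \<beta>\<^sup>2 * n))"
    by (intro mult_left_mono mgf_total) simp
  also have "\<dots> = ennreal (exp (- \<gamma>\<^sup>2 * n / (32 * K)))"
  proof -
    have "- \<theta> * \<gamma> * (real n)\<^sup>2 + 2 * K * \<beta>\<^sup>2 * n = - \<gamma>\<^sup>2 * n / (32 * K)"
      using n_pos K(2) by (simp add: \<theta>_def \<beta>_def power2_eq_square field_simps)
    then show ?thesis by (simp add: ennreal_mult[symmetric] exp_add[symmetric])
  qed
  finally show ?thesis by (simp add: Pr.emeasure_eq_measure)
qed

text \<open>Markov's inequality for the exponential of the sum, at parameter 1: the threshold
  exceeds the logarithm of the moment bound \<open>K ^ n\<close> by exactly \<open>n\<close>. It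
  serves the diagonal terms, where the order of magnitude suffices and nothing is centred.\<close>

lemma iid_tail:
  assumes \<phi> [measurable]: "\<phi> \<in> borel_measurable D"
    and K: "(\<integral>\<^sup>+z. ennreal (exp (\<phi> z)) \<partial>D) \<le> ennreal K" "1 \<le> K"
  shows "Pr.prob {\<omega> \<in> space Pr. (ln K + 1) * n \<le> (\<Sum>i<n. \<phi> (fst \<omega> i))} \<le> exp (- real n)"
proof -
  let ?A = "{\<omega> \<in> space Pr. (ln K + 1) * n \<le> (\<Sum>i<n. \<phi> (fst \<omega> i))}"
  have mS: "(\<lambda>\<omega>. \<Sum>i<n. \<phi> (fst \<omega> i)) \<in> borel_measurable Pr"
    by (intro borel_measurable_sum measurable_compose[OF measurable_fst_Pr \<phi>]) auto
  have A: "?A \<in> sets Pr" using mS by measurable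
  have mP: "(\<lambda>\<omega>. \<Prod>i<n. ennreal (exp (\<phi> (fst \<omega> i)))) \<in> borel_measurable ((\<Pi>\<^sub>M i\<in>{..<n}. D) \<Otimes>\<^sub>M (\<Pi>\<^sub>M ij\<in>{..<n} \<times> {..<n}. L))"
    by measurable
  have "(\<integral>\<^sup>+\<omega>. ennreal (exp (\<Sum>i<n. \<phi> (fst \<omega> i))) \<partial>Pr) = (\<integral>\<^sup>+\<omega>. (\<Prod>i<n. ennreal (exp (\<phi> (fst \<omega> i)))) \<partial>Pr)"
    by (simp add: exp_sum prod_ennreal)
  also have "\<dots> = (\<integral>\<^sup>+S. (\<Prod>i<n. ennreal (exp (\<phi> (S i)))) \<partial>(\<Pi>\<^sub>M i\<in>{..<n}. D))"
    unfolding Pr_def by (subst nn_integral_pair_prob_space[OF prob_space_PiM[OF L.prob_space_axioms] mP]) (simp add: PL.emeasure_space_1)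
  also have "\<dots> = (\<Prod>i<n. \<integral>\<^sup>+z. ennreal (exp (\<phi> z)) \<partial>D)"
    by (rule PD.product_nn_integral_prod) auto
  also have "\<dots> \<le> ennreal K ^ n" using K(1) by (simp add: power_mono)
  also have "\<dots> = ennreal (exp (ln K * n))"
    using K(2) by (simp add: ennreal_power exp_of_nat2_mult)
  finally have mgf: "(\<integral>\<^sup>+\<omega>. ennreal (exp (\<Sum>i<n. \<phi> (fst \<omega> i))) \<partial>Pr) \<le> ennreal (exp (ln K * n))" .
  have "emeasure Pr ?A = (\<integral>\<^sup>+\<omega>. indicator ?A \<omega> \<partial>Pr)" using A by simp
  also have "\<dots> \<le> (\<integral>\<^sup>+\<omega>. ennreal (exp (- (ln K + 1) * n)) * ennreal (exp (\<Sum>i<n. \<phi> (fst \<omega> i))) \<partial>Pr)"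
  proof (rule nn_integral_mono)
    fix \<omega>
    show "indicator ?A \<omega> \<le> ennreal (exp (- (ln K + 1) * n)) * ennreal (exp (\<Sum>i<n. \<phi> (fst \<omega> i)))"
    proof (cases "\<omega> \<in> ?A")
      case True
      then have "0 \<le> - (ln K + 1) * n + (\<Sum>i<n. \<phi> (fst \<omega> i))" by (simp add: algebra_simps)
      then have "1 \<le> exp (- (ln K + 1) * n + (\<Sum>i<n. \<phi> (fst \<omega> i)))" by (simp only: one_le_exp_iff)
      then show ?thesis using True by (simp add: ennreal_mult[symmetric] exp_add[symmetric])
    qed simp
  qed
  also have "\<dots> = ennreal (exp (- (ln K + 1) * n)) * (\<integral>\<^sup>+\<omega>. ennreal (exp (\<Sum>i<n. \<phi> (fst \<omega> i))) \<partial>Pr)"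
    by (rule nn_integral_cmult) (use mS in measurable)
  also have "\<dots> \<le> ennreal (exp (- (ln K + 1) * n)) * ennreal (exp (ln K * n))"
    by (intro mult_left_mono mgf) simp
  also have "\<dots> = ennreal (exp (- real n))"
    by (simp add: ennreal_mult[symmetric] exp_add[symmetric] algebra_simps)
  finally show ?thesis by (simp add: Pr.emeasure_eq_measure)
qed

end

section \<open>Logistic losses and unique minimizers\<close>

definition sigmoid :: "real \<Rightarrow> real" where
  "sigmoid t = 1 / (1 + exp (- t))"

lemma sigmoid_bounds: "0 < sigmoid t" "sigmoid t < 1"
  by (simp_all add: sigmoid_def add_pos_pos)

lemma borel_measurable_sigmoid [measurable]: "sigmoid \<in> borel_measurable borel"
  unfolding sigmoid_def by measurable

lemma DERIV_sigmoid: "(sigmoid has_real_derivative sigmoid t * (1 - sigmoid t)) (at t)"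
proof -
  have "1 + exp (- t) \<noteq> 0" by (metis add_pos_pos exp_gt_zero less_irrefl zero_less_one)
  then show ?thesis unfolding sigmoid_def
    by (auto intro!: derivative_eq_intros simp: field_simps power2_eq_square)
qed

lemma DERIV_logistic_loss: "(logistic_loss has_real_derivative sigmoid t - 1) (at t)"
proof -
  have pos: "0 < 1 + exp (- t)" by (simp add: add_pos_pos)
  then show ?thesis unfolding logistic_loss_def sigmoid_def
    by (auto intro!: derivative_eq_intros simp: field_simps)
qed

lemma logistic_loss_minus: "logistic_loss (- z) = logistic_loss z + z"
proof -
  have "1 + exp z = exp z * (1 + exp (- z))" by (simp add: algebra_simps exp_add[symmetric])
  moreover have "0 < 1 + exp (- z)" by (simp add: add_pos_pos)
  ultimately show ?thesis by (simp add: logistic_loss_def ln_mult)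
qed

text \<open>The derivative of the sigmoid is even: it equals \<open>e / (1 + e)^2\<close> with
  \<open>e = exp (- \<bar>t\<bar>)\<close>, and \<open>1 + e \<le> 2\<close>.\<close>

lemma sigmoid_deriv_ge:
  assumes "\<bar>t\<bar> \<le> b"
  shows "exp (- b) / 4 \<le> sigmoid t * (1 - sigmoid t)"
proof -
  define e where "e = exp (- \<bar>t\<bar>)"
  have e: "0 < e" "e \<le> 1" by (auto simp: e_def)
  have key: "1 / (1 + x) * (1 - 1 / (1 + x)) = x / (1 + x)\<^sup>2" if "0 < x" for x :: real
    using that by (simp add: field_simps power2_eq_square)
  have eq: "sigmoid t * (1 - sigmoid t) = e / (1 + e)\<^sup>2"
  proof (cases "0 \<le> t")
    case True
    then have "e = exp (- t)" by (simp add: e_def)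
    then show ?thesis using e key[of e] by (simp add: sigmoid_def)
  next
    case False
    then have "exp (- t) = 1 / e" by (simp add: e_def exp_minus field_simps)
    moreover have "(1 / e) / (1 + 1 / e)\<^sup>2 = e / (1 + e)\<^sup>2"
      using e by (simp add: field_simps power2_eq_square)
    ultimately show ?thesis using e key[of "1 / e"] by (simp add: sigmoid_def)
  qed
  have "(1 + e)\<^sup>2 \<le> 2\<^sup>2" using e by (intro power_mono) auto
  then have "e / 4 \<le> e / (1 + e)\<^sup>2" using e by (intro divide_left_mono) auto
  moreover have "exp (- b) \<le> e" using assms by (simp add: e_def)
  ultimately show ?thesis unfolding eq by simp
qed

lemma sigmoid_deriv_bounds: "0 \<le> sigmoid t * (1 - sigmoid t)" "sigmoid t * (1 - sigmoid t) \<le> 1"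
  using sigmoid_bounds[of t] by (auto intro: mult_le_one)

lemma sigmoid_lipschitz: "\<bar>sigmoid s - sigmoid t\<bar> \<le> \<bar>s - t\<bar>"
proof -
  have "norm (sigmoid s - sigmoid t) \<le> 1 * norm (s - t)"
    using sigmoid_deriv_bounds DERIV_sigmoid
    by (intro field_differentiable_bound[of UNIV sigmoid "\<lambda>t. sigmoid t * (1 - sigmoid t)"])
      (auto intro: has_field_derivative_at_within)
  then show ?thesis by simp
qed

text \<open>With \<open>m\<close> the lower bound of the second derivative on
  \<open>[-b, b]\<close>, the loss minus \<open>m / 2 * t^2\<close> is still convex there; the claim
  is its tangent inequality at \<open>s\<close>.\<close>

lemma logistic_loss_ge_quadratic:
  assumes "\<bar>s\<bar> \<le> b" "\<bar>t\<bar> \<le> b"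
  shows "logistic_loss s + (sigmoid s - 1) * (t - s) + exp (- b) / 8 * (t - s)\<^sup>2 \<le> logistic_loss t"
proof -
  define m where "m = exp (- b) / 4"
  define f where "f = (\<lambda>t. logistic_loss t - m / 2 * t\<^sup>2)"
  define f' where "f' = (\<lambda>t. sigmoid t - 1 - m * t)"
  have "f' s * (t - s) \<le> f t - f s"
  proof (rule f''_imp_f'[of "{-b..b}" f f' "\<lambda>t. sigmoid t * (1 - sigmoid t) - m"])
    show "(f has_real_derivative f' x) (at x)" for x
      unfolding f_def f'_def by (auto intro!: derivative_eq_intros DERIV_logistic_loss)
    show "(f' has_real_derivative sigmoid x * (1 - sigmoid x) - m) (at x)" for x
      unfolding f'_def by (auto intro!: derivative_eq_intros DERIV_sigmoid)
    show "0 \<le> sigmoid x * (1 - sigmoid x) - m" if "x \<in> {-b..b}" for x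
      using sigmoid_deriv_ge[of x b] that by (simp add: m_def abs_le_iff)
  qed (use assms in auto)
  then show ?thesis
    by (simp add: f_def f'_def m_def power2_eq_square algebra_simps) (simp add: field_simps)
qed

lemma logistic_loss_ge_tangent:
  "logistic_loss s + (sigmoid s - 1) * (t - s) \<le> logistic_loss t"
proof -
  have "0 \<le> exp (- max \<bar>s\<bar> \<bar>t\<bar>) / 8 * (t - s)\<^sup>2" by simp
  then show ?thesis using logistic_loss_ge_quadratic[of s "max \<bar>s\<bar> \<bar>t\<bar>" t] by linarith
qed

lemma logistic_loss_ge_tangent_strict:
  assumes "s \<noteq> t"
  shows "logistic_loss s + (sigmoid s - 1) * (t - s) < logistic_loss t"
proof -
  have "0 < exp (- max \<bar>s\<bar> \<bar>t\<bar>) / 8 * (t - s)\<^sup>2" using assms by simp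
  then show ?thesis using logistic_loss_ge_quadratic[of s "max \<bar>s\<bar> \<bar>t\<bar>" t] by linarith
qed

section \<open>Convex sums of logistic losses and their minimizers\<close>

lemma convex_logistic_loss: "convex_on UNIV logistic_loss"
  by (rule f''_ge0_imp_convex[where f'="\<lambda>t. sigmoid t - 1" and f''="\<lambda>t. sigmoid t * (1 - sigmoid t)"])
    (auto intro!: derivative_eq_intros DERIV_logistic_loss DERIV_sigmoid sigmoid_deriv_bounds)

lemma continuous_logistic_loss: "continuous_on A logistic_loss"
  using DERIV_logistic_loss by (meson DERIV_continuous_on has_field_derivative_at_within)

lemma borel_measurable_logistic_loss [measurable]: "logistic_loss \<in> borel_measurable borel"
  by (rule borel_measurable_continuous_onI[OF continuous_logistic_loss])

text \<open>The Mixup loss up to the factor \<open>1 / n^2\<close>: since the loss at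
  \<open>- z\<close> is the loss at \<open>z\<close> plus \<open>z\<close>, a term with soft label
  \<open>y\<close> equals \<open>logistic_loss z + (1 - y) * z\<close>. With
  \<open>b p = 1 - y\<close> the label enters a linear term only, so convexity and curvature do not
  depend on it.\<close>

definition lin_logistic :: "'i set \<Rightarrow> ('i \<Rightarrow> 'a::euclidean_space) \<Rightarrow> ('i \<Rightarrow> real) \<Rightarrow> 'a \<Rightarrow> real" where
  "lin_logistic I X b w = (\<Sum>p\<in>I. logistic_loss (w \<bullet> X p) + b p * (w \<bullet> X p))"

lemma convex_lin_logistic: "convex_on UNIV (lin_logistic I X b)"
proof (intro convex_onI)
  fix t :: real and x y :: 'a assume t: "0 < t" "t < 1"
  have "lin_logistic I X b ((1 - t) *\<^sub>R x + t *\<^sub>R y) \<le>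
     (\<Sum>p\<in>I. (1 - t) * (logistic_loss (x \<bullet> X p) + b p * (x \<bullet> X p)) + t * (logistic_loss (y \<bullet> X p) + b p * (y \<bullet> X p)))"
    unfolding lin_logistic_def
  proof (rule sum_mono)
    fix p
    have "logistic_loss (((1 - t) *\<^sub>R x + t *\<^sub>R y) \<bullet> X p) \<le> (1 - t) * logistic_loss (x \<bullet> X p) + t * logistic_loss (y \<bullet> X p)"
      using convex_onD[OF convex_logistic_loss, of t "x \<bullet> X p" "y \<bullet> X p"] t by (simp add: inner_add_left)
    then show "logistic_loss (((1 - t) *\<^sub>R x + t *\<^sub>R y) \<bullet> X p) + b p * (((1 - t) *\<^sub>R x + t *\<^sub>R y) \<bullet> X p) \<le>
      (1 - t) * (logistic_loss (x \<bullet> X p) + b p * (x \<bullet> X p)) + t * (logistic_loss (y \<bullet> X p) + b p * (y \<bullet> X p))"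
      by (simp add: inner_add_left algebra_simps)
  qed
  then show "lin_logistic I X b ((1 - t) *\<^sub>R x + t *\<^sub>R y) \<le> (1 - t) * lin_logistic I X b x + t * lin_logistic I X b y"
    by (simp only: lin_logistic_def sum_distrib_left sum.distrib[symmetric])
qed auto

lemma continuous_lin_logistic: "continuous_on A (lin_logistic I X b)"
  unfolding lin_logistic_def
  by (intro continuous_intros continuous_on_compose2[OF continuous_logistic_loss[of UNIV]]) auto

text \<open>The second summand is the first-order term, with the gradient at \<open>w\<close>. Terms
  in \<open>J\<close> have arguments bounded by \<open>(W + 1) * B\<close> at both ends of the step
  and contribute the quadratic bound; all others contribute their tangent alone.\<close>

lemma lin_logistic_lower:
  assumes I: "finite I" "J \<subseteq> I" and B: "\<And>p. p \<in> J \<Longrightarrow> norm (X p) \<le> B"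
    and w: "norm w \<le> W" and v: "norm v \<le> 1"
  shows "lin_logistic I X b w + v \<bullet> (\<Sum>p\<in>I. (sigmoid (w \<bullet> X p) - 1 + b p) *\<^sub>R X p)
      + exp (- ((W + 1) * B)) / 8 * (\<Sum>p\<in>J. (v \<bullet> X p)\<^sup>2) \<le> lin_logistic I X b (w + v)"
proof -
  have nn: "0 \<le> W" using w norm_ge_zero by (rule order_trans[rotated])
  have pt: "logistic_loss (w \<bullet> X p) + (sigmoid (w \<bullet> X p) - 1) * (v \<bullet> X p)
     + (if p \<in> J then exp (- ((W + 1) * B)) / 8 * (v \<bullet> X p)\<^sup>2 else 0) \<le> logistic_loss ((w + v) \<bullet> X p)" for p
  proof (cases "p \<in> J")
    case True
    have B0: "0 \<le> B" using B[OF True] norm_ge_zero[of "X p"] by linarith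
    have 1: "\<bar>w \<bullet> X p\<bar> \<le> (W + 1) * B"
      using Cauchy_Schwarz_ineq2[of w "X p"] mult_mono[OF w B[OF True] nn norm_ge_zero] B0
      by (simp add: algebra_simps)
    have "norm (w + v) \<le> W + 1" using norm_triangle_ineq[of w v] w v by linarith
    then have 2: "\<bar>(w + v) \<bullet> X p\<bar> \<le> (W + 1) * B"
      using Cauchy_Schwarz_ineq2[of "w + v" "X p"] mult_mono[OF _ B[OF True], of "norm (w + v)" "W + 1"] nn
      by simp
    show ?thesis using logistic_loss_ge_quadratic[OF 1 2] True by (simp add: inner_add_left)
  next
    case False
    then show ?thesis using logistic_loss_ge_tangent[of "w \<bullet> X p" "(w + v) \<bullet> X p"] by (simp add: inner_add_left)
  qed
  have "(\<Sum>p\<in>I. logistic_loss (w \<bullet> X p) + (sigmoid (w \<bullet> X p) - 1) * (v \<bullet> X p)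
     + (if p \<in> J then exp (- ((W + 1) * B)) / 8 * (v \<bullet> X p)\<^sup>2 else 0) + b p * ((w + v) \<bullet> X p)) \<le> lin_logistic I X b (w + v)"
    unfolding lin_logistic_def by (intro sum_mono add_right_mono pt)
  also have "(\<Sum>p\<in>I. logistic_loss (w \<bullet> X p) + (sigmoid (w \<bullet> X p) - 1) * (v \<bullet> X p)
     + (if p \<in> J then exp (- ((W + 1) * B)) / 8 * (v \<bullet> X p)\<^sup>2 else 0) + b p * ((w + v) \<bullet> X p)) =
     lin_logistic I X b w + v \<bullet> (\<Sum>p\<in>I. (sigmoid (w \<bullet> X p) - 1 + b p) *\<^sub>R X p)
      + (\<Sum>p\<in>I. if p \<in> J then exp (- ((W + 1) * B)) / 8 * (v \<bullet> X p)\<^sup>2 else 0)"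
    by (simp add: lin_logistic_def inner_sum_right sum.distrib[symmetric] inner_add_left algebra_simps)
  also have "(\<Sum>p\<in>I. if p \<in> J then exp (- ((W + 1) * B)) / 8 * (v \<bullet> X p)\<^sup>2 else 0) =
      exp (- ((W + 1) * B)) / 8 * (\<Sum>p\<in>J. (v \<bullet> X p)\<^sup>2)"
    using I by (simp add: sum.If_cases sum_distrib_left Int_absorb1)
  finally show ?thesis .
qed

text \<open>Adding the tangent inequalities at the midpoint towards \<open>x\<close> and towards
  \<open>y\<close> cancels the first-order terms; a single term that tells \<open>x\<close> from
  \<open>y\<close> makes the sum strict.\<close>

lemma lin_logistic_midpoint:
  assumes I: "finite I" and p: "p \<in> I" "x \<bullet> X p \<noteq> y \<bullet> X p"
  shows "2 * lin_logistic I X b ((1 / 2) *\<^sub>R (x + y)) < lin_logistic I X b x + lin_logistic I X b y"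
proof -
  let ?m = "(1 / 2) *\<^sub>R (x + y)"
  have mid: "2 * logistic_loss (?m \<bullet> X p) \<le> logistic_loss (x \<bullet> X p) + logistic_loss (y \<bullet> X p)" for p
    using logistic_loss_ge_tangent[of "?m \<bullet> X p" "x \<bullet> X p"] logistic_loss_ge_tangent[of "?m \<bullet> X p" "y \<bullet> X p"]
    by (simp add: inner_add_left algebra_simps)
  have strict: "2 * logistic_loss (?m \<bullet> X p) < logistic_loss (x \<bullet> X p) + logistic_loss (y \<bullet> X p)"
    using logistic_loss_ge_tangent_strict[of "?m \<bullet> X p" "x \<bullet> X p"] logistic_loss_ge_tangent[of "?m \<bullet> X p" "y \<bullet> X p"] p(2)
    by (simp add: inner_add_left algebra_simps)
  have "(\<Sum>p\<in>I. 2 * logistic_loss (?m \<bullet> X p) + b p * ((x + y) \<bullet> X p)) <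
      (\<Sum>p\<in>I. logistic_loss (x \<bullet> X p) + logistic_loss (y \<bullet> X p) + b p * ((x + y) \<bullet> X p))"
    using I p(1) mid strict by (intro sum_strict_mono_ex1) auto
  then show ?thesis
    by (simp add: lin_logistic_def sum_distrib_left sum.distrib[symmetric] inner_add_left algebra_simps)
qed

text \<open>A convex function that exceeds its value at the centre on a sphere does so everywhere
  outside, since each segment from the centre to an outer point crosses the sphere. So a minimizer
  over the ball is global, and the midpoint inequality makes it unique.\<close>

lemma unique_arg_min_near:
  fixes f :: "'a::euclidean_space \<Rightarrow> real"
  assumes conv: "convex_on UNIV f" and cont: "continuous_on UNIV f"
    and strict: "\<And>x y. x \<noteq> y \<Longrightarrow> 2 * f ((1 / 2) *\<^sub>R (x + y)) < f x + f y"
    and \<rho>: "0 < \<rho>" and sphere: "\<And>v. norm v = \<rho> \<Longrightarrow> f w0 < f (w0 + v)"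
  obtains w where "norm (w - w0) \<le> \<rho>" "\<And>v. is_arg_min f (\<lambda>_. True) v \<longleftrightarrow> v = w"
proof -
  obtain w where w: "w \<in> cball w0 \<rho>" "\<And>y. y \<in> cball w0 \<rho> \<Longrightarrow> f w \<le> f y"
    using continuous_attains_inf[of "cball w0 \<rho>" f] \<rho> cont by (metis cball_eq_empty compact_cball continuous_on_subset not_less less_imp_le top_greatest)
  have min: "f w \<le> f y" for y
  proof (cases "y \<in> cball w0 \<rho>")
    case False
    define t where "t = \<rho> / norm (y - w0)"
    have far: "\<rho> < norm (y - w0)" using False by (simp add: dist_norm norm_minus_commute)
    then have "0 < norm (y - w0)" using \<rho> by linarith
    then have t: "0 < t" "t < 1" using \<rho> far unfolding t_def by (simp_all only: divide_pos_pos divide_less_eq_1_pos)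
    have "f w0 < f (w0 + t *\<^sub>R (y - w0))"
      by (rule sphere) (use far \<rho> in \<open>auto simp: t_def\<close>)
    also have "w0 + t *\<^sub>R (y - w0) = (1 - t) *\<^sub>R w0 + t *\<^sub>R y"
      by (simp add: scaleR_diff_right scaleR_diff_left)
    also have "f \<dots> \<le> (1 - t) * f w0 + t * f y"
      using convex_onD[OF conv] t by simp
    finally have "t * f w0 < t * f y" by (simp add: algebra_simps)
    then have "f w0 < f y" using t by simp
    moreover have "f w \<le> f w0" using w(2)[of w0] \<rho> by simp
    ultimately show ?thesis by simp
  qed (use w in auto)
  have "is_arg_min f (\<lambda>_. True) v \<longleftrightarrow> v = w" for v
  proof
    assume v: "is_arg_min f (\<lambda>_. True) v"
    show "v = w"
    proof (rule ccontr)
      assume "v \<noteq> w"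
      then have "2 * f ((1 / 2) *\<^sub>R (v + w)) < f v + f w" by (rule strict)
      moreover have "f v \<le> f w" using v by (auto simp: is_arg_min_def not_less)
      moreover have "f w \<le> f ((1 / 2) *\<^sub>R (v + w))" by (rule min)
      ultimately show False by simp
    qed
  next
    assume "v = w" then show "is_arg_min f (\<lambda>_. True) v"
      using min by (auto simp: is_arg_min_def not_less)
  qed
  then show ?thesis using that w(1) by (auto simp: dist_norm norm_minus_commute)
qed

text \<open>A relative error \<open>\<epsilon> / 2\<close> changes the inner product with
  \<open>c *\<^sub>R u\<close> and the length by factors \<open>1 - \<epsilon> / 2\<close> and
  \<open>1 + \<epsilon> / 2\<close> at worst, and \<open>(1 - \<epsilon>) * (1 + \<epsilon> / 2)
  \<le> 1 - \<epsilon> / 2\<close>.\<close>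

lemma sim_ge:
  fixes u :: "real^'d"
  assumes "norm (w - c *\<^sub>R u) \<le> \<epsilon> / 2 * norm (c *\<^sub>R u)" "0 < c" "u \<noteq> 0" "0 < \<epsilon>" "\<epsilon> < 1"
  shows "w \<noteq> 0" "1 - \<epsilon> \<le> sim w u"
proof -
  define w0 where "w0 = c *\<^sub>R u"
  have w0: "0 < norm w0" using assms by (simp add: w0_def)
  have d: "norm (w - w0) \<le> \<epsilon> / 2 * norm w0" using assms(1) by (simp add: w0_def)
  have "\<epsilon> / 2 * norm w0 < norm w0" using w0 assms(5) by simp
  then show nz: "w \<noteq> 0" using d by auto
  have "\<bar>(w - w0) \<bullet> w0\<bar> \<le> norm (w - w0) * norm w0" by (rule Cauchy_Schwarz_ineq2)
  also have "\<dots> \<le> (\<epsilon> / 2 * norm w0) * norm w0" using d by (intro mult_right_mono) auto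
  finally have "- ((\<epsilon> / 2 * norm w0) * norm w0) \<le> (w - w0) \<bullet> w0" by linarith
  then have inner: "(1 - \<epsilon> / 2) * (norm w0)\<^sup>2 \<le> w \<bullet> w0"
    by (simp add: inner_diff_left power2_norm_eq_inner[symmetric] power2_eq_square algebra_simps)
  have nw: "norm w \<le> (1 + \<epsilon> / 2) * norm w0"
    using norm_triangle_ineq[of "w - w0" w0] d by (simp add: algebra_simps)
  have "(1 - \<epsilon>) * (1 + \<epsilon> / 2) \<le> 1 - \<epsilon> / 2" using assms(4) by (simp add: algebra_simps)
  then have "(1 - \<epsilon>) * (1 + \<epsilon> / 2) * (norm w0)\<^sup>2 \<le> (1 - \<epsilon> / 2) * (norm w0)\<^sup>2" by (intro mult_right_mono) auto
  moreover have "(1 - \<epsilon>) * (norm w * norm w0) \<le> (1 - \<epsilon>) * (((1 + \<epsilon> / 2) * norm w0) * norm w0)"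
    using nw assms(5) by (intro mult_left_mono mult_right_mono) auto
  ultimately have "(1 - \<epsilon>) * (norm w * norm w0) \<le> w \<bullet> w0"
    using inner by (simp add: power2_eq_square mult.assoc)
  then have "c * ((1 - \<epsilon>) * (norm w * norm u)) \<le> c * (w \<bullet> u)"
    using assms(2) by (simp add: w0_def mult_ac)
  then have "(1 - \<epsilon>) * (norm w * norm u) \<le> w \<bullet> u" using assms(2) by simp
  then show "1 - \<epsilon> \<le> sim w u" using nz assms(3) by (simp add: sim_def pos_le_divide_eq)
qed

text \<open>A convex continuous function has a unique minimizer precisely when, at every scale, some point of a
  countable dense set beats by a fixed margin all dense points outside a ball of that size around it.\<close>

lemma sets_unique_arg_min:
  fixes f :: "'w \<Rightarrow> 'a::euclidean_space \<Rightarrow> real"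
  assumes meas [measurable]: "\<And>x. (\<lambda>\<omega>. f \<omega> x) \<in> borel_measurable M"
    and conv: "\<And>\<omega>. convex_on UNIV (f \<omega>)" and cont: "\<And>\<omega>. continuous_on UNIV (f \<omega>)"
    and K: "closed K"
  shows "{\<omega> \<in> space M. \<exists>w\<in>K. \<forall>v. is_arg_min (f \<omega>) (\<lambda>_. True) v \<longleftrightarrow> v = w} \<in> sets M"
proof -
  obtain D :: "'a set" where D: "countable D" "\<And>X. open X \<Longrightarrow> X \<noteq> {} \<Longrightarrow> \<exists>d\<in>D. d \<in> X"
    by (rule countable_dense_setE) blast
  have D_near: "\<exists>d\<in>D. dist d x < e" if "0 < e" for x e
    using D(2)[of "ball x e"] that by (auto simp: dist_commute)
  define r where "r = (\<lambda>k::nat. 1 / (real k + 1))"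
  have r: "0 < r k" for k by (simp add: r_def)
  have r_small: "\<exists>k. r k < e" if "0 < e" for e
    using reals_Archimedean[OF that] by (auto simp: r_def inverse_eq_divide add.commute)
  define D' where "D' = (\<lambda>k. {q\<in>D. \<exists>y\<in>K. dist q y \<le> r k})"
  define far where "far = (\<lambda>k q. {z\<in>D. r k < dist z q})"
  have iff: "(\<exists>w\<in>K. \<forall>v. is_arg_min (f \<omega>) (\<lambda>_. True) v \<longleftrightarrow> v = w) \<longleftrightarrow>
     (\<forall>k. \<exists>q\<in>D' k. \<exists>l. \<forall>z\<in>far k q. f \<omega> q + r l \<le> f \<omega> z)" (is "?lhs \<longleftrightarrow> ?rhs") for \<omega>
  proof
    assume ?lhs
    then obtain w where w: "w \<in> K" "\<And>v. is_arg_min (f \<omega>) (\<lambda>_. True) v \<longleftrightarrow> v = w" by blast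
    have min: "f \<omega> w \<le> f \<omega> v" for v using w(2)[of w] by (auto simp: is_arg_min_def not_less)
    have smin: "f \<omega> w < f \<omega> v" if "v \<noteq> w" for v
      using w(2)[of v] that min by (auto simp: is_arg_min_def) (meson less_le_trans not_less)
    show ?rhs
    proof
      fix k
      let ?S = "sphere w (r k / 2)"
      have "compact ?S" "?S \<noteq> {}" using r[of k] by auto
      then obtain s where s: "s \<in> ?S" "\<And>y. y \<in> ?S \<Longrightarrow> f \<omega> s \<le> f \<omega> y"
        using continuous_attains_inf[of ?S "f \<omega>"] cont[of \<omega>] by (meson continuous_on_subset top_greatest)
      \<comment> \<open>One half of the gap pays for replacing \<open>w\<close> by the dense point
        \<open>q\<close>, the other half for the margin \<open>r l\<close>.\<close>
      define \<eta> where "\<eta> = (f \<omega> s - f \<omega> w) / 2"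
      have "s \<noteq> w" using s(1) r[of k] by auto
      then have \<eta>: "0 < \<eta>" using smin by (simp add: \<eta>_def)
      have out: "f \<omega> w + 2 * \<eta> \<le> f \<omega> z" if z: "r k / 2 \<le> norm (z - w)" for z
      proof -
        define t where "t = (r k / 2) / norm (z - w)"
        have nz: "0 < norm (z - w)" using z r[of k] by linarith
        have t: "0 < t" "t \<le> 1" using z r[of k] nz by (auto simp: t_def)
        have "w + t *\<^sub>R (z - w) \<in> ?S" using t r[of k] nz by (simp add: t_def dist_norm)
        then have "f \<omega> s \<le> f \<omega> (w + t *\<^sub>R (z - w))" by (rule s)
        also have "w + t *\<^sub>R (z - w) = (1 - t) *\<^sub>R w + t *\<^sub>R z"
          by (simp add: scaleR_diff_right scaleR_diff_left)
        also have "f \<omega> \<dots> \<le> (1 - t) * f \<omega> w + t * f \<omega> z"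
          using convex_onD[OF conv] t by simp
        also have "\<dots> \<le> (1 - t) * f \<omega> z + t * f \<omega> z"
          using t min[of z] by (intro add_right_mono mult_left_mono) auto
        finally have "f \<omega> s \<le> f \<omega> z" by (simp add: algebra_simps)
        moreover have "2 * \<eta> = f \<omega> s - f \<omega> w" unfolding \<eta>_def by (simp only: times_divide_eq_right nonzero_mult_div_cancel_left)
        ultimately show ?thesis by linarith
      qed
      have "isCont (f \<omega>) w" using cont[of \<omega>] by (simp add: continuous_on_eq_continuous_at)
      then obtain \<delta> where \<delta>: "0 < \<delta>" "\<And>q. dist q w < \<delta> \<Longrightarrow> dist (f \<omega> q) (f \<omega> w) < \<eta>"
        using \<eta> unfolding continuous_at_eps_delta by blast
      have "0 < min \<delta> (r k / 2)" using \<delta>(1) r[of k] by simp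
      then obtain q where q: "q \<in> D" "dist q w < min \<delta> (r k / 2)" using D_near by blast
      then have qw: "dist q w < \<delta>" "dist q w < r k / 2" by auto
      have "q \<in> D' k" using q(1) w(1) qw r[of k] by (auto simp: D'_def intro!: bexI[of _ w])
      moreover obtain l where l: "r l < \<eta>" using r_small[OF \<eta>] by blast
      have "f \<omega> q + r l \<le> f \<omega> z" if "z \<in> far k q" for z
      proof -
        have "dist z q \<le> dist z w + dist q w" by (metis dist_commute dist_triangle)
        then have "r k / 2 \<le> norm (z - w)" using that qw by (simp add: far_def dist_norm)
        then show ?thesis using out[of z] \<delta>(2)[OF qw(1)] l by (simp add: dist_real_def)
      qed
      ultimately show "\<exists>q\<in>D' k. \<exists>l. \<forall>z\<in>far k q. f \<omega> q + r l \<le> f \<omega> z" by blast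
    qed
  next
    assume ?rhs
    then obtain q l where q: "\<And>k. q k \<in> D' k" "\<And>k z. z \<in> far k (q k) \<Longrightarrow> f \<omega> (q k) + r (l k) \<le> f \<omega> z"
      by metis
    \<comment> \<open>Every point outside the closed ball is a limit of dense points outside it, and
      the margin \<open>r (l k)\<close> survives the limit as a strict inequality.\<close>
    have out: "f \<omega> (q k) < f \<omega> z" if z: "r k < dist z (q k)" for k z
    proof -
      have "isCont (f \<omega>) z" using cont[of \<omega>] by (simp add: continuous_on_eq_continuous_at)
      then obtain \<delta> where \<delta>: "0 < \<delta>" "\<And>y. dist y z < \<delta> \<Longrightarrow> dist (f \<omega> y) (f \<omega> z) < r (l k)"
        using r[of "l k"] unfolding continuous_at_eps_delta by blast
      have "0 < min \<delta> (dist z (q k) - r k)" using \<delta>(1) z by simp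
      then obtain y where y: "y \<in> D" "dist y z < min \<delta> (dist z (q k) - r k)" using D_near by blast
      then have yz: "dist y z < \<delta>" "dist y z < dist z (q k) - r k" by auto
      have "dist z (q k) \<le> dist y z + dist y (q k)" by (metis dist_commute dist_triangle)
      then have "y \<in> far k (q k)" using y(1) yz by (simp add: far_def)
      then show ?thesis using q(2)[of y k] \<delta>(2)[OF yz(1)] by (simp add: dist_real_def)
    qed
    obtain w where w: "w \<in> cball (q 0) (r 0)" "\<And>y. y \<in> cball (q 0) (r 0) \<Longrightarrow> f \<omega> w \<le> f \<omega> y"
      using continuous_attains_inf[of "cball (q 0) (r 0)" "f \<omega>"] r[of 0] cont[of \<omega>]
      by (metis cball_eq_empty compact_cball continuous_on_subset not_less less_imp_le top_greatest)
    have min: "f \<omega> w \<le> f \<omega> y" for y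
    proof (cases "y \<in> cball (q 0) (r 0)")
      case False
      then have "f \<omega> (q 0) < f \<omega> y" by (intro out) (simp add: dist_commute)
      then show ?thesis using w(2)[of "q 0"] r[of 0] by simp
    qed (rule w)
    have near: "dist v (q k) \<le> r k" if "\<And>y. f \<omega> v \<le> f \<omega> y" for v k
      using out[of k v] that[of "q k"] by (meson not_less)
    \<comment> \<open>For every \<open>k\<close>, two minimizers lie within \<open>r k\<close> of
      the same point \<open>q k\<close>.\<close>
    have "v = w" if "\<And>y. f \<omega> v \<le> f \<omega> y" for v
    proof (rule ccontr)
      assume "v \<noteq> w"
      then obtain k where "r k < dist v w / 2" using r_small[of "dist v w / 2"] by auto
      then show False using near[OF that, of k] near[OF min, of k] dist_triangle2[of v w "q k"] by simp
    qed
    then have "is_arg_min (f \<omega>) (\<lambda>_. True) v \<longleftrightarrow> v = w" for v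
      using min by (auto simp: is_arg_min_def not_less)
    moreover have "w \<in> K"
    proof -
      have "\<exists>y\<in>K. dist y w < e" if "0 < e" for e
      proof -
        obtain k where k: "r k < e / 2" using r_small[of "e / 2"] \<open>0 < e\<close> by auto
        obtain y where "y \<in> K" "dist (q k) y \<le> r k" using q(1)[of k] by (auto simp: D'_def)
        moreover have "dist y w \<le> dist (q k) y + dist w (q k)" by (metis dist_commute dist_triangle)
        ultimately show ?thesis using near[OF min, of k] k by (intro bexI[of _ y]) auto
      qed
      then have "w \<in> closure K" by (simp add: closure_approachable)
      then show ?thesis using K by simp
    qed
    ultimately show ?lhs by blast
  qed
  have cD: "countable (D' k)" "countable (far k q)" for k q
    using D(1) by (auto simp: D'_def far_def)
  have Bex: "Measurable.pred M (\<lambda>\<omega>. \<exists>i\<in>X. P \<omega> i)"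
    if X: "countable X" and P: "\<And>i. Measurable.pred M (\<lambda>\<omega>. P \<omega> i)" for X :: "'a set" and P
  proof -
    have "{\<omega>\<in>space M. \<exists>i\<in>X. P \<omega> i} = (\<Union>i\<in>X. {\<omega>\<in>space M. P \<omega> i})" by auto
    also have "\<dots> \<in> sets M" using P X by (intro sets.countable_UN') (auto simp: pred_def)
    finally show ?thesis by (simp add: pred_def)
  qed
  have Ball: "Measurable.pred M (\<lambda>\<omega>. \<forall>i\<in>X. P \<omega> i)"
    if X: "countable X" and P: "\<And>i. Measurable.pred M (\<lambda>\<omega>. P \<omega> i)" for X :: "'a set" and P
  proof -
    have "Measurable.pred M (\<lambda>\<omega>. \<not> (\<exists>i\<in>X. \<not> P \<omega> i))"
      by (intro pred_intros_logic Bex X P)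
    then show ?thesis by simp
  qed
  show ?thesis unfolding iff pred_def[symmetric]
    by (intro pred_intros_countable Bex Ball cD) measurable
qed

section \<open>The population gradient\<close>

locale mixup_setting =
  fixes \<mu> :: "real^'d" and \<Sigma> :: "real^'d^'d" and \<Lambda> :: "real measure" and g :: "real \<Rightarrow> real"
  assumes \<mu>_nz: "\<mu> \<noteq> 0" and \<Sigma>_pd: "pos_def \<Sigma>"
    and \<Lambda>_prob: "prob_space \<Lambda>" and \<Lambda>_sets: "sets \<Lambda> = sets (restrict_space borel {0..1})"
    and g_range: "g \<in> {0..1} \<rightarrow> {0..1}"
    and g_meas: "g \<in> borel_measurable (restrict_space borel {0..1})"
    and g_half: "\<forall>z\<in>{0..1}. g z > 1/2 \<longleftrightarrow> z > 1/2"
    and \<Lambda>_nontrivial: "\<P>(l in \<Lambda>. l \<notin> {0, 1} \<and> g l \<noteq> 1/2) > 0"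
begin

sublocale L: prob_space \<Lambda> by (rule \<Lambda>_prob)

abbreviation D :: "real \<Rightarrow> ((real^'d) \<times> real) measure" where
  "D \<equiv> data_dist \<mu> \<Sigma>"

text \<open>The law of an entry with distinct indices: two independent data points and a mixing
  coefficient. Population quantities are integrals against it.\<close>

abbreviation Q :: "real \<Rightarrow> (((real^'d) \<times> real) \<times> ((real^'d) \<times> real) \<times> real) measure" where
  "Q \<kappa> \<equiv> D \<kappa> \<Otimes>\<^sub>M D \<kappa> \<Otimes>\<^sub>M \<Lambda>"

text \<open>The sigma-algebra of \<open>Q \<kappa>\<close> written without \<kappa>, so that
  measurability is shown once for all \<kappa>.\<close>

abbreviation sample_alg :: "(((real^'d) \<times> real) \<times> ((real^'d) \<times> real) \<times> real) measure" where
  "sample_alg \<equiv> (borel \<Otimes>\<^sub>M borel) \<Otimes>\<^sub>M (borel \<Otimes>\<^sub>M borel) \<Otimes>\<^sub>M \<Lambda>"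

definition dir :: "real^'d" where
  "dir = matrix_inv \<Sigma> *v \<mu>"

text \<open>The squared length of \<mu> in the form of the inverse of \<Sigma>, and the value that
  \<open>dir\<close> takes at the class centre; it is all that the noiseless problem sees of \<mu>
  and \<Sigma>.\<close>

definition M :: real where
  "M = dir \<bullet> \<mu>"

definition xt :: "((real^'d) \<times> real) \<times> ((real^'d) \<times> real) \<times> real \<Rightarrow> real^'d" where
  "xt x = g (snd (snd x)) *\<^sub>R fst (fst x) + (1 - g (snd (snd x))) *\<^sub>R fst (fst (snd x))"

definition yt :: "((real^'d) \<times> real) \<times> ((real^'d) \<times> real) \<times> real \<Rightarrow> real" where
  "yt x = snd (snd x) * snd (fst x) + (1 - snd (snd x)) * snd (fst (snd x))"

definition grad_term :: "real^'d \<Rightarrow> ((real^'d) \<times> real) \<times> ((real^'d) \<times> real) \<times> real \<Rightarrow> real^'d" where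
  "grad_term w x = (sigmoid (w \<bullet> xt x) - yt x) *\<^sub>R xt x"

text \<open>A common dominating function for mixed points and gradient terms, with exponential
  moments that are bounded uniformly in \<kappa>.\<close>

definition pair_norm :: "((real^'d) \<times> real) \<times> ((real^'d) \<times> real) \<times> real \<Rightarrow> real" where
  "pair_norm x = norm (fst (fst x)) + norm (fst (fst (snd x)))"

lemma \<Sigma>_dir: "\<Sigma> *v dir = \<mu>"
proof -
  obtain C :: "real^'d^'d" where C: "invertible C" "C ** transpose C = \<Sigma>" using pos_def_factor[OF \<Sigma>_pd] by blast
  have "invertible \<Sigma>"
    using C invertible_mult[OF C(1) transpose_invertible[OF C(1)]] by simp
  then show ?thesis by (simp add: dir_def matrix_vector_mul_assoc invertible_matrix_inv)
qed

lemma dir_nz: "dir \<noteq> 0"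
  using \<Sigma>_dir \<mu>_nz by auto

lemma M_pos: "0 < M"
  using \<Sigma>_pd dir_nz \<Sigma>_dir by (auto simp: pos_def_def M_def)

lemma space_\<Lambda> [simp]: "space \<Lambda> = {0..1}"
  using sets_eq_imp_space_eq[OF \<Lambda>_sets] by (simp add: space_restrict_space)

lemma measurable_id_\<Lambda> [measurable]: "(\<lambda>l. l) \<in> \<Lambda> \<rightarrow>\<^sub>M borel"
  by (subst measurable_cong_sets[OF \<Lambda>_sets refl]) (auto intro: measurable_restrict_space1)

lemma measurable_g [measurable]: "g \<in> \<Lambda> \<rightarrow>\<^sub>M borel"
  by (subst measurable_cong_sets[OF \<Lambda>_sets refl]) (rule g_meas)

lemma g_bounds: "l \<in> {0..1} \<Longrightarrow> 0 \<le> g l" "l \<in> {0..1} \<Longrightarrow> g l \<le> 1"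
  using g_range by (auto simp: Pi_def)

lemma sets_D: "0 < \<kappa> \<Longrightarrow> sets (D \<kappa>) = sets (borel \<Otimes>\<^sub>M borel)"
  by (rule sets_data_dist[OF \<Sigma>_pd])

lemma prob_D: "0 < \<kappa> \<Longrightarrow> prob_space (D \<kappa>)"
  by (rule prob_space_data_dist[OF \<Sigma>_pd])

lemma prob_Q: "0 < \<kappa> \<Longrightarrow> prob_space (Q \<kappa>)"
  by (intro prob_space_pair prob_D \<Lambda>_prob)

lemma sets_Q: "0 < \<kappa> \<Longrightarrow> sets (Q \<kappa>) = sets sample_alg"
  by (intro sets_pair_measure_cong sets_D refl)

lemma measurable_Q: "0 < \<kappa> \<Longrightarrow> f \<in> sample_alg \<rightarrow>\<^sub>M N \<Longrightarrow> f \<in> Q \<kappa> \<rightarrow>\<^sub>M N"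
  by (simp add: measurable_cong_sets[OF sets_Q refl])

lemma measurable_D: "0 < \<kappa> \<Longrightarrow> f \<in> borel \<Otimes>\<^sub>M borel \<rightarrow>\<^sub>M N \<Longrightarrow> f \<in> D \<kappa> \<rightarrow>\<^sub>M N"
  by (simp add: measurable_cong_sets[OF sets_D refl])

lemma measurable_base [measurable]:
  "xt \<in> sample_alg \<rightarrow>\<^sub>M borel"
  "yt \<in> sample_alg \<rightarrow>\<^sub>M borel"
  "grad_term w \<in> sample_alg \<rightarrow>\<^sub>M borel"
  "pair_norm \<in> sample_alg \<rightarrow>\<^sub>M borel"
proof -
  show [measurable]: "xt \<in> sample_alg \<rightarrow>\<^sub>M borel"
    unfolding xt_def by measurable
  show [measurable]: "yt \<in> sample_alg \<rightarrow>\<^sub>M borel"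
    unfolding yt_def by measurable
  show "grad_term w \<in> sample_alg \<rightarrow>\<^sub>M borel"
    unfolding grad_term_def by measurable
  show "pair_norm \<in> sample_alg \<rightarrow>\<^sub>M borel"
    unfolding pair_norm_def by measurable
qed

text \<open>Labels are real numbers, so that they are 0 or 1 is an almost sure event; the pointwise
  estimates are stated on it.\<close>

definition regular :: "((real^'d) \<times> real) \<times> ((real^'d) \<times> real) \<times> real \<Rightarrow> bool" where
  "regular x \<longleftrightarrow> snd (fst x) \<in> {0, 1} \<and> snd (fst (snd x)) \<in> {0, 1} \<and> snd (snd x) \<in> {0..1}"

lemma AE_regular:
  assumes \<kappa>: "0 < \<kappa>"
  shows "AE x in Q \<kappa>. regular x"
proof -
  interpret D: prob_space "D \<kappa>" by (rule prob_D[OF \<kappa>])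
  interpret DL: prob_space "D \<kappa> \<Otimes>\<^sub>M \<Lambda>" by (intro prob_space_pair prob_D[OF \<kappa>] \<Lambda>_prob)
  interpret P1: pair_sigma_finite "D \<kappa>" \<Lambda> ..
  interpret P2: pair_sigma_finite "D \<kappa>" "D \<kappa> \<Otimes>\<^sub>M \<Lambda>" ..
  have lab: "AE z in D \<kappa>. snd z = 0 \<or> snd z = 1" by (rule AE_data_dist_label[OF \<Sigma>_pd \<kappa>])
  have "Measurable.pred ((borel \<Otimes>\<^sub>M borel) \<Otimes>\<^sub>M \<Lambda>) (\<lambda>w::((real^'d) \<times> real) \<times> real. (snd (fst w) = 0 \<or> snd (fst w) = 1) \<and> 0 \<le> snd w \<and> snd w \<le> 1)"
    by measurable
  then have m1: "Measurable.pred (D \<kappa> \<Otimes>\<^sub>M \<Lambda>) (\<lambda>w. (snd (fst w) = 0 \<or> snd (fst w) = 1) \<and> 0 \<le> snd w \<and> snd w \<le> 1)"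
    by (subst measurable_cong_sets[OF sets_pair_measure_cong[OF sets_D[OF \<kappa>] refl] refl])
  have 1: "AE w in D \<kappa> \<Otimes>\<^sub>M \<Lambda>. (snd (fst w) = 0 \<or> snd (fst w) = 1) \<and> 0 \<le> snd w \<and> snd w \<le> 1"
  proof (rule P1.AE_pair_measure)
    show "AE x in D \<kappa>. AE y in \<Lambda>. (snd (fst (x, y)) = 0 \<or> snd (fst (x, y)) = 1) \<and> 0 \<le> snd (x, y) \<and> snd (x, y) \<le> 1"
      using lab by eventually_elim (auto intro!: AE_I2)
  qed (use m1 in \<open>simp add: pred_def\<close>)
  have m2: "Measurable.pred (Q \<kappa>) regular"
    unfolding regular_def by (intro measurable_Q[OF \<kappa>]) (simp, measurable)
  show ?thesis
  proof (rule P2.AE_pair_measure)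
    show "AE x in D \<kappa>. AE y in D \<kappa> \<Otimes>\<^sub>M \<Lambda>. regular (x, y)"
      using lab
    proof eventually_elim
      case (elim z)
      show ?case using 1 by eventually_elim (use elim in \<open>auto simp: regular_def\<close>)
    qed
  qed (use m2 in \<open>simp add: pred_def\<close>)
qed

lemma pair_norm_nonneg: "0 \<le> pair_norm x" by (simp add: pair_norm_def)

lemma regular_bounds:
  assumes "regular x"
  shows "0 \<le> yt x" "yt x \<le> 1" "norm (xt x) \<le> pair_norm x" "\<bar>sigmoid t - yt x\<bar> \<le> 1" "norm (grad_term w x) \<le> pair_norm x"
proof -
  let ?l = "snd (snd x)"
  have l: "?l \<in> {0..1}" using assms by (simp add: regular_def)
  show y: "0 \<le> yt x" "yt x \<le> 1" using assms by (auto simp: regular_def yt_def)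
  have "norm (xt x) \<le> norm (g ?l *\<^sub>R fst (fst x)) + norm ((1 - g ?l) *\<^sub>R fst (fst (snd x)))"
    unfolding xt_def by (rule norm_triangle_ineq)
  also have "\<dots> \<le> 1 * norm (fst (fst x)) + 1 * norm (fst (fst (snd x)))"
    unfolding norm_scaleR using g_bounds[OF l] by (intro add_mono mult_right_mono) auto
  finally show n: "norm (xt x) \<le> pair_norm x" by (simp add: pair_norm_def)
  show s: "\<bar>sigmoid t - yt x\<bar> \<le> 1" for t using y sigmoid_bounds[of t] by (simp add: abs_le_iff)
  have "norm (grad_term w x) \<le> 1 * norm (xt x)"
    unfolding grad_term_def norm_scaleR real_norm_def by (intro mult_right_mono s) auto
  then show "norm (grad_term w x) \<le> pair_norm x" using n by simp
qed

lemma Q_exp_moment: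
  assumes "0 \<le> a"
  obtains K where "1 \<le> K" "\<And>\<kappa>. 1 \<le> \<kappa> \<Longrightarrow> (\<integral>\<^sup>+x. ennreal (exp (a * pair_norm x)) \<partial>Q \<kappa>) \<le> ennreal K"
proof -
  obtain K where K: "1 \<le> K" "\<And>\<kappa>. 1 \<le> \<kappa> \<Longrightarrow> (\<integral>\<^sup>+z. ennreal (exp (a * norm (fst z))) \<partial>D \<kappa>) \<le> ennreal K"
    using data_dist_exp_moment[OF \<Sigma>_pd assms] by blast
  have "(\<integral>\<^sup>+x. ennreal (exp (a * pair_norm x)) \<partial>Q \<kappa>) \<le> ennreal (K * K)" if \<kappa>: "1 \<le> \<kappa>" for \<kappa>
  proof -
    have \<kappa>0: "0 < \<kappa>" using \<kappa> by simp
    have pDL: "prob_space (D \<kappa> \<Otimes>\<^sub>M \<Lambda>)" by (intro prob_space_pair prob_D[OF \<kappa>0] \<Lambda>_prob)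
    note [measurable_cong] = sets_D[OF \<kappa>0]
    define e where "e = (\<lambda>z::(real^'d) \<times> real. ennreal (exp (a * norm (fst z))))"
    have [measurable]: "e \<in> borel_measurable (borel \<Otimes>\<^sub>M borel)" unfolding e_def by measurable
    have "(\<integral>\<^sup>+x. ennreal (exp (a * pair_norm x)) \<partial>Q \<kappa>) = (\<integral>\<^sup>+x. e (fst x) * e (fst (snd x)) \<partial>Q \<kappa>)"
      by (simp add: pair_norm_def e_def ennreal_mult[symmetric] exp_add[symmetric] distrib_left)
    also have "\<dots> = (\<integral>\<^sup>+z. \<integral>\<^sup>+w. e z * e (fst w) \<partial>(D \<kappa> \<Otimes>\<^sub>M \<Lambda>) \<partial>D \<kappa>)"
      by (subst nn_integral_pair_prob_space[OF pDL]) auto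
    also have "\<dots> = (\<integral>\<^sup>+z. e z * (\<integral>\<^sup>+w. e (fst w) \<partial>(D \<kappa> \<Otimes>\<^sub>M \<Lambda>)) \<partial>D \<kappa>)"
      by (simp add: nn_integral_cmult)
    also have "(\<integral>\<^sup>+w. e (fst w) \<partial>(D \<kappa> \<Otimes>\<^sub>M \<Lambda>)) = integral\<^sup>N (D \<kappa>) e"
      by (subst nn_integral_pair_prob_space[OF \<Lambda>_prob]) (auto simp: L.emeasure_space_1[simplified])
    also have "(\<integral>\<^sup>+z. e z * integral\<^sup>N (D \<kappa>) e \<partial>D \<kappa>) = integral\<^sup>N (D \<kappa>) e * integral\<^sup>N (D \<kappa>) e"
      by (simp add: nn_integral_multc)
    also have "\<dots> \<le> ennreal K * ennreal K"
      using K(2)[OF \<kappa>] unfolding e_def by (intro mult_mono) auto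
    also have "\<dots> = ennreal (K * K)" using K(1) by (simp add: ennreal_mult)
    finally show ?thesis .
  qed
  moreover have "1 \<le> K * K" using K(1) mult_mono[of 1 K 1 K] by simp
  ultimately show ?thesis using that by blast
qed

lemma integrable_Q:
  fixes f :: "_ \<Rightarrow> 'e::{banach, second_countable_topology}"
  assumes \<kappa>: "1 \<le> \<kappa>" and f: "f \<in> borel_measurable sample_alg"
    and le: "\<And>x. regular x \<Longrightarrow> norm (f x) \<le> c * exp (2 * pair_norm x)"
  shows "integrable (Q \<kappa>) f"
proof -
  have \<kappa>0: "0 < \<kappa>" using \<kappa> by simp
  obtain K where K: "1 \<le> K" "(\<integral>\<^sup>+x. ennreal (exp (2 * pair_norm x)) \<partial>Q \<kappa>) \<le> ennreal K"
    using Q_exp_moment[of 2] \<kappa> by (metis zero_le_numeral)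
  have "(\<lambda>x. exp (2 * pair_norm x)) \<in> borel_measurable (Q \<kappa>)" by (intro measurable_Q[OF \<kappa>0]) measurable
  then have "integrable (Q \<kappa>) (\<lambda>x. exp (2 * pair_norm x))"
    using K by (intro integrableI_nonneg) (auto intro: le_less_trans)
  then have "integrable (Q \<kappa>) (\<lambda>x. c * exp (2 * pair_norm x))" by simp
  then show ?thesis
  proof (rule Bochner_Integration.integrable_bound)
    show "f \<in> borel_measurable (Q \<kappa>)" by (intro measurable_Q[OF \<kappa>0] f)
    show "AE x in Q \<kappa>. norm (f x) \<le> norm (c * exp (2 * pair_norm x))"
      using AE_regular[OF \<kappa>0]
    proof eventually_elim
      case (elim x)
      then show ?case using le[OF elim] by simp
    qed
  qed
qed

lemma pair_norm_le_exp: "pair_norm x \<le> exp (2 * pair_norm x)" "(pair_norm x)\<^sup>2 \<le> exp (2 * pair_norm x)"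
proof -
  have s: "pair_norm x \<le> exp (pair_norm x)" using exp_ge_add_one_self[of "pair_norm x"] by linarith
  also have "\<dots> \<le> exp (2 * pair_norm x)" using pair_norm_nonneg[of x] by simp
  finally show "pair_norm x \<le> exp (2 * pair_norm x)" .
  have "(pair_norm x)\<^sup>2 \<le> (exp (pair_norm x))\<^sup>2" using s pair_norm_nonneg by (intro power_mono) auto
  then show "(pair_norm x)\<^sup>2 \<le> exp (2 * pair_norm x)" by (simp add: power2_eq_square exp_add[symmetric])
qed

lemma integrable_grad_term: "1 \<le> \<kappa> \<Longrightarrow> integrable (Q \<kappa>) (grad_term w)"
  by (rule integrable_Q[where c=1]) (auto intro: order_trans[OF regular_bounds(5) pair_norm_le_exp(1)])

text \<open>The reflection fixing \<^term>\<open>\<mu>\<close> that is orthogonal for the form of \<^term>\<open>matrix_inv \<Sigma>\<close>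
  preserves the law of the data, so the population gradient at a multiple of \<^term>\<open>dir\<close> is a multiple
  of \<^term>\<open>\<mu>\<close>.\<close>

lemma gradient_reflection:
  assumes \<kappa>: "1 \<le> \<kappa>"
  shows "M *\<^sub>R (\<integral>x. grad_term (c *\<^sub>R dir) x \<partial>Q \<kappa>) = (dir \<bullet> (\<integral>x. grad_term (c *\<^sub>R dir) x \<partial>Q \<kappa>)) *\<^sub>R \<mu>"
proof -
  have \<kappa>0: "0 < \<kappa>" using \<kappa> by simp
  interpret D: prob_space "D \<kappa>" by (rule prob_D[OF \<kappa>0])
  interpret DL: prob_space "D \<kappa> \<Otimes>\<^sub>M \<Lambda>" by (intro prob_space_pair prob_D[OF \<kappa>0] \<Lambda>_prob)
  define \<rho> where "\<rho> = (\<lambda>x::real^'d. (2 * (dir \<bullet> x) / M) *\<^sub>R \<mu> - x)"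
  define R where "R = (\<lambda>z::(real^'d) \<times> real. (\<rho> (fst z), snd z))"
  have lin: "linear \<rho>"
    by (rule linearI) (simp_all add: \<rho>_def inner_add_right algebra_simps add_divide_distrib)
  then have bl: "bounded_linear \<rho>" by (simp add: linear_linear)
  have dir\<rho>: "dir \<bullet> \<rho> x = dir \<bullet> x" for x
    using M_pos by (simp add: \<rho>_def inner_diff_right M_def)
  have R_meas: "R \<in> borel \<Otimes>\<^sub>M borel \<rightarrow>\<^sub>M borel \<Otimes>\<^sub>M borel" unfolding R_def \<rho>_def by measurable
  have R_meas': "R \<in> D \<kappa> \<rightarrow>\<^sub>M borel \<Otimes>\<^sub>M borel" by (rule measurable_D[OF \<kappa>0 R_meas])
  have DR: "distr (D \<kappa>) (borel \<Otimes>\<^sub>M borel) R = D \<kappa>"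
    using data_dist_reflection[OF \<Sigma>_pd \<kappa>0 \<Sigma>_dir dir_nz] by (simp add: R_def \<rho>_def M_def)
  have "distr (D \<kappa>) (borel \<Otimes>\<^sub>M borel) R \<Otimes>\<^sub>M distr \<Lambda> \<Lambda> (\<lambda>l. l) =
      distr (D \<kappa> \<Otimes>\<^sub>M \<Lambda>) ((borel \<Otimes>\<^sub>M borel) \<Otimes>\<^sub>M \<Lambda>) (\<lambda>(z, l). (R z, l))"
    by (rule pair_measure_distr) (auto simp: distr_id R_meas' intro: L.sigma_finite_measure_axioms)
  then have DL: "distr (D \<kappa> \<Otimes>\<^sub>M \<Lambda>) ((borel \<Otimes>\<^sub>M borel) \<Otimes>\<^sub>M \<Lambda>) (\<lambda>(z, l). (R z, l)) = D \<kappa> \<Otimes>\<^sub>M \<Lambda>"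
    by (simp add: DR distr_id)
  have RL_meas: "(\<lambda>(z, l). (R z, l)) \<in> D \<kappa> \<Otimes>\<^sub>M \<Lambda> \<rightarrow>\<^sub>M (borel \<Otimes>\<^sub>M borel) \<Otimes>\<^sub>M \<Lambda>"
    using R_meas' by measurable
  have "distr (D \<kappa>) (borel \<Otimes>\<^sub>M borel) R \<Otimes>\<^sub>M distr (D \<kappa> \<Otimes>\<^sub>M \<Lambda>) ((borel \<Otimes>\<^sub>M borel) \<Otimes>\<^sub>M \<Lambda>) (\<lambda>(z, l). (R z, l)) =
      distr (Q \<kappa>) sample_alg (\<lambda>(z, w). (R z, (\<lambda>(z, l). (R z, l)) w))"
    by (rule pair_measure_distr) (auto simp: DL R_meas' RL_meas intro: DL.sigma_finite_measure_axioms)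
  then have QR: "distr (Q \<kappa>) sample_alg (\<lambda>(z, w). (R z, (\<lambda>(z, l). (R z, l)) w)) = Q \<kappa>"
    by (simp add: DR DL)
  have QR_meas: "(\<lambda>(z, w). (R z, (\<lambda>(z, l). (R z, l)) w)) \<in> Q \<kappa> \<rightarrow>\<^sub>M sample_alg"
    using R_meas' RL_meas by measurable
  define G where "G = (\<integral>x. grad_term (c *\<^sub>R dir) x \<partial>Q \<kappa>)"
  \<comment> \<open>The reflection is linear and so commutes with mixing; it preserves
    \<open>dir \<bullet> xt x\<close> and the labels, hence the scalar factor of the gradient
    term.\<close>
  have pt: "grad_term (c *\<^sub>R dir) ((\<lambda>(z, w). (R z, (\<lambda>(z, l). (R z, l)) w)) x) = \<rho> (grad_term (c *\<^sub>R dir) x)" for x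
  proof -
    obtain z z' l where x: "x = (z, z', l)" by (cases x) auto
    have "xt (R z, R z', l) = \<rho> (xt x)"
      by (simp add: x xt_def R_def linear_add[OF lin] linear_scale[OF lin])
    moreover have "yt (R z, R z', l) = yt x" by (simp add: x yt_def R_def)
    ultimately show ?thesis by (simp add: x grad_term_def dir\<rho> linear_scale[OF lin])
  qed
  have "G = (\<integral>x. grad_term (c *\<^sub>R dir) x \<partial>distr (Q \<kappa>) sample_alg (\<lambda>(z, w). (R z, (\<lambda>(z, l). (R z, l)) w)))"
    by (simp only: G_def QR)
  also have "\<dots> = (\<integral>x. \<rho> (grad_term (c *\<^sub>R dir) x) \<partial>Q \<kappa>)"
    by (subst integral_distr[OF QR_meas]) (simp_all only: pt measurable_base)
  also have "\<dots> = \<rho> G"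
    unfolding G_def by (rule integral_bounded_linear[OF bl integrable_grad_term[OF \<kappa>]])
  \<comment> \<open>The vectors fixed by the reflection are the multiples of \<mu>.\<close>
  finally have "G + G = (2 * (dir \<bullet> G) / M) *\<^sub>R \<mu>" by (simp add: \<rho>_def algebra_simps)
  then have "2 *\<^sub>R G = 2 *\<^sub>R (((dir \<bullet> G) / M) *\<^sub>R \<mu>)" by (simp add: scaleR_2[symmetric])
  then have "G = ((dir \<bullet> G) / M) *\<^sub>R \<mu>" by (simp only: scaleR_cancel_left) simp
  then have "M *\<^sub>R G = M *\<^sub>R (((dir \<bullet> G) / M) *\<^sub>R \<mu>)" by simp
  then show ?thesis using M_pos by (simp add: G_def)
qed

end

section \<open>The noiseless problem and averages over the labels\<close>

lemma sigmoid_minus: "sigmoid (- t) = 1 - sigmoid t"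
proof -
  have "1 + exp (- t) \<noteq> 0" "1 + exp t \<noteq> 0" by (metis add_pos_pos exp_gt_zero less_irrefl zero_less_one)+
  then show ?thesis by (simp add: sigmoid_def exp_minus field_simps)
qed

lemma sigmoid_zero: "sigmoid 0 = 1 / 2"
  by (simp add: sigmoid_def)

lemma one_minus_sigmoid_le:
  assumes "0 < t"
  shows "1 - sigmoid t \<le> 1 / t"
proof -
  have "1 - sigmoid t = 1 / (1 + exp t)" unfolding sigmoid_minus[symmetric] by (simp add: sigmoid_def)
  also have "\<dots> \<le> 1 / t"
  proof (rule divide_left_mono)
    show "t \<le> 1 + exp t" using exp_ge_add_one_self[of t] by linarith
    show "0 < (1 + exp t) * t" using assms by (intro mult_pos_pos add_pos_pos) auto
  qed simp
  finally show ?thesis .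
qed

context mixup_setting
begin

lemma integral_label:
  fixes f :: "bool \<Rightarrow> real"
  assumes \<kappa>: "0 < \<kappa>"
  shows "(\<integral>z. f (snd z = 1) \<partial>D \<kappa>) = (f False + f True) / 2"
proof -
  interpret D: prob_space "D \<kappa>" by (rule prob_D[OF \<kappa>])
  have lab: "AE z in D \<kappa>. snd z = 0 \<or> snd z = 1" by (rule AE_data_dist_label[OF \<Sigma>_pd \<kappa>])
  have meas: "(\<lambda>z. snd z) \<in> borel_measurable (D \<kappa>)" by (intro measurable_D[OF \<kappa>]) measurable
  have int: "integrable (D \<kappa>) (\<lambda>z. snd z)"
    using lab by (intro D.integrable_const_bound[of _ 1] meas) (auto elim!: eventually_mono)
  have "(\<integral>z. snd z \<partial>D \<kappa>) = enn2real (\<integral>\<^sup>+z. ennreal (snd z) \<partial>D \<kappa>)"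
    using lab by (intro integral_eq_nn_integral meas) (auto elim!: eventually_mono)
  also have "(\<integral>\<^sup>+z. ennreal (snd z) \<partial>D \<kappa>) = (ennreal 1 + ennreal 0) / 2"
    by (rule nn_integral_data_dist_label[OF \<Sigma>_pd \<kappa>]) simp
  also have "\<dots> = ennreal (1 / 2)" using divide_ennreal[of 1 2] by simp
  also have "enn2real (ennreal (1 / 2)) = 1 / 2" by (rule enn2real_ennreal) simp
  finally have half: "(\<integral>z. snd z \<partial>D \<kappa>) = 1 / 2" .
  have "(\<lambda>z. if snd z = 1 then f True else f False) \<in> borel_measurable (D \<kappa>)"
    by (intro measurable_D[OF \<kappa>]) measurable
  moreover have "(\<lambda>z::(real^'d) \<times> real. if snd z = 1 then f True else f False) = (\<lambda>z. f (snd z = 1))"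
    by (auto simp: fun_eq_iff)
  ultimately have "(\<lambda>z. f (snd z = 1)) \<in> borel_measurable (D \<kappa>)" by simp
  \<comment> \<open>On the values 0 and 1 every function of the label is affine in it, so the mean
    label \<open>1 / 2\<close> determines the integral.\<close>
  then have "(\<integral>z. f (snd z = 1) \<partial>D \<kappa>) = (\<integral>z. f False + (f True - f False) * snd z \<partial>D \<kappa>)"
    using meas lab by (intro integral_cong_AE) (auto elim!: eventually_mono)
  also have "\<dots> = f False + (f True - f False) * (1 / 2)"
    using int by (simp add: half D.prob_space)
  finally show ?thesis by (simp add: field_simps)
qed

text \<open>Fubini, with an average over one label at each of two stages: the four combinations of
  labels have weight \<open>1 / 4\<close> each. The integrand sees the points through their labels
  only, so the result does not depend on \<kappa>.\<close>

lemma integral_Q_label: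
  fixes \<Phi> :: "bool \<Rightarrow> bool \<Rightarrow> real \<Rightarrow> real"
  assumes \<kappa>: "0 < \<kappa>" and \<Phi> [measurable]: "\<And>b b'. \<Phi> b b' \<in> borel_measurable \<Lambda>"
    and bound: "\<And>b b' l. l \<in> {0..1} \<Longrightarrow> \<bar>\<Phi> b b' l\<bar> \<le> c"
  shows "integrable (Q \<kappa>) (\<lambda>x. \<Phi> (snd (fst x) = 1) (snd (fst (snd x)) = 1) (snd (snd x)))" (is "integrable _ ?f")
    and "(\<integral>x. \<Phi> (snd (fst x) = 1) (snd (fst (snd x)) = 1) (snd (snd x)) \<partial>Q \<kappa>) =
      (\<integral>l. \<Phi> True True l + \<Phi> False False l + \<Phi> True False l + \<Phi> False True l \<partial>\<Lambda>) / 4"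
proof -
  interpret D: prob_space "D \<kappa>" by (rule prob_D[OF \<kappa>])
  interpret DL: prob_space "D \<kappa> \<Otimes>\<^sub>M \<Lambda>" by (intro prob_space_pair prob_D[OF \<kappa>] \<Lambda>_prob)
  interpret QQ: prob_space "Q \<kappa>" by (rule prob_Q[OF \<kappa>])
  interpret P1: pair_sigma_finite "D \<kappa>" \<Lambda> ..
  interpret P2: pair_sigma_finite "D \<kappa>" "D \<kappa> \<Otimes>\<^sub>M \<Lambda>" ..
  note [measurable_cong] = sets_D[OF \<kappa>]
  have f_eq: "?f = (\<lambda>x. if snd (fst x) = 1
      then (if snd (fst (snd x)) = 1 then \<Phi> True True (snd (snd x)) else \<Phi> True False (snd (snd x)))
      else (if snd (fst (snd x)) = 1 then \<Phi> False True (snd (snd x)) else \<Phi> False False (snd (snd x))))"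
    by (auto simp: fun_eq_iff)
  have [measurable]: "?f \<in> borel_measurable (Q \<kappa>)" unfolding f_eq by measurable
  have bnd: "x \<in> space (Q \<kappa>) \<Longrightarrow> \<bar>?f x\<bar> \<le> c" for x
    using bound by (auto simp: space_pair_measure)
  show int: "integrable (Q \<kappa>) ?f"
    using bnd by (intro QQ.integrable_const_bound[of _ c] AE_I2) auto
  have intL: "integrable \<Lambda> (\<Phi> b b')" for b b'
    using bound by (intro L.integrable_const_bound[of _ c] AE_I2) auto
  define J where "J = (\<lambda>b b'. \<integral>l. \<Phi> b b' l \<partial>\<Lambda>)"
  have inner: "(\<integral>w. \<Phi> b (snd (fst w) = 1) (snd w) \<partial>(D \<kappa> \<Otimes>\<^sub>M \<Lambda>)) = (J b False + J b True) / 2" for b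
  proof -
    have eq: "(\<lambda>w::((real^'d) \<times> real) \<times> real. \<Phi> b (snd (fst w) = 1) (snd w)) =
       (\<lambda>w. if snd (fst w) = 1 then \<Phi> b True (snd w) else \<Phi> b False (snd w))"
      by (auto simp: fun_eq_iff)
    have m: "(\<lambda>w::((real^'d) \<times> real) \<times> real. \<Phi> b (snd (fst w) = 1) (snd w)) \<in> borel_measurable (D \<kappa> \<Otimes>\<^sub>M \<Lambda>)"
      unfolding eq by measurable
    have "integrable (D \<kappa> \<Otimes>\<^sub>M \<Lambda>) (\<lambda>w. \<Phi> b (snd (fst w) = 1) (snd w))"
      using bound by (intro DL.integrable_const_bound[of _ c] AE_I2 m) (auto simp: space_pair_measure)
    from P1.integral_fst'[OF this]
    have "(\<integral>w. \<Phi> b (snd (fst w) = 1) (snd w) \<partial>(D \<kappa> \<Otimes>\<^sub>M \<Lambda>)) = (\<integral>z. J b (snd z = 1) \<partial>D \<kappa>)"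
      by (simp add: J_def)
    also have "\<dots> = (J b False + J b True) / 2" by (rule integral_label[OF \<kappa>])
    finally show ?thesis .
  qed
  have "integral\<^sup>L (Q \<kappa>) ?f = (\<integral>z. (J (snd z = 1) False + J (snd z = 1) True) / 2 \<partial>D \<kappa>)"
    using P2.integral_fst'[OF int] by (simp add: inner)
  also have "\<dots> = ((J False False + J False True) / 2 + (J True False + J True True) / 2) / 2"
    by (rule integral_label[OF \<kappa>])
  also have "\<dots> = (\<integral>l. \<Phi> True True l + \<Phi> False False l + \<Phi> True False l + \<Phi> False True l \<partial>\<Lambda>) / 4"
    using intL by (simp add: J_def field_simps)
  finally show "integral\<^sup>L (Q \<kappa>) ?f = (\<integral>l. \<Phi> True True l + \<Phi> False False l + \<Phi> True False l + \<Phi> False True l \<partial>\<Lambda>) / 4" .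
qed

text \<open>The integrand of the slope along \<open>dir\<close> at \<open>c *\<^sub>R dir\<close>
  when both points sit at their class centres: the mixed point is then
  \<open>a *\<^sub>R \<mu>\<close>, at which \<open>dir\<close> takes the value
  \<open>M * a\<close>. Labels are Booleans here, so that averaging over them is a finite
  sum.\<close>

definition noiseless :: "real \<Rightarrow> bool \<Rightarrow> bool \<Rightarrow> real \<Rightarrow> real" where
  "noiseless c b b' l = (let a = g l * (2 * of_bool b - 1) + (1 - g l) * (2 * of_bool b' - 1)
     in (sigmoid (c * (M * a)) - (l * of_bool b + (1 - l) * of_bool b')) * (M * a))"

abbreviation noiseless_at :: "real \<Rightarrow> ((real^'d) \<times> real) \<times> ((real^'d) \<times> real) \<times> real \<Rightarrow> real" where
  "noiseless_at c x \<equiv> noiseless c (snd (fst x) = 1) (snd (fst (snd x)) = 1) (snd (snd x))"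

text \<open>By the symmetry of the sigmoid, the two combinations with equal labels contribute alike,
  and so do the two with opposite labels. Equal labels drive \<open>c\<close> up through
  \<open>1 - sigmoid (c * M)\<close>; opposite labels hold it back once \<open>c\<close> is
  large.\<close>

lemma noiseless_sum:
  "noiseless c True True l + noiseless c False False l + noiseless c True False l + noiseless c False True l =
   2 * M * ((sigmoid (c * M * (2 * g l - 1)) - l) * (2 * g l - 1) - (1 - sigmoid (c * M)))"
proof -
  define h where "h = 2 * g l - 1"
  define S where "S = sigmoid (c * M * h)"
  define T where "T = sigmoid (c * M)"
  have eqs: "g l * (2 * of_bool True - 1) + (1 - g l) * (2 * of_bool True - 1) = (1::real)"
    "g l * (2 * of_bool False - 1) + (1 - g l) * (2 * of_bool False - 1) = (-1::real)"
    "g l * (2 * of_bool True - 1) + (1 - g l) * (2 * of_bool False - 1) = h"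
    "g l * (2 * of_bool False - 1) + (1 - g l) * (2 * of_bool True - 1) = - h"
    by (simp_all add: h_def algebra_simps)
  have sg: "sigmoid (c * (M * 1)) = T" "sigmoid (c * (M * (- 1))) = 1 - T"
    "sigmoid (c * (M * h)) = S" "sigmoid (c * (M * (- h))) = 1 - S"
    using sigmoid_minus[of "c * M"] sigmoid_minus[of "c * M * h"] by (simp_all add: T_def S_def mult.assoc)
  show ?thesis
    unfolding noiseless_def Let_def eqs sg h_def[symmetric] S_def[symmetric] T_def[symmetric]
    by (simp add: algebra_simps)
qed

lemma measurable_noiseless [measurable]: "noiseless c b b' \<in> borel_measurable \<Lambda>"
  unfolding noiseless_def Let_def by measurable

lemma noiseless_bound:
  assumes l: "l \<in> {0..1}"
  shows "\<bar>noiseless c b b' l\<bar> \<le> M"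
proof -
  define a where "a = g l * (2 * of_bool b - 1) + (1 - g l) * (2 * of_bool b' - 1 :: real)"
  define y where "y = l * of_bool b + (1 - l) * (of_bool b' :: real)"
  have a: "\<bar>a\<bar> \<le> 1" using g_bounds[OF l] by (cases b; cases b') (auto simp: a_def)
  have y: "0 \<le> y" "y \<le> 1" using l by (cases b; cases b'; auto simp: y_def)+
  have "\<bar>sigmoid (c * (M * a)) - y\<bar> \<le> 1" using y sigmoid_bounds[of "c * (M * a)"] by (simp add: abs_le_iff)
  moreover have "\<bar>M * a\<bar> \<le> M" using a M_pos by (simp add: abs_mult)
  ultimately have "\<bar>sigmoid (c * (M * a)) - y\<bar> * \<bar>M * a\<bar> \<le> 1 * M" by (intro mult_mono) auto
  then show ?thesis by (simp add: noiseless_def Let_def a_def y_def abs_mult)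
qed

text \<open>For \<open>l\<close> in \<open>{0..1}\<close> and \<open>h = 2 * g l - 1\<close>, this
  is the limit of \<open>(sigmoid (c * M * h) - l) * h\<close> as \<open>c\<close> tends to
  infinity, because \<open>g_half\<close> puts \<open>g l\<close> and \<open>l\<close> on the same
  side of \<open>1/2\<close>.\<close>

definition gap :: "real \<Rightarrow> real" where
  "gap l = min l (1 - l) * \<bar>2 * g l - 1\<bar>"

lemma gap_nonneg: "l \<in> {0..1} \<Longrightarrow> 0 \<le> gap l"
  by (simp add: gap_def)

lemma gap_le: "l \<in> {0..1} \<Longrightarrow> gap l \<le> 1"
  using g_bounds[of l] unfolding gap_def by (intro mult_le_one) (auto simp: abs_le_iff)

lemma measurable_gap [measurable]: "gap \<in> borel_measurable \<Lambda>"
  unfolding gap_def by measurable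

definition P0 :: real where
  "P0 = (\<integral>l. gap l \<partial>\<Lambda>)"

lemma integrable_gap: "integrable \<Lambda> gap"
  using gap_nonneg gap_le by (intro L.integrable_const_bound[of _ 1] AE_I2) auto

text \<open>A nonnegative function of mean zero vanishes almost surely, but \<open>gap\<close>
  vanishes only where \<open>l\<close> is 0 or 1 or \<open>g l\<close> is \<open>1/2\<close>,
  against \<open>\<Lambda>_nontrivial\<close>.\<close>

lemma P0_pos: "0 < P0"
proof -
  have "P0 \<noteq> 0"
  proof
    assume "P0 = 0"
    then have "AE l in \<Lambda>. gap l = 0"
      unfolding P0_def using gap_nonneg integrable_gap
      by (subst (asm) integral_nonneg_eq_0_iff_AE) auto
    then have "AE l in \<Lambda>. \<not> (l \<notin> {0, 1} \<and> g l \<noteq> 1/2)"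
    proof eventually_elim
      case (elim l)
      then show ?case by (auto simp: gap_def min_def split: if_splits)
    qed
    then have "\<P>(l in \<Lambda>. l \<notin> {0, 1} \<and> g l \<noteq> 1/2) = 0"
      by (rule L.prob_eq_0_AE)
    then show False using \<Lambda>_nontrivial by simp
  qed
  moreover have "0 \<le> P0" unfolding P0_def using gap_nonneg by (intro integral_nonneg_AE AE_I2) auto
  ultimately show ?thesis by simp
qed

lemma P0_le: "P0 \<le> 1"
proof -
  have "P0 \<le> (\<integral>l. 1 \<partial>\<Lambda>)" unfolding P0_def
    using gap_le integrable_gap by (intro integral_mono_AE AE_I2) auto
  then show ?thesis by (simp add: L.prob_space[simplified])
qed

text \<open>At \<open>c = 0\<close> both sigmoids are \<open>1/2\<close>, and
  \<open>(1/2 - l) * h \<le> 0\<close> since \<open>g_half\<close> lets the mixed point lean towards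
  the heavier label. Moving away from \<open>c = 0\<close> costs at most \<open>c * M\<close> for
  each sigmoid, by the Lipschitz bound.\<close>

lemma noiseless_upper:
  assumes l: "l \<in> {0..1}" and c: "0 \<le> c"
  shows "(sigmoid (c * M * (2 * g l - 1)) - l) * (2 * g l - 1) - (1 - sigmoid (c * M)) \<le> - (1/2) + 2 * (c * M)"
proof -
  define h where "h = 2 * g l - 1"
  have h: "\<bar>h\<bar> \<le> 1" using g_bounds[OF l] by (simp add: h_def abs_le_iff)
  have cM: "0 \<le> c * M" using c M_pos by simp
  have 1: "sigmoid (c * M) \<le> 1/2 + c * M"
    using sigmoid_lipschitz[of "c * M" 0] cM by (simp add: sigmoid_zero abs_le_iff)
  have "\<bar>c * M * h\<bar> = c * M * \<bar>h\<bar>" by (subst abs_mult) (simp only: abs_of_nonneg[OF cM])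
  then have "\<bar>sigmoid (c * M * h) - 1/2\<bar> \<le> c * M * \<bar>h\<bar>"
    using sigmoid_lipschitz[of "c * M * h" 0] by (simp only: sigmoid_zero diff_zero)
  also have "\<dots> \<le> c * M * 1" using h cM by (intro mult_left_mono) auto
  finally have "\<bar>(sigmoid (c * M * h) - 1/2) * h\<bar> \<le> (c * M) * 1"
    unfolding abs_mult using h cM by (intro mult_mono) auto
  moreover have "(1/2 - l) * h \<le> 0"
  proof (cases "1/2 < l")
    case True
    then have "1/2 < g l" using g_half l by blast
    then have "0 < h" by (simp add: h_def)
    then show ?thesis using True by (intro mult_nonpos_nonneg) auto
  next
    case False
    then have "\<not> 1/2 < g l" using g_half l by blast
    then have "h \<le> 0" by (simp add: h_def)
    then show ?thesis using False by (intro mult_nonneg_nonpos) auto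
  qed
  ultimately have "(sigmoid (c * M * h) - l) * h \<le> c * M" by (simp add: algebra_simps abs_le_iff)
  then show ?thesis using 1 unfolding h_def[symmetric] by simp
qed

text \<open>Each of the two terms falls short of its limit by at most \<open>1 / (c * M)\<close>,
  because \<open>1 - sigmoid t \<le> 1 / t\<close>. The bound is uniform in \<open>l\<close>: the
  outer factor \<open>h\<close> cancels the one inside the sigmoid.\<close>

lemma noiseless_lower:
  assumes l: "l \<in> {0..1}" and c: "0 < c"
  shows "gap l - 2 / (c * M) \<le> (sigmoid (c * M * (2 * g l - 1)) - l) * (2 * g l - 1) - (1 - sigmoid (c * M))"
proof -
  define h where "h = 2 * g l - 1"
  have cM: "0 < c * M" using c M_pos by simp
  have tail: "(1 - sigmoid (c * M * k)) * k \<le> 1 / (c * M)" if "0 \<le> k" for k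
  proof (cases "k = 0")
    case False
    then have k: "0 < k" using that by simp
    have "(1 - sigmoid (c * M * k)) * k \<le> 1 / (c * M * k) * k"
      using one_minus_sigmoid_le[of "c * M * k"] cM k by (intro mult_right_mono) auto
    then show ?thesis using k by simp
  qed (use cM in simp)
  have 1: "1 - sigmoid (c * M) \<le> 1 / (c * M)" by (rule one_minus_sigmoid_le[OF cM])
  have "gap l - 1 / (c * M) \<le> (sigmoid (c * M * h) - l) * h"
  proof (cases "1/2 < l")
    case True
    then have "1/2 < g l" using g_half l by blast
    then have h: "0 < h" by (simp add: h_def)
    have "gap l = (1 - l) * h" using True h by (simp add: gap_def h_def[symmetric])
    then show ?thesis using tail[of h] h by (simp add: algebra_simps)
  next
    case False
    then have "\<not> 1/2 < g l" using g_half l by blast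
    then have h: "h \<le> 0" by (simp add: h_def)
    have "gap l = l * (- h)" using False h by (simp add: gap_def h_def[symmetric])
    moreover have "1 - sigmoid (c * M * (- h)) = sigmoid (c * M * h)" using sigmoid_minus[of "c * M * h"] by simp
    then have "sigmoid (c * M * h) * (- h) \<le> 1 / (c * M)" using tail[of "- h"] h by (simp only:)
    ultimately show ?thesis by (simp add: algebra_simps)
  qed
  from diff_mono[OF this 1] show ?thesis unfolding h_def[symmetric] by simp
qed

lemma integral_noiseless:
  assumes \<kappa>: "0 < \<kappa>"
  shows "integrable (Q \<kappa>) (\<lambda>x. noiseless_at c x)"
    and "0 \<le> c \<Longrightarrow> (\<integral>x. noiseless_at c x \<partial>Q \<kappa>) \<le> M / 2 * (- (1/2) + 2 * (c * M))"
    and "0 < c \<Longrightarrow> M / 2 * (P0 - 2 / (c * M)) \<le> (\<integral>x. noiseless_at c x \<partial>Q \<kappa>)"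
proof -
  define s where "s = (\<lambda>l. noiseless c True True l + noiseless c False False l + noiseless c True False l + noiseless c False True l)"
  have [measurable]: "s \<in> borel_measurable \<Lambda>" unfolding s_def by measurable
  note Q = integral_Q_label[where \<Phi>="noiseless c" and c=M, OF \<kappa> measurable_noiseless noiseless_bound]
  show "integrable (Q \<kappa>) (\<lambda>x. noiseless_at c x)" by (rule Q(1))
  have eq: "(\<integral>x. noiseless_at c x \<partial>Q \<kappa>) = (\<integral>l. s l \<partial>\<Lambda>) / 4"
    unfolding s_def by (rule Q(2))
  have int: "integrable \<Lambda> s"
    unfolding s_def using noiseless_bound
    by (intro Bochner_Integration.integrable_add L.integrable_const_bound[of _ M] AE_I2) auto
  show "(\<integral>x. noiseless_at c x \<partial>Q \<kappa>) \<le> M / 2 * (- (1/2) + 2 * (c * M))" if "0 \<le> c"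
  proof -
    have "(\<integral>l. s l \<partial>\<Lambda>) \<le> (\<integral>l. 2 * M * (- (1/2) + 2 * (c * M)) \<partial>\<Lambda>)"
      using int noiseless_upper[OF _ that] M_pos unfolding s_def noiseless_sum
      by (intro integral_mono_AE AE_I2) (auto intro!: mult_left_mono)
    then show ?thesis unfolding eq by (simp add: L.prob_space[simplified] algebra_simps)
  qed
  show "M / 2 * (P0 - 2 / (c * M)) \<le> (\<integral>x. noiseless_at c x \<partial>Q \<kappa>)" if "0 < c"
  proof -
    have "(\<integral>l. 2 * M * (gap l - 2 / (c * M)) \<partial>\<Lambda>) \<le> (\<integral>l. s l \<partial>\<Lambda>)"
      using int noiseless_lower[OF _ that] M_pos integrable_gap unfolding s_def noiseless_sum
      by (intro integral_mono_AE AE_I2) (auto intro!: mult_left_mono)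
    moreover have "(\<integral>l. gap l - 2 / (c * M) \<partial>\<Lambda>) = P0 - 2 / (c * M)"
      using integrable_gap by (simp add: P0_def L.prob_space[simplified])
    ultimately have "2 * M * (P0 - 2 / (c * M)) \<le> (\<integral>l. s l \<partial>\<Lambda>)"
      by (simp only: integral_mult_right_zero)
    then show ?thesis unfolding eq by simp
  qed
qed

section \<open>The slope of the population loss along \<open>dir\<close> and its zero\<close>

definition slope :: "real \<Rightarrow> real \<Rightarrow> real" where
  "slope \<kappa> c = dir \<bullet> (\<integral>x. grad_term (c *\<^sub>R dir) x \<partial>Q \<kappa>)"

lemma slope_eq: "1 \<le> \<kappa> \<Longrightarrow> slope \<kappa> c = (\<integral>x. dir \<bullet> grad_term (c *\<^sub>R dir) x \<partial>Q \<kappa>)"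
  unfolding slope_def using integrable_grad_term by (intro integral_inner_right[symmetric])

lemma dir_xt_le: "regular x \<Longrightarrow> \<bar>dir \<bullet> xt x\<bar> \<le> norm dir * pair_norm x"
  using Cauchy_Schwarz_ineq2[of dir "xt x"] regular_bounds(3)[of x] mult_left_mono[of "norm (xt x)" "pair_norm x" "norm dir"]
  by simp

text \<open>The sigmoid is Lipschitz with constant 1, so a change of \<open>c\<close> alters the
  integrand by at most that change times the square of \<open>dir \<bullet> xt x\<close>, which has
  finite mean. The continuity is for the intermediate value theorem.\<close>

lemma continuous_slope:
  assumes \<kappa>: "1 \<le> \<kappa>"
  shows "continuous_on UNIV (slope \<kappa>)"
proof -
  have \<kappa>0: "0 < \<kappa>" using \<kappa> by simp
  define B where "B = (norm dir)\<^sup>2 * (\<integral>x. (pair_norm x)\<^sup>2 \<partial>Q \<kappa>)"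
  have int2: "integrable (Q \<kappa>) (\<lambda>x. (pair_norm x)\<^sup>2)"
    by (rule integrable_Q[OF \<kappa>, where c=1]) (auto simp: pair_norm_le_exp)
  have int: "integrable (Q \<kappa>) (\<lambda>x. dir \<bullet> grad_term (c *\<^sub>R dir) x)" for c
    using integrable_grad_term[OF \<kappa>] by simp
  have B0: "0 \<le> B" by (simp add: B_def)
  have "\<bar>slope \<kappa> c - slope \<kappa> c'\<bar> \<le> B * \<bar>c - c'\<bar>" for c c'
  proof -
    have "\<bar>slope \<kappa> c - slope \<kappa> c'\<bar> = \<bar>\<integral>x. dir \<bullet> grad_term (c *\<^sub>R dir) x - dir \<bullet> grad_term (c' *\<^sub>R dir) x \<partial>Q \<kappa>\<bar>"
      using int by (simp add: slope_eq[OF \<kappa>])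
    also have "\<dots> \<le> (\<integral>x. \<bar>dir \<bullet> grad_term (c *\<^sub>R dir) x - dir \<bullet> grad_term (c' *\<^sub>R dir) x\<bar> \<partial>Q \<kappa>)"
      by (rule integral_abs_bound)
    also have "\<dots> \<le> (\<integral>x. ((norm dir)\<^sup>2 * \<bar>c - c'\<bar>) * (pair_norm x)\<^sup>2 \<partial>Q \<kappa>)"
    proof (rule integral_mono_AE)
      show "AE x in Q \<kappa>. \<bar>dir \<bullet> grad_term (c *\<^sub>R dir) x - dir \<bullet> grad_term (c' *\<^sub>R dir) x\<bar> \<le> ((norm dir)\<^sup>2 * \<bar>c - c'\<bar>) * (pair_norm x)\<^sup>2"
        using AE_regular[OF \<kappa>0]
      proof eventually_elim
        case (elim x)
        let ?b = "dir \<bullet> xt x"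
        have "dir \<bullet> grad_term (c *\<^sub>R dir) x - dir \<bullet> grad_term (c' *\<^sub>R dir) x = (sigmoid (c * ?b) - sigmoid (c' * ?b)) * ?b"
          by (simp add: grad_term_def algebra_simps)
        then have "\<bar>dir \<bullet> grad_term (c *\<^sub>R dir) x - dir \<bullet> grad_term (c' *\<^sub>R dir) x\<bar> \<le> \<bar>c * ?b - c' * ?b\<bar> * \<bar>?b\<bar>"
          unfolding abs_mult[symmetric] using sigmoid_lipschitz[of "c * ?b" "c' * ?b"]
          by (simp add: abs_mult mult_right_mono)
        also have "\<dots> = \<bar>c - c'\<bar> * \<bar>?b\<bar>\<^sup>2" by (simp add: left_diff_distrib[symmetric] abs_mult power2_eq_square)
        also have "\<dots> \<le> \<bar>c - c'\<bar> * (norm dir * pair_norm x)\<^sup>2"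
          using dir_xt_le[OF elim] by (intro mult_left_mono power_mono) auto
        finally show ?case by (simp add: power_mult_distrib mult_ac)
      qed
    qed (use int int2 in auto)
    also have "\<dots> = B * \<bar>c - c'\<bar>" by (simp add: B_def)
    finally show ?thesis .
  qed
  then have "B-lipschitz_on UNIV (slope \<kappa>)"
    using B0 by (intro lipschitz_onI) (auto simp: dist_real_def)
  then show ?thesis by (rule lipschitz_on_continuous_on)
qed

definition noise_norm :: "((real^'d) \<times> real) \<times> ((real^'d) \<times> real) \<times> real \<Rightarrow> real" where
  "noise_norm x = norm (fst (fst x) - (2 * snd (fst x) - 1) *\<^sub>R \<mu>) + norm (fst (fst (snd x)) - (2 * snd (fst (snd x)) - 1) *\<^sub>R \<mu>)"

lemma noise_norm_expectation:
  obtains K where "0 < K" "\<And>\<kappa>. 1 \<le> \<kappa> \<Longrightarrow> integrable (Q \<kappa>) noise_norm \<and> (\<integral>x. noise_norm x \<partial>Q \<kappa>) \<le> K / sqrt \<kappa>"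
proof -
  obtain K where K: "0 < K" "\<And>\<kappa>. 1 \<le> \<kappa> \<Longrightarrow> (\<integral>\<^sup>+z. ennreal (norm (fst z - (2 * snd z - 1) *\<^sub>R \<mu>)) \<partial>D \<kappa>) \<le> ennreal (K / sqrt \<kappa>)"
    using data_dist_noise[OF \<Sigma>_pd] by blast
  have "integrable (Q \<kappa>) noise_norm \<and> (\<integral>x. noise_norm x \<partial>Q \<kappa>) \<le> 2 * K / sqrt \<kappa>" if \<kappa>: "1 \<le> \<kappa>" for \<kappa>
  proof -
    have \<kappa>0: "0 < \<kappa>" using \<kappa> by simp
    interpret D: prob_space "D \<kappa>" by (rule prob_D[OF \<kappa>0])
    interpret DL: prob_space "D \<kappa> \<Otimes>\<^sub>M \<Lambda>" by (intro prob_space_pair prob_D[OF \<kappa>0] \<Lambda>_prob)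
    note [measurable_cong] = sets_D[OF \<kappa>0]
    define e where "e = (\<lambda>z::(real^'d) \<times> real. ennreal (norm (fst z - (2 * snd z - 1) *\<^sub>R \<mu>)))"
    have [measurable]: "e \<in> borel_measurable (borel \<Otimes>\<^sub>M borel)" unfolding e_def by measurable
    have [measurable]: "noise_norm \<in> borel_measurable (Q \<kappa>)" unfolding noise_norm_def by measurable
    have "(\<integral>\<^sup>+x. ennreal (noise_norm x) \<partial>Q \<kappa>) = (\<integral>\<^sup>+x. e (fst x) + e (fst (snd x)) \<partial>Q \<kappa>)"
      by (simp add: noise_norm_def e_def)
    also have "\<dots> = (\<integral>\<^sup>+x. e (fst x) \<partial>Q \<kappa>) + (\<integral>\<^sup>+x. e (fst (snd x)) \<partial>Q \<kappa>)"
      by (rule nn_integral_add) measurable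
    also have "(\<integral>\<^sup>+x. e (fst x) \<partial>Q \<kappa>) = integral\<^sup>N (D \<kappa>) e"
      by (subst nn_integral_pair_prob_space[OF DL.prob_space_axioms]) (auto simp: DL.emeasure_space_1)
    also have "(\<integral>\<^sup>+x. e (fst (snd x)) \<partial>Q \<kappa>) = (\<integral>\<^sup>+w. e (fst w) \<partial>(D \<kappa> \<Otimes>\<^sub>M \<Lambda>))"
      by (subst nn_integral_pair_prob_space[OF DL.prob_space_axioms]) (auto simp: D.emeasure_space_1)
    also have "\<dots> = integral\<^sup>N (D \<kappa>) e"
      by (subst nn_integral_pair_prob_space[OF \<Lambda>_prob]) (auto simp: L.emeasure_space_1[simplified])
    also have "integral\<^sup>N (D \<kappa>) e + integral\<^sup>N (D \<kappa>) e \<le> ennreal (K / sqrt \<kappa>) + ennreal (K / sqrt \<kappa>)"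
      using K(2)[OF \<kappa>] unfolding e_def by (intro add_mono)
    also have "\<dots> = ennreal (2 * K / sqrt \<kappa>)" using K(1) \<kappa> by (simp flip: ennreal_plus)
    finally have le: "(\<integral>\<^sup>+x. ennreal (noise_norm x) \<partial>Q \<kappa>) \<le> ennreal (2 * K / sqrt \<kappa>)" .
    have nn: "0 \<le> noise_norm x" for x by (simp add: noise_norm_def)
    have "integrable (Q \<kappa>) noise_norm" using le nn by (intro integrableI_nonneg) (auto intro: le_less_trans)
    moreover have "(\<integral>x. noise_norm x \<partial>Q \<kappa>) \<le> 2 * K / sqrt \<kappa>"
      using le nn K(1) \<kappa> by (subst integral_eq_nn_integral) (auto intro!: enn2real_leI)
    ultimately show ?thesis by simp
  qed
  then show ?thesis using K(1) by (intro that[of "2 * K"]) auto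
qed

lemma slope_noiseless:
  assumes x: "regular x" and c: "0 \<le> c"
  shows "\<bar>dir \<bullet> grad_term (c *\<^sub>R dir) x - noiseless_at c x\<bar> \<le> norm dir * (1 + c * M) * noise_norm x"
proof -
  obtain z z' l where xe: "x = (z, z', l)" by (cases x) auto
  have l: "l \<in> {0..1}" and y: "snd z \<in> {0, 1}" "snd z' \<in> {0, 1}" using x by (auto simp: xe regular_def)
  note g = g_bounds[OF l]
  define a where "a = g l * (2 * snd z - 1) + (1 - g l) * (2 * snd z' - 1)"
  let ?b = "dir \<bullet> xt x"
  have ob: "of_bool (snd z = 1) = snd z" "of_bool (snd z' = 1) = snd z'" using y by auto
  have cl: "noiseless_at c x = (sigmoid (c * (M * a)) - yt x) * (M * a)"
    by (simp add: noiseless_def Let_def xe ob a_def yt_def)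
  have a: "\<bar>a\<bar> \<le> 1"
    using y g by (auto simp: a_def)
  have bM: "?b - M * a = dir \<bullet> (g l *\<^sub>R (fst z - (2 * snd z - 1) *\<^sub>R \<mu>) + (1 - g l) *\<^sub>R (fst z' - (2 * snd z' - 1) *\<^sub>R \<mu>))"
    by (simp add: xe xt_def M_def a_def inner_add_right inner_diff_right algebra_simps)
  have "norm (g l *\<^sub>R (fst z - (2 * snd z - 1) *\<^sub>R \<mu>) + (1 - g l) *\<^sub>R (fst z' - (2 * snd z' - 1) *\<^sub>R \<mu>)) \<le>
      norm (g l *\<^sub>R (fst z - (2 * snd z - 1) *\<^sub>R \<mu>)) + norm ((1 - g l) *\<^sub>R (fst z' - (2 * snd z' - 1) *\<^sub>R \<mu>))"
    by (rule norm_triangle_ineq)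
  also have "\<dots> \<le> 1 * norm (fst z - (2 * snd z - 1) *\<^sub>R \<mu>) + 1 * norm (fst z' - (2 * snd z' - 1) *\<^sub>R \<mu>)"
    unfolding norm_scaleR using g by (intro add_mono mult_right_mono) auto
  also have "\<dots> = noise_norm x" by (simp add: noise_norm_def xe)
  finally have "norm dir * norm (g l *\<^sub>R (fst z - (2 * snd z - 1) *\<^sub>R \<mu>) + (1 - g l) *\<^sub>R (fst z' - (2 * snd z' - 1) *\<^sub>R \<mu>)) \<le> norm dir * noise_norm x"
    by (intro mult_left_mono) auto
  then have \<nu>: "\<bar>?b - M * a\<bar> \<le> norm dir * noise_norm x"
    unfolding bM using Cauchy_Schwarz_ineq2 order_trans by blast
  \<comment> \<open>The noise enters through \<open>?b - M * a\<close> only, once as a factor and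
    once inside the sigmoid; the second occurrence costs \<open>c\<close> by the Lipschitz bound and
    \<open>M\<close> by \<open>\<bar>a\<bar> \<le> 1\<close>.\<close>
  have "\<bar>dir \<bullet> grad_term (c *\<^sub>R dir) x - (sigmoid (c * (M * a)) - yt x) * (M * a)\<bar> =
      \<bar>(sigmoid (c * ?b) - yt x) * (?b - M * a) + (sigmoid (c * ?b) - sigmoid (c * (M * a))) * (M * a)\<bar>"
    by (simp add: grad_term_def algebra_simps)
  also have "\<dots> \<le> \<bar>sigmoid (c * ?b) - yt x\<bar> * \<bar>?b - M * a\<bar> + \<bar>sigmoid (c * ?b) - sigmoid (c * (M * a))\<bar> * \<bar>M * a\<bar>"
    unfolding abs_mult[symmetric] by (rule abs_triangle_ineq)
  also have "\<dots> \<le> 1 * \<bar>?b - M * a\<bar> + (c * \<bar>?b - M * a\<bar>) * M"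
  proof (intro add_mono mult_mono)
    show "\<bar>sigmoid (c * ?b) - yt x\<bar> \<le> 1" by (rule regular_bounds(4)[OF x])
    show "\<bar>sigmoid (c * ?b) - sigmoid (c * (M * a))\<bar> \<le> c * \<bar>?b - M * a\<bar>"
      using sigmoid_lipschitz[of "c * ?b" "c * (M * a)"] c by (simp add: right_diff_distrib[symmetric] abs_mult)
    show "\<bar>M * a\<bar> \<le> M" using a M_pos by (simp add: abs_mult)
  qed (use c in auto)
  also have "\<dots> = (1 + c * M) * \<bar>?b - M * a\<bar>" by (simp add: algebra_simps)
  also have "\<dots> \<le> (1 + c * M) * (norm dir * noise_norm x)" using c M_pos by (intro mult_left_mono \<nu>) auto
  finally show ?thesis unfolding cl by (simp add: mult_ac)
qed

text \<open>The factor \<open>1 + c * M\<close> stays bounded on the range of \<open>c\<close> that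
  matters, so that one threshold for \<kappa> makes the error small on all of it.\<close>

lemma slope_approx:
  obtains K where "0 < K" "\<And>\<kappa> c. 1 \<le> \<kappa> \<Longrightarrow> 0 \<le> c \<Longrightarrow>
    \<bar>slope \<kappa> c - (\<integral>x. noiseless_at c x \<partial>Q \<kappa>)\<bar> \<le> K * (1 + c * M) / sqrt \<kappa>"
proof -
  obtain K where K: "0 < K" "\<And>\<kappa>. 1 \<le> \<kappa> \<Longrightarrow> integrable (Q \<kappa>) noise_norm \<and> (\<integral>x. noise_norm x \<partial>Q \<kappa>) \<le> K / sqrt \<kappa>"
    using noise_norm_expectation by blast
  have "\<bar>slope \<kappa> c - (\<integral>x. noiseless_at c x \<partial>Q \<kappa>)\<bar> \<le> (norm dir * K) * (1 + c * M) / sqrt \<kappa>"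
    if \<kappa>: "1 \<le> \<kappa>" and c: "0 \<le> c" for \<kappa> c
  proof -
    have \<kappa>0: "0 < \<kappa>" using \<kappa> by simp
    let ?cl = "\<lambda>x::((real^'d) \<times> real) \<times> ((real^'d) \<times> real) \<times> real. noiseless_at c x"
    have int: "integrable (Q \<kappa>) (\<lambda>x. dir \<bullet> grad_term (c *\<^sub>R dir) x)" using integrable_grad_term[OF \<kappa>] by simp
    note intc = integral_noiseless(1)[OF \<kappa>0, of c]
    have "\<bar>slope \<kappa> c - (\<integral>x. ?cl x \<partial>Q \<kappa>)\<bar> = \<bar>\<integral>x. dir \<bullet> grad_term (c *\<^sub>R dir) x - ?cl x \<partial>Q \<kappa>\<bar>"
      using int intc by (simp add: slope_eq[OF \<kappa>])
    also have "\<dots> \<le> (\<integral>x. \<bar>dir \<bullet> grad_term (c *\<^sub>R dir) x - ?cl x\<bar> \<partial>Q \<kappa>)" by (rule integral_abs_bound)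
    also have "\<dots> \<le> (\<integral>x. norm dir * (1 + c * M) * noise_norm x \<partial>Q \<kappa>)"
    proof (rule integral_mono_AE)
      show "AE x in Q \<kappa>. \<bar>dir \<bullet> grad_term (c *\<^sub>R dir) x - ?cl x\<bar> \<le> norm dir * (1 + c * M) * noise_norm x"
        using AE_regular[OF \<kappa>0] by eventually_elim (rule slope_noiseless[OF _ c])
    qed (use int intc K(2)[OF \<kappa>] in auto)
    also have "\<dots> = norm dir * (1 + c * M) * (\<integral>x. noise_norm x \<partial>Q \<kappa>)" by simp
    also have "\<dots> \<le> norm dir * (1 + c * M) * (K / sqrt \<kappa>)"
      using K(2)[OF \<kappa>] c M_pos by (intro mult_left_mono) auto
    finally show ?thesis by (simp add: mult_ac)
  qed
  moreover have "0 < norm dir * K" using K(1) dir_nz by simp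
  ultimately show ?thesis using that by blast
qed

lemma population_critical_point:
  obtains \<kappa>0 c0 c1 where "1 < \<kappa>0" "0 < c0"
    "\<And>\<kappa>. \<kappa>0 \<le> \<kappa> \<Longrightarrow> \<exists>c. c0 \<le> c \<and> c \<le> c1 \<and> (\<integral>x. grad_term (c *\<^sub>R dir) x \<partial>Q \<kappa>) = 0"
proof -
  obtain K where K: "0 < K" "\<And>\<kappa> c. 1 \<le> \<kappa> \<Longrightarrow> 0 \<le> c \<Longrightarrow>
    \<bar>slope \<kappa> c - (\<integral>x. noiseless_at c x \<partial>Q \<kappa>)\<bar> \<le> K * (1 + c * M) / sqrt \<kappa>"
    using slope_approx by blast
  \<comment> \<open>At \<open>c0\<close> the noiseless slope is at most \<open>- M / 8\<close>, at
    \<open>c1\<close> at least \<open>M * P0 / 4\<close>. The smaller margin is \<open>e\<close>,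
    and \<open>\<kappa>0\<close> keeps the effect of the noise below it at both ends.\<close>
  define c0 where "c0 = 1 / (8 * M)"
  define c1 where "c1 = 4 / (M * P0)"
  define e where "e = min (M / 8) (M * P0 / 4)"
  have pos: "0 < c0" "0 < c1" "0 < e" using M_pos P0_pos by (auto simp: c0_def c1_def e_def)
  have "c0 \<le> c1"
  proof -
    have "1 / (8 * M) \<le> 4 / M" using M_pos by (simp add: field_simps)
    also have "\<dots> \<le> 4 / (M * P0)" using M_pos P0_pos P0_le by (intro divide_left_mono) (auto simp: mult_left_le)
    finally show ?thesis by (simp add: c0_def c1_def)
  qed
  define \<kappa>0 where "\<kappa>0 = 2 + (K * (1 + c1 * M) / e)\<^sup>2"
  have "\<exists>c. c0 \<le> c \<and> c \<le> c1 \<and> (\<integral>x. grad_term (c *\<^sub>R dir) x \<partial>Q \<kappa>) = 0" if \<kappa>: "\<kappa>0 \<le> \<kappa>" for \<kappa>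
  proof -
    have "0 \<le> (K * (1 + c1 * M) / e)\<^sup>2" by simp
    then have \<kappa>1: "1 \<le> \<kappa>" using \<kappa> unfolding \<kappa>0_def by linarith
    then have \<kappa>pos: "0 < \<kappa>" by simp
    have "(K * (1 + c1 * M) / e)\<^sup>2 \<le> \<kappa>" using \<kappa> by (simp add: \<kappa>0_def)
    then have "K * (1 + c1 * M) / e \<le> sqrt \<kappa>" by (rule real_le_rsqrt)
    then have err: "K * (1 + c1 * M) / sqrt \<kappa> \<le> e"
      using pos \<kappa>pos by (simp add: field_simps)
    have "K * (1 + c0 * M) / sqrt \<kappa> \<le> K * (1 + c1 * M) / sqrt \<kappa>"
      using \<open>c0 \<le> c1\<close> K(1) M_pos \<kappa>pos by (intro divide_right_mono mult_left_mono) auto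
    then have err0: "K * (1 + c0 * M) / sqrt \<kappa> \<le> e" using err by simp
    have "slope \<kappa> c0 \<le> M / 2 * (- (1/2) + 2 * (c0 * M)) + e"
      using K(2)[OF \<kappa>1, of c0] integral_noiseless(2)[OF \<kappa>pos, of c0] pos err0 by linarith
    also have "M / 2 * (- (1/2) + 2 * (c0 * M)) = - (M / 8)" using M_pos by (simp add: c0_def)
    finally have lo: "slope \<kappa> c0 \<le> 0" by (simp add: e_def)
    have "M / 2 * (P0 - 2 / (c1 * M)) - e \<le> slope \<kappa> c1"
      using K(2)[OF \<kappa>1, of c1] integral_noiseless(3)[OF \<kappa>pos, of c1] pos err by linarith
    moreover have "M / 2 * (P0 - 2 / (c1 * M)) = M * P0 / 4" using M_pos P0_pos by (simp add: c1_def field_simps)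
    moreover have "e \<le> M * P0 / 4" by (simp add: e_def)
    ultimately have hi: "0 \<le> slope \<kappa> c1" by linarith
    obtain c where c: "c0 \<le> c" "c \<le> c1" "slope \<kappa> c = 0"
      using IVT'[OF lo hi \<open>c0 \<le> c1\<close>] continuous_on_subset[OF continuous_slope[OF \<kappa>1]] by auto
    have "M *\<^sub>R (\<integral>x. grad_term (c *\<^sub>R dir) x \<partial>Q \<kappa>) = 0"
      using gradient_reflection[OF \<kappa>1, of c] c(3) by (simp add: slope_def)
    then show ?thesis using c M_pos by auto
  qed
  moreover have "0 \<le> (K * (1 + c1 * M) / e)\<^sup>2" by simp
  then have "1 < \<kappa>0" unfolding \<kappa>0_def by linarith
  ultimately show ?thesis using that pos by blast
qed

section \<open>Truncated second moments\<close>

definition trunc :: "real \<Rightarrow> ((real^'d) \<times> real) \<times> ((real^'d) \<times> real) \<times> real \<Rightarrow> real" where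
  "trunc B x = of_bool (norm (fst (fst x)) \<le> B \<and> norm (fst (fst (snd x))) \<le> B)"

lemma measurable_trunc [measurable]:
  "trunc B \<in> borel_measurable sample_alg"
  unfolding trunc_def by measurable

lemma trunc_xt_le:
  assumes "0 \<le> B" "snd (snd x) \<in> {0..1}" "trunc B x \<noteq> 0"
  shows "norm (xt x) \<le> B"
proof -
  have b: "norm (fst (fst x)) \<le> B" "norm (fst (fst (snd x))) \<le> B" using assms(3) by (auto simp: trunc_def)
  let ?g = "g (snd (snd x))"
  have "norm (xt x) \<le> norm (?g *\<^sub>R fst (fst x)) + norm ((1 - ?g) *\<^sub>R fst (fst (snd x)))"
    unfolding xt_def by (rule norm_triangle_ineq)
  also have "\<dots> \<le> ?g * B + (1 - ?g) * B"
    unfolding norm_scaleR using g_bounds[OF assms(2)] b by (intro add_mono mult_mono) auto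
  finally show ?thesis by (simp add: algebra_simps)
qed

text \<open>If both points have label 1 and noise along \<open>v\<close>, then so does every convex
  combination, whatever the mixing coefficient; by independence this has probability at least
  \<open>q^2\<close>. The truncation is imposed on the two points and not on the mixed one, so that
  the event is a product set.\<close>

lemma second_moment_lower:
  obtains B q where "0 < B" "0 < q"
    "\<And>\<kappa> v. 1 \<le> \<kappa> \<Longrightarrow> q / \<kappa> * (norm v)\<^sup>2 \<le> (\<integral>x. trunc B x * (v \<bullet> xt x)\<^sup>2 \<partial>Q \<kappa>)"
proof -
  obtain B r q where Brq: "0 < B" "0 < r" "0 < q"
    and spread: "\<And>\<kappa> v. 1 \<le> \<kappa> \<Longrightarrow> q \<le> measure (D \<kappa>)
       {z. snd z = 1 \<and> norm (fst z) \<le> B \<and> r * norm v / sqrt \<kappa> \<le> v \<bullet> (fst z - \<mu>)}"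
    using data_dist_spread[OF \<Sigma>_pd] by blast
  have main: "(r\<^sup>2 * q\<^sup>2) / \<kappa> * (norm v)\<^sup>2 \<le> (\<integral>x. trunc B x * (v \<bullet> xt x)\<^sup>2 \<partial>Q \<kappa>)"
    if \<kappa>: "1 \<le> \<kappa>" and v: "0 \<le> v \<bullet> \<mu>" for \<kappa> v
  proof -
    have \<kappa>0: "0 < \<kappa>" using \<kappa> by simp
    interpret D: prob_space "D \<kappa>" by (rule prob_D[OF \<kappa>0])
    interpret DL: prob_space "D \<kappa> \<Otimes>\<^sub>M \<Lambda>" by (intro prob_space_pair prob_D[OF \<kappa>0] \<Lambda>_prob)
    interpret QQ: prob_space "Q \<kappa>" by (rule prob_Q[OF \<kappa>0])
    define A where "A = {z. snd z = (1::real) \<and> norm (fst z) \<le> B \<and> r * norm v / sqrt \<kappa> \<le> v \<bullet> (fst z - \<mu>)}"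
    have "{z \<in> space (borel \<Otimes>\<^sub>M borel). snd z = (1::real) \<and> norm (fst z) \<le> B \<and> r * norm v / sqrt \<kappa> \<le> v \<bullet> (fst z - \<mu>)}
        \<in> sets (borel \<Otimes>\<^sub>M borel)"
      by measurable
    then have A: "A \<in> sets (D \<kappa>)" unfolding sets_D[OF \<kappa>0] by (simp add: space_pair_measure A_def)
    define Z where "Z = A \<times> A \<times> space \<Lambda>"
    have Z: "Z \<in> sets (Q \<kappa>)" unfolding Z_def by (intro pair_measureI A sets.top)
    have "emeasure (Q \<kappa>) Z = emeasure (D \<kappa>) A * (emeasure (D \<kappa>) A * emeasure \<Lambda> (space \<Lambda>))"
      unfolding Z_def using A by (simp add: DL.emeasure_pair_measure_Times L.emeasure_pair_measure_Times del: space_\<Lambda>)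
    then have "measure (Q \<kappa>) Z = measure (D \<kappa>) A * measure (D \<kappa>) A"
      by (simp add: L.emeasure_space_1[simplified] QQ.emeasure_eq_measure D.emeasure_eq_measure ennreal_mult[symmetric])
    moreover have "q \<le> measure (D \<kappa>) A" unfolding A_def by (rule spread[OF \<kappa>])
    ultimately have mZ: "q\<^sup>2 \<le> measure (Q \<kappa>) Z"
      using Brq by (simp add: power2_eq_square mult_mono)
    have low: "r\<^sup>2 / \<kappa> * (norm v)\<^sup>2 * indicator Z x \<le> trunc B x * (v \<bullet> xt x)\<^sup>2" for x
    proof (cases "x \<in> Z")
      case True
      then obtain z z' l where x: "x = (z, z', l)" "z \<in> A" "z' \<in> A" "l \<in> {0..1}" by (auto simp: Z_def)
      have t: "trunc B x = 1" using x by (simp add: trunc_def A_def)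
      have "r * norm v / sqrt \<kappa> \<le> v \<bullet> fst z" "r * norm v / sqrt \<kappa> \<le> v \<bullet> fst z'"
        using x v by (auto simp: A_def inner_diff_right)
      then have "g l * (r * norm v / sqrt \<kappa>) + (1 - g l) * (r * norm v / sqrt \<kappa>) \<le> g l * (v \<bullet> fst z) + (1 - g l) * (v \<bullet> fst z')"
        using g_bounds[OF x(4)] by (intro add_mono mult_left_mono) auto
      also have "\<dots> = v \<bullet> xt x" by (simp add: x xt_def inner_add_right)
      finally have "r * norm v / sqrt \<kappa> \<le> v \<bullet> xt x" by (simp only: distrib_right[symmetric]) simp
      then have "(r * norm v / sqrt \<kappa>)\<^sup>2 \<le> (v \<bullet> xt x)\<^sup>2" using Brq \<kappa>0 by (intro power_mono) auto
      then show ?thesis using t True \<kappa>0 by (simp add: power_mult_distrib power_divide)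
    qed (simp add: trunc_def)
    have intT: "integrable (Q \<kappa>) (\<lambda>x. trunc B x * (v \<bullet> xt x)\<^sup>2)"
    proof (rule integrable_Q[OF \<kappa>, where c="(norm v)\<^sup>2"])
      fix x assume x: "regular x"
      have "\<bar>v \<bullet> xt x\<bar> \<le> norm v * pair_norm x"
        using Cauchy_Schwarz_ineq2[of v "xt x"] regular_bounds(3)[OF x] mult_left_mono[of "norm (xt x)" "pair_norm x" "norm v"] by simp
      then have "\<bar>v \<bullet> xt x\<bar>\<^sup>2 \<le> (norm v * pair_norm x)\<^sup>2" by (intro power_mono) auto
      also have "\<dots> \<le> (norm v)\<^sup>2 * exp (2 * pair_norm x)"
        unfolding power_mult_distrib by (intro mult_left_mono pair_norm_le_exp) auto
      finally have "(v \<bullet> xt x)\<^sup>2 \<le> (norm v)\<^sup>2 * exp (2 * pair_norm x)" by simp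
      then show "norm (trunc B x * (v \<bullet> xt x)\<^sup>2) \<le> (norm v)\<^sup>2 * exp (2 * pair_norm x)"
        by (simp add: trunc_def)
    qed measurable
    have "(r\<^sup>2 * q\<^sup>2) / \<kappa> * (norm v)\<^sup>2 \<le> r\<^sup>2 / \<kappa> * (norm v)\<^sup>2 * measure (Q \<kappa>) Z"
      using mult_left_mono[OF mZ, of "r\<^sup>2 / \<kappa> * (norm v)\<^sup>2"] \<kappa>0 by (simp add: mult_ac)
    also have "\<dots> = (\<integral>x. r\<^sup>2 / \<kappa> * (norm v)\<^sup>2 * indicator Z x \<partial>Q \<kappa>)" using Z by simp
    also have "\<dots> \<le> (\<integral>x. trunc B x * (v \<bullet> xt x)\<^sup>2 \<partial>Q \<kappa>)"
      using Z intT by (intro integral_mono low) (auto simp: QQ.emeasure_eq_measure)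
    finally show ?thesis .
  qed
  have "(r\<^sup>2 * q\<^sup>2) / \<kappa> * (norm v)\<^sup>2 \<le> (\<integral>x. trunc B x * (v \<bullet> xt x)\<^sup>2 \<partial>Q \<kappa>)" if \<kappa>: "1 \<le> \<kappa>" for \<kappa> v
    \<comment> \<open>The square does not see the sign of \<open>v\<close>, so the centre \<mu> may
      be taken to push the same way as the noise instead of cancelling it.\<close>
    using main[OF \<kappa>, of v] main[OF \<kappa>, of "- v"] by (cases "0 \<le> v \<bullet> \<mu>") auto
  then show ?thesis using Brq by (intro that[of B "r\<^sup>2 * q\<^sup>2"]) auto
qed

end

section \<open>From concentration to the empirical minimizer\<close>

lemma mixup_loss_eq_lin_logistic:
  "mixup_loss g n S lam = (\<lambda>w. 1 / (real n)\<^sup>2 * lin_logistic ({..<n} \<times> {..<n})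
     (\<lambda>p. mix_x g S lam (fst p) (snd p)) (\<lambda>p. 1 - mix_y S lam (fst p) (snd p)) w)"
proof
  fix w
  have "mix_y S lam i j * logistic_loss (w \<bullet> mix_x g S lam i j)
      + (1 - mix_y S lam i j) * logistic_loss (- (w \<bullet> mix_x g S lam i j)) =
    logistic_loss (w \<bullet> mix_x g S lam i j) + (1 - mix_y S lam i j) * (w \<bullet> mix_x g S lam i j)" for i j
    by (simp add: logistic_loss_minus algebra_simps)
  then show "mixup_loss g n S lam w = 1 / (real n)\<^sup>2 * lin_logistic ({..<n} \<times> {..<n})
     (\<lambda>p. mix_x g S lam (fst p) (snd p)) (\<lambda>p. 1 - mix_y S lam (fst p) (snd p)) w"
    by (simp add: mixup_loss_def lin_logistic_def sum.cartesian_product case_prod_unfold)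
qed

lemma convex_mixup_loss: "convex_on UNIV (mixup_loss g n S lam)"
  unfolding mixup_loss_eq_lin_logistic by (intro convex_on_cmul convex_lin_logistic) simp

lemma continuous_mixup_loss: "continuous_on UNIV (mixup_loss g n S lam)"
  unfolding mixup_loss_eq_lin_logistic by (intro continuous_intros continuous_lin_logistic)

lemma is_arg_min_scale:
  fixes f :: "'a \<Rightarrow> real"
  assumes "0 < a"
  shows "is_arg_min (\<lambda>x. a * f x) P v \<longleftrightarrow> is_arg_min f P v"
  using assms by (simp add: is_arg_min_def)

lemma norm_sum_le_components:
  fixes y :: "real^'d" and a :: real
  assumes "\<And>k. \<bar>y $ k\<bar> \<le> a"
  shows "norm y \<le> real CARD('d) * a"
proof -
  have "norm y \<le> (\<Sum>k\<in>UNIV. \<bar>y $ k\<bar>)" by (rule norm_le_l1_cart)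
  also have "\<dots> \<le> (\<Sum>k\<in>(UNIV::'d set). a)" by (intro sum_mono assms)
  finally show ?thesis by simp
qed

context mixup_setting
begin

text \<open>The norm of the gradient term at a pair \<open>(i, i)\<close>, where mixing returns the
  point itself with its own label.\<close>

definition label_err :: "real^'d \<Rightarrow> (real^'d) \<times> real \<Rightarrow> real" where
  "label_err w z = \<bar>sigmoid (w \<bullet> fst z) - snd z\<bar> * norm (fst z)"

text \<open>Summands of the entries of the truncated second moment matrix. Concentration of these
  finitely many scalars controls the quadratic form in all directions at once, without a net on the
  sphere.\<close>

definition cov :: "real \<Rightarrow> 'd \<Rightarrow> 'd \<Rightarrow> ((real^'d) \<times> real) \<times> ((real^'d) \<times> real) \<times> real \<Rightarrow> real" where
  "cov B k l x = trunc B x * (xt x $ k * xt x $ l)"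

lemma measurable_vec_nth [measurable]: "(\<lambda>x::real^'d. x $ k) \<in> borel_measurable borel"
  by (intro borel_measurable_continuous_onI continuous_intros)

lemma measurable_cov [measurable]:
  "cov B k l \<in> borel_measurable sample_alg"
  unfolding cov_def by measurable

lemma quadratic_cov: "(\<Sum>k\<in>UNIV. \<Sum>l\<in>UNIV. v $ k * v $ l * cov B k l x) = trunc B x * (v \<bullet> xt x)\<^sup>2"
  by (simp add: cov_def inner_vec_def power2_eq_square sum_product sum_distrib_left mult_ac)

lemma cov_bound:
  assumes "0 \<le> B" "snd (snd x) \<in> {0..1}"
  shows "\<bar>cov B k l x\<bar> \<le> B\<^sup>2"
proof (cases "trunc B x = 0")
  case False
  have n: "norm (xt x) \<le> B" by (rule trunc_xt_le[OF assms False])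
  have "\<bar>xt x $ k\<bar> \<le> B" "\<bar>xt x $ l\<bar> \<le> B"
    using component_le_norm_cart[of "xt x" k] component_le_norm_cart[of "xt x" l] n by auto
  then have "\<bar>xt x $ k\<bar> * \<bar>xt x $ l\<bar> \<le> B * B" using assms(1) by (intro mult_mono) auto
  then show ?thesis by (auto simp: cov_def trunc_def abs_mult power2_eq_square)
qed (simp add: cov_def)

lemma integrable_cov:
  assumes \<kappa>: "1 \<le> \<kappa>" and B: "0 \<le> B"
  shows "integrable (Q \<kappa>) (cov B k l)"
proof (rule integrable_Q[OF \<kappa>, where c="B\<^sup>2"])
  fix x assume "regular x"
  then have "\<bar>cov B k l x\<bar> \<le> B\<^sup>2" using B by (intro cov_bound) (auto simp: regular_def)
  also have "\<dots> \<le> B\<^sup>2 * exp (2 * pair_norm x)" using pair_norm_nonneg[of x] by (simp add: mult_le_cancel_left1)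
  finally show "norm (cov B k l x) \<le> B\<^sup>2 * exp (2 * pair_norm x)" by simp
qed measurable

text \<open>The deterministic half of the argument, for one fixed sample. On the sphere of radius
  \<rho> the curvature gains \<rho> times \<open>\<tau> * \<rho> / \<kappa> * n^2\<close>; the
  off-diagonal and the diagonal part of the gradient may each spend a quarter of that, so the loss
  exceeds its value at the centre.\<close>

lemma good_event:
  fixes S :: "nat \<Rightarrow> (real^'d) \<times> real" and lam :: "nat \<times> nat \<Rightarrow> real" and n :: nat and \<kappa> B q c0 c1 c \<epsilon> \<rho> :: real
  defines "e \<equiv> (\<lambda>p. (S (fst p), S (snd p), lam p))"
    and "off \<equiv> {(i, j). i < n \<and> j < n \<and> i \<noteq> j}"
    and "\<tau> \<equiv> exp (- ((c1 * norm dir + 1) * B)) / 8 * (q / 4)"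
  assumes n: "2 \<le> n" and \<kappa>: "1 \<le> \<kappa>" and c: "0 < c0" "c0 \<le> c" "c \<le> c1" and B: "0 < B" and q: "0 < q"
    and moment: "\<And>v. q / \<kappa> * (norm v)\<^sup>2 \<le> (\<integral>x. trunc B x * (v \<bullet> xt x)\<^sup>2 \<partial>Q \<kappa>)"
    and lam: "\<And>i j. i < n \<Longrightarrow> j < n \<Longrightarrow> lam (i, j) \<in> {0..1}"
    and \<epsilon>: "0 < \<epsilon>" "\<epsilon> < 1" and \<rho>: "0 < \<rho>" "\<rho> \<le> 1" "\<rho> \<le> \<epsilon> / 2 * (c0 * norm dir)"
    and grad: "\<And>k. \<bar>\<Sum>p\<in>off. grad_term (c *\<^sub>R dir) (e p) $ k\<bar> \<le> \<tau> * \<rho> / (4 * real CARD('d) * \<kappa>) * (real n)\<^sup>2"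
    and hess: "\<And>k l. \<bar>\<Sum>p\<in>off. cov B k l (e p) - (\<integral>x. cov B k l x \<partial>Q \<kappa>)\<bar> \<le> q / (4 * (real CARD('d))\<^sup>2 * \<kappa>) * (real n)\<^sup>2"
    and diag: "(\<Sum>i<n. label_err (c *\<^sub>R dir) (S i)) \<le> \<tau> * \<rho> / (4 * \<kappa>) * (real n)\<^sup>2"
  shows "\<exists>w. (\<forall>v. is_arg_min (mixup_loss g n S lam) (\<lambda>_. True) v \<longleftrightarrow> v = w) \<and> w \<noteq> 0 \<and> sim w dir \<ge> 1 - \<epsilon>"
proof -
  define I where "I = {..<n} \<times> {..<n}"
  define X where "X = (\<lambda>p. mix_x g S lam (fst p) (snd p))"
  define b where "b = (\<lambda>p. 1 - mix_y S lam (fst p) (snd p))"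
  define f where "f = lin_logistic I X b"
  define w0 where "w0 = c *\<^sub>R dir"
  have X: "X p = xt (e p)" for p by (simp add: X_def mix_x_def xt_def e_def)
  have b: "b p = 1 - yt (e p)" for p by (simp add: b_def mix_y_def yt_def e_def)
  have nn: "0 < real n" using n by simp
  have \<tau>: "0 < \<tau>" using q by (simp add: \<tau>_def)
  have finI: "finite I" by (simp add: I_def)
  have off_I: "off \<subseteq> I" by (auto simp: off_def I_def)
  have finoff: "finite off" using finI off_I by (rule finite_subset[rotated])
  have lamI: "snd (snd (e p)) \<in> {0..1}" if "p \<in> I" for p
    using that lam by (auto simp: e_def I_def)
  define G where "G = (\<Sum>p\<in>I. (sigmoid (w0 \<bullet> X p) - 1 + b p) *\<^sub>R X p)"
  have G_gr: "G = (\<Sum>p\<in>I. grad_term w0 (e p))" by (simp add: G_def X b grad_term_def)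
  \<comment> \<open>The diagonal is split off because the critical point equation concerns pairs of
    independent points only.\<close>
  have I_split: "I = off \<union> (\<lambda>i. (i, i)) ` {..<n}" "off \<inter> (\<lambda>i. (i, i)) ` {..<n} = {}"
    by (auto simp: I_def off_def)
  have "G = (\<Sum>p\<in>off. grad_term w0 (e p)) + (\<Sum>p\<in>(\<lambda>i. (i, i)) ` {..<n}. grad_term w0 (e p))"
    unfolding G_gr I_split(1) using finoff I_split(2) by (intro sum.union_disjoint) auto
  also have "(\<Sum>p\<in>(\<lambda>i. (i, i)) ` {..<n}. grad_term w0 (e p)) = (\<Sum>i<n. grad_term w0 (e (i, i)))"
    by (subst sum.reindex) (auto simp: inj_on_def)
  finally have G_split: "G = (\<Sum>p\<in>off. grad_term w0 (e p)) + (\<Sum>i<n. grad_term w0 (e (i, i)))" .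
  have "norm (\<Sum>p\<in>off. grad_term w0 (e p)) \<le> CARD('d) * (\<tau> * \<rho> / (4 * real CARD('d) * \<kappa>) * (real n)\<^sup>2)"
    by (rule norm_sum_le_components) (use grad in \<open>simp add: w0_def\<close>)
  also have "\<dots> = \<tau> * \<rho> / (4 * \<kappa>) * (real n)\<^sup>2" by simp
  finally have G_off: "norm (\<Sum>p\<in>off. grad_term w0 (e p)) \<le> \<tau> * \<rho> / (4 * \<kappa>) * (real n)\<^sup>2" .
  have gr_diag: "norm (grad_term w0 (e (i, i))) = label_err w0 (S i)" for i
  proof -
    have "xt (e (i, i)) = fst (S i)" by (simp add: xt_def e_def flip: scaleR_add_left)
    moreover have "yt (e (i, i)) = snd (S i)" by (simp add: yt_def e_def algebra_simps)
    ultimately show ?thesis by (simp add: grad_term_def label_err_def)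
  qed
  have "norm (\<Sum>i<n. grad_term w0 (e (i, i))) \<le> (\<Sum>i<n. label_err w0 (S i))"
    unfolding gr_diag[symmetric] by (rule norm_sum)
  then have G_diag: "norm (\<Sum>i<n. grad_term w0 (e (i, i))) \<le> \<tau> * \<rho> / (4 * \<kappa>) * (real n)\<^sup>2"
    using diag by (simp add: w0_def)
  have normG: "norm G \<le> \<tau> * \<rho> / (2 * \<kappa>) * (real n)\<^sup>2"
    using norm_triangle_ineq[of "\<Sum>p\<in>off. grad_term w0 (e p)" "\<Sum>i<n. grad_term w0 (e (i, i))"] G_off G_diag
    unfolding G_split by simp
  \<comment> \<open>Pairs outside \<open>J\<close> may be left out of the curvature, since their
    loss terms lie above their tangents.\<close>
  define J where "J = {p\<in>off. trunc B (e p) \<noteq> 0}"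
  have J: "J \<subseteq> I" using off_I by (auto simp: J_def)
  have XJ: "norm (X p) \<le> B" if "p \<in> J" for p
    unfolding X using that off_I B by (intro trunc_xt_le lamI) (auto simp: J_def)
  \<comment> \<open>With \<open>n \<ge> 2\<close> at least half of all pairs are off-diagonal, so
    the mean contributes \<open>q / (2 * \<kappa>)\<close> times \<open>n^2\<close>; the deviations
    of all entries together take away at most \<open>q / (4 * \<kappa>)\<close> of it.\<close>
  have quad: "(real n)\<^sup>2 * (q / (4 * \<kappa>)) * (norm v)\<^sup>2 \<le> (\<Sum>p\<in>J. (v \<bullet> X p)\<^sup>2)" for v
  proof -
    define m where "m = (\<lambda>k l. \<integral>x. cov B k l x \<partial>Q \<kappa>)"
    have "(\<integral>x. trunc B x * (v \<bullet> xt x)\<^sup>2 \<partial>Q \<kappa>) = (\<Sum>k\<in>UNIV. \<Sum>l\<in>UNIV. v $ k * v $ l * m k l)"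
      unfolding quadratic_cov[symmetric] m_def using integrable_cov[OF \<kappa> less_imp_le[OF B]] by simp
    then have mq: "q / \<kappa> * (norm v)\<^sup>2 \<le> (\<Sum>k\<in>UNIV. \<Sum>l\<in>UNIV. v $ k * v $ l * m k l)"
      using moment[of v] by simp
    define \<eta> where "\<eta> = q / (4 * (real CARD('d))\<^sup>2 * \<kappa>)"
    have "(\<Sum>p\<in>J. (v \<bullet> X p)\<^sup>2) = (\<Sum>p\<in>J. trunc B (e p) * (v \<bullet> xt (e p))\<^sup>2)"
      by (intro sum.cong) (auto simp: J_def trunc_def X)
    also have "\<dots> = (\<Sum>p\<in>off. trunc B (e p) * (v \<bullet> xt (e p))\<^sup>2)"
      using finoff by (intro sum.mono_neutral_left) (auto simp: J_def)
    also have "\<dots> = (\<Sum>p\<in>off. \<Sum>k\<in>UNIV. \<Sum>l\<in>UNIV. v $ k * v $ l * cov B k l (e p))"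
      by (simp add: quadratic_cov)
    also have "\<dots> = (\<Sum>k\<in>UNIV. \<Sum>p\<in>off. \<Sum>l\<in>UNIV. v $ k * v $ l * cov B k l (e p))"
      by (rule sum.swap)
    also have "\<dots> = (\<Sum>k\<in>UNIV. \<Sum>l\<in>UNIV. \<Sum>p\<in>off. v $ k * v $ l * cov B k l (e p))"
      by (intro sum.cong refl sum.swap)
    also have "\<dots> = (\<Sum>k\<in>UNIV. \<Sum>l\<in>UNIV. card off * (v $ k * v $ l * m k l) + v $ k * v $ l * (\<Sum>p\<in>off. cov B k l (e p) - m k l))"
      by (intro sum.cong refl) (simp add: sum_subtractf sum_distrib_left[symmetric] algebra_simps)
    also have "\<dots> = card off * (\<Sum>k\<in>UNIV. \<Sum>l\<in>UNIV. v $ k * v $ l * m k l) +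
        (\<Sum>k\<in>UNIV. \<Sum>l\<in>UNIV. v $ k * v $ l * (\<Sum>p\<in>off. cov B k l (e p) - m k l))"
      by (simp add: sum.distrib sum_distrib_left)
    finally have eq: "(\<Sum>p\<in>J. (v \<bullet> X p)\<^sup>2) = card off * (\<Sum>k\<in>UNIV. \<Sum>l\<in>UNIV. v $ k * v $ l * m k l) +
        (\<Sum>k\<in>UNIV. \<Sum>l\<in>UNIV. v $ k * v $ l * (\<Sum>p\<in>off. cov B k l (e p) - m k l))" .
    have "\<bar>\<Sum>k\<in>UNIV. \<Sum>l\<in>UNIV. v $ k * v $ l * (\<Sum>p\<in>off. cov B k l (e p) - m k l)\<bar> \<le>
        (\<Sum>k\<in>(UNIV::'d set). \<Sum>l\<in>(UNIV::'d set). (norm v)\<^sup>2 * (\<eta> * (real n)\<^sup>2))"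
    proof (intro order_trans[OF sum_abs] sum_mono)
      fix k l
      have "\<bar>v $ k\<bar> * \<bar>v $ l\<bar> \<le> norm v * norm v"
        by (intro mult_mono component_le_norm_cart) auto
      then have "(\<bar>v $ k\<bar> * \<bar>v $ l\<bar>) * \<bar>\<Sum>p\<in>off. cov B k l (e p) - m k l\<bar> \<le> (norm v * norm v) * (\<eta> * (real n)\<^sup>2)"
        using hess[of k l] by (intro mult_mono) (auto simp: m_def \<eta>_def component_le_norm_cart)
      then show "\<bar>v $ k * v $ l * (\<Sum>p\<in>off. cov B k l (e p) - m k l)\<bar> \<le> (norm v)\<^sup>2 * (\<eta> * (real n)\<^sup>2)"
        by (simp add: abs_mult power2_eq_square)
    qed
    also have "\<dots> = (real n)\<^sup>2 * (q / (4 * \<kappa>)) * (norm v)\<^sup>2"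
      using \<kappa> by (simp add: \<eta>_def power2_eq_square field_simps)
    finally have err: "- ((real n)\<^sup>2 * (q / (4 * \<kappa>)) * (norm v)\<^sup>2) \<le> (\<Sum>k\<in>UNIV. \<Sum>l\<in>UNIV. v $ k * v $ l * (\<Sum>p\<in>off. cov B k l (e p) - m k l))"
      by linarith
    have coff: "(real n)\<^sup>2 / 2 \<le> card off"
    proof -
      have "off = I - (\<lambda>i. (i, i)) ` {..<n}" by (auto simp: I_def off_def)
      moreover have "card ((\<lambda>i. (i, i)) ` {..<n}) = n" by (subst card_image) (auto simp: inj_on_def)
      ultimately have "card off = n * n - n"
        by (simp add: I_def card_Diff_subset image_subset_iff)
      then have "real (card off) = real n * real n - real n" using n by (simp add: of_nat_diff)
      moreover have "2 * real n \<le> real n * real n" using n by (intro mult_right_mono) auto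
      ultimately show ?thesis by (simp add: power2_eq_square)
    qed
    have "(real n)\<^sup>2 / 2 * (q / \<kappa> * (norm v)\<^sup>2) \<le> card off * (\<Sum>k\<in>UNIV. \<Sum>l\<in>UNIV. v $ k * v $ l * m k l)"
      using coff mq q \<kappa> by (intro mult_mono) auto
    then have "(real n)\<^sup>2 / 2 * (q / \<kappa> * (norm v)\<^sup>2) - (real n)\<^sup>2 * (q / (4 * \<kappa>)) * (norm v)\<^sup>2 \<le> (\<Sum>p\<in>J. (v \<bullet> X p)\<^sup>2)"
      unfolding eq using err by linarith
    moreover have "(real n)\<^sup>2 / 2 * (q / \<kappa> * (norm v)\<^sup>2) - (real n)\<^sup>2 * (q / (4 * \<kappa>)) * (norm v)\<^sup>2 = (real n)\<^sup>2 * (q / (4 * \<kappa>)) * (norm v)\<^sup>2"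
      using \<kappa> by (simp add: field_simps)
    ultimately show ?thesis by (simp only:)
  qed
  \<comment> \<open>The curvature bound also gives strict convexity: a vector orthogonal to all
    \<open>X p\<close> with \<open>p \<in> J\<close> must be zero.\<close>
  have strict: "2 * f ((1 / 2) *\<^sub>R (x + y)) < f x + f y" if "x \<noteq> y" for x y
  proof -
    have "0 < (real n)\<^sup>2 * (q / (4 * \<kappa>)) * (norm (x - y))\<^sup>2" using nn q \<kappa> that by simp
    also have "\<dots> \<le> (\<Sum>p\<in>J. ((x - y) \<bullet> X p)\<^sup>2)" by (rule quad)
    finally have "(\<Sum>p\<in>J. ((x - y) \<bullet> X p)\<^sup>2) \<noteq> 0" by simp
    then obtain p where "p \<in> J" "((x - y) \<bullet> X p)\<^sup>2 \<noteq> 0"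
      using sum.neutral[of J "\<lambda>p. ((x - y) \<bullet> X p)\<^sup>2"] by blast
    then have "p \<in> I" "x \<bullet> X p \<noteq> y \<bullet> X p" using J by (auto simp: inner_diff_left)
    then show ?thesis unfolding f_def by (intro lin_logistic_midpoint finI)
  qed
  have w0: "norm w0 \<le> c1 * norm dir" using c by (simp add: w0_def mult_right_mono)
  have sphere: "f w0 < f (w0 + v)" if v: "norm v = \<rho>" for v
  proof -
    have "f w0 + v \<bullet> G + exp (- ((c1 * norm dir + 1) * B)) / 8 * (\<Sum>p\<in>J. (v \<bullet> X p)\<^sup>2) \<le> f (w0 + v)"
      unfolding f_def G_def using v \<rho>(2) by (intro lin_logistic_lower finI J XJ w0) auto
    moreover have "- (\<rho> * (\<tau> * \<rho> / (2 * \<kappa>) * (real n)\<^sup>2)) \<le> v \<bullet> G"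
    proof -
      have "\<bar>v \<bullet> G\<bar> \<le> norm v * norm G" by (rule Cauchy_Schwarz_ineq2)
      also have "\<dots> \<le> \<rho> * (\<tau> * \<rho> / (2 * \<kappa>) * (real n)\<^sup>2)" unfolding v using \<rho>(1) normG by (intro mult_left_mono) auto
      finally show ?thesis by linarith
    qed
    moreover have "exp (- ((c1 * norm dir + 1) * B)) / 8 * ((real n)\<^sup>2 * (q / (4 * \<kappa>)) * (norm v)\<^sup>2) \<le>
        exp (- ((c1 * norm dir + 1) * B)) / 8 * (\<Sum>p\<in>J. (v \<bullet> X p)\<^sup>2)"
      by (intro mult_left_mono quad) auto
    moreover have "exp (- ((c1 * norm dir + 1) * B)) / 8 * ((real n)\<^sup>2 * (q / (4 * \<kappa>)) * (norm v)\<^sup>2) = \<tau> * \<rho>\<^sup>2 / \<kappa> * (real n)\<^sup>2"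
      by (simp add: \<tau>_def v)
    moreover have "\<rho> * (\<tau> * \<rho> / (2 * \<kappa>) * (real n)\<^sup>2) < \<tau> * \<rho>\<^sup>2 / \<kappa> * (real n)\<^sup>2"
      using \<tau> \<rho>(1) nn \<kappa> by (simp add: power2_eq_square field_simps)
    ultimately show ?thesis by linarith
  qed
  obtain w where w: "norm (w - w0) \<le> \<rho>" "\<And>v. is_arg_min f (\<lambda>_. True) v \<longleftrightarrow> v = w"
    using unique_arg_min_near[OF convex_lin_logistic continuous_lin_logistic strict[unfolded f_def] \<rho>(1) sphere[unfolded f_def]]
    unfolding f_def by blast
  have "mixup_loss g n S lam = (\<lambda>w. 1 / (real n)\<^sup>2 * f w)"
    unfolding mixup_loss_eq_lin_logistic f_def I_def X_def b_def ..
  then have "is_arg_min (mixup_loss g n S lam) (\<lambda>_. True) v \<longleftrightarrow> v = w" for v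
    using w(2) nn by (simp only: is_arg_min_scale zero_less_divide_1_iff zero_less_power)
  moreover have "norm (w - c *\<^sub>R dir) \<le> \<epsilon> / 2 * norm (c *\<^sub>R dir)"
  proof -
    have "\<epsilon> / 2 * (c0 * norm dir) \<le> \<epsilon> / 2 * norm (c *\<^sub>R dir)"
      using c \<epsilon> by (intro mult_left_mono) (auto intro: mult_right_mono)
    then show ?thesis using w(1) \<rho>(3) by (simp add: w0_def)
  qed
  ultimately show ?thesis using sim_ge[of w c dir \<epsilon>] c \<epsilon> dir_nz by auto
qed

end

section \<open>Measurability of success and tail bounds for the three statistics\<close>

context mixup_setting
begin

lemma pair_sampling: "0 < \<kappa> \<Longrightarrow> 2 \<le> n \<Longrightarrow> pair_sampling (D \<kappa>) \<Lambda> n"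
  by (intro pair_sampling.intro pair_sampling_axioms.intro prob_D \<Lambda>_prob) auto

lemma Pr_eq_mixup_space: "0 < \<kappa> \<Longrightarrow> 2 \<le> n \<Longrightarrow> pair_sampling.Pr (D \<kappa>) \<Lambda> n = mixup_space n \<mu> \<Sigma> \<kappa> \<Lambda>"
  by (simp add: pair_sampling.Pr_def[OF pair_sampling] mixup_space_def)

text \<open>\<open>measure\<close> is zero on sets that are not measurable, so a lower bound on the
  probability needs this. The condition \<open>w \<noteq> 0\<close> is not closed and is exhausted
  by the closed conditions \<open>1 / (m + 1) \<le> norm w\<close>; the similarity bound becomes
  closed when cleared of denominators.\<close>

lemma sets_success:
  assumes \<kappa>: "0 < \<kappa>" and n: "2 \<le> n"
  shows "{\<omega> \<in> space (mixup_space n \<mu> \<Sigma> \<kappa> \<Lambda>).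
     \<exists>w. (\<forall>v. is_arg_min (mixup_loss g n (fst \<omega>) (snd \<omega>)) (\<lambda>_. True) v \<longleftrightarrow> v = w) \<and> w \<noteq> 0 \<and> sim w dir \<ge> 1 - \<epsilon>}
     \<in> sets (mixup_space n \<mu> \<Sigma> \<kappa> \<Lambda>)"
proof -
  interpret PS: pair_sampling "D \<kappa>" \<Lambda> n by (rule pair_sampling[OF \<kappa> n])
  note Pr = Pr_eq_mixup_space[OF \<kappa> n]
  define K where "K = (\<lambda>m::nat. {w. 1 / (real m + 1) \<le> norm w} \<inter> {w. (1 - \<epsilon>) * (norm w * norm dir) \<le> w \<bullet> dir})"
  have closedK: "closed (K m)" for m
    unfolding K_def by (intro closed_Int closed_Collect_le continuous_intros)
  have meas: "(\<lambda>\<omega>. mixup_loss g n (fst \<omega>) (snd \<omega>) w) \<in> borel_measurable PS.Pr" for w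
  proof -
    define h where "h = (\<lambda>x. logistic_loss (w \<bullet> xt x) + (1 - yt x) * (w \<bullet> xt x))"
    have "h \<in> borel_measurable sample_alg"
      unfolding h_def by measurable
    then have h: "h \<in> borel_measurable (Q \<kappa>)" by (rule measurable_Q[OF \<kappa>])
    have eq: "(\<lambda>\<omega>. mixup_loss g n (fst \<omega>) (snd \<omega>) w) =
       (\<lambda>\<omega>. 1 / (real n)\<^sup>2 * (\<Sum>p\<in>{..<n} \<times> {..<n}. h (PS.entry \<omega> p)))"
      by (simp add: fun_eq_iff mixup_loss_eq_lin_logistic lin_logistic_def h_def PS.entry_def xt_def yt_def mix_x_def mix_y_def)
    show ?thesis unfolding eq
      by (intro borel_measurable_times borel_measurable_const borel_measurable_sum
          measurable_compose[OF PS.measurable_entry h]) auto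
  qed
  have K_iff: "(\<exists>w. (\<forall>v. is_arg_min f (\<lambda>_. True) v \<longleftrightarrow> v = w) \<and> w \<noteq> 0 \<and> sim w dir \<ge> 1 - \<epsilon>) \<longleftrightarrow>
     (\<exists>m. \<exists>w\<in>K m. \<forall>v. is_arg_min f (\<lambda>_. True) v \<longleftrightarrow> v = w)" for f :: "real^'d \<Rightarrow> real"
  proof -
    have "w \<noteq> 0 \<and> sim w dir \<ge> 1 - \<epsilon> \<longleftrightarrow> (\<exists>m. w \<in> K m)" for w
    proof (cases "w = 0")
      case False
      then have "sim w dir \<ge> 1 - \<epsilon> \<longleftrightarrow> (1 - \<epsilon>) * (norm w * norm dir) \<le> w \<bullet> dir"
        using dir_nz by (simp add: sim_def pos_le_divide_eq)
      moreover obtain m where "1 / (real m + 1) \<le> norm w"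
        using reals_Archimedean[of "norm w"] False by (auto simp: inverse_eq_divide add.commute intro: less_imp_le)
      ultimately show ?thesis using False by (auto simp: K_def)
    qed (auto simp: K_def not_le add_pos_nonneg)
    then show ?thesis by blast
  qed
  have "{\<omega> \<in> space PS.Pr. \<exists>w\<in>K m. \<forall>v. is_arg_min (mixup_loss g n (fst \<omega>) (snd \<omega>)) (\<lambda>_. True) v \<longleftrightarrow> v = w} \<in> sets PS.Pr" for m
    by (intro sets_unique_arg_min meas convex_mixup_loss continuous_mixup_loss closedK)
  then have "(\<Union>m. {\<omega> \<in> space PS.Pr. \<exists>w\<in>K m. \<forall>v. is_arg_min (mixup_loss g n (fst \<omega>) (snd \<omega>)) (\<lambda>_. True) v \<longleftrightarrow> v = w}) \<in> sets PS.Pr"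
    by (intro sets.countable_UN) auto
  also have "(\<Union>m. {\<omega> \<in> space PS.Pr. \<exists>w\<in>K m. \<forall>v. is_arg_min (mixup_loss g n (fst \<omega>) (snd \<omega>)) (\<lambda>_. True) v \<longleftrightarrow> v = w}) =
     {\<omega> \<in> space PS.Pr. \<exists>m. \<exists>w\<in>K m. \<forall>v. is_arg_min (mixup_loss g n (fst \<omega>) (snd \<omega>)) (\<lambda>_. True) v \<longleftrightarrow> v = w}"
    by auto
  finally show ?thesis unfolding K_iff Pr[symmetric] .
qed

text \<open>The critical point equation gives every component mean zero. The sign \<open>s\<close>
  lets two one-sided tails bound the absolute value.\<close>

lemma gradient_tail:
  assumes \<kappa>: "1 \<le> \<kappa>" and n: "2 \<le> n"
    and K: "(\<integral>\<^sup>+x. ennreal (exp (2 * pair_norm x)) \<partial>Q \<kappa>) \<le> ennreal K" "1 \<le> K"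
    and crit: "(\<integral>x. grad_term w x \<partial>Q \<kappa>) = 0" and s: "\<bar>s\<bar> = 1" and \<gamma>: "0 < \<gamma>" "\<gamma> \<le> 1"
  shows "measure (pair_sampling.Pr (D \<kappa>) \<Lambda> n) {\<omega> \<in> space (pair_sampling.Pr (D \<kappa>) \<Lambda> n).
      \<gamma> * (real n)\<^sup>2 \<le> (\<Sum>p\<in>pair_sampling.offdiag n. s * grad_term w (pair_sampling.entry \<omega> p) $ k)} \<le> exp (- \<gamma>\<^sup>2 * n / (32 * K))"
proof -
  have \<kappa>0: "0 < \<kappa>" using \<kappa> by simp
  interpret PS: pair_sampling "D \<kappa>" \<Lambda> n by (rule pair_sampling[OF \<kappa>0 n])
  show ?thesis
  proof (rule PS.offdiag_tail[where F="\<lambda>x. s * grad_term w x $ k", OF _ _ K(2) _ \<gamma>])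
    show "(\<lambda>x. s * grad_term w x $ k) \<in> borel_measurable (Q \<kappa>)" by (intro measurable_Q[OF \<kappa>0]) measurable
    have "(\<integral>\<^sup>+x. ennreal (exp (2 * \<bar>s * grad_term w x $ k\<bar>)) \<partial>Q \<kappa>) \<le> (\<integral>\<^sup>+x. ennreal (exp (2 * pair_norm x)) \<partial>Q \<kappa>)"
    proof (rule nn_integral_mono_AE)
      show "AE x in Q \<kappa>. ennreal (exp (2 * \<bar>s * grad_term w x $ k\<bar>)) \<le> ennreal (exp (2 * pair_norm x))"
        using AE_regular[OF \<kappa>0]
      proof eventually_elim
        case (elim x)
        have "\<bar>s * grad_term w x $ k\<bar> \<le> pair_norm x"
          using component_le_norm_cart[of "grad_term w x" k] regular_bounds(5)[OF elim, of w] s by (simp add: abs_mult)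
        then show ?case by (intro ennreal_leI) simp
      qed
    qed
    then show "(\<integral>\<^sup>+x. ennreal (exp (2 * \<bar>s * grad_term w x $ k\<bar>)) \<partial>Q \<kappa>) \<le> ennreal K" using K(1) by (rule order_trans)
    have "(\<integral>x. grad_term w x $ k \<partial>Q \<kappa>) = (\<integral>x. grad_term w x \<partial>Q \<kappa>) $ k"
      by (rule integral_bounded_linear[OF bounded_linear_vec_nth integrable_grad_term[OF \<kappa>]])
    then show "(\<integral>x. s * grad_term w x $ k \<partial>Q \<kappa>) = 0" by (simp add: crit)
  qed
qed

text \<open>The truncation keeps the centred statistic within \<open>2 * B^2\<close>, so its
  exponential moment bound \<open>exp (4 * B^2)\<close> does not depend on \<kappa>.\<close>

lemma cov_tail:
  assumes \<kappa>: "1 \<le> \<kappa>" and n: "2 \<le> n" and B: "0 \<le> B" and s: "\<bar>s\<bar> = 1" and \<eta>: "0 < \<eta>" "\<eta> \<le> 1"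
  shows "measure (pair_sampling.Pr (D \<kappa>) \<Lambda> n) {\<omega> \<in> space (pair_sampling.Pr (D \<kappa>) \<Lambda> n).
      \<eta> * (real n)\<^sup>2 \<le> (\<Sum>p\<in>pair_sampling.offdiag n. s * (cov B k l (pair_sampling.entry \<omega> p) - (\<integral>x. cov B k l x \<partial>Q \<kappa>)))}
      \<le> exp (- \<eta>\<^sup>2 * n / (32 * exp (4 * B\<^sup>2)))"
proof -
  have \<kappa>0: "0 < \<kappa>" using \<kappa> by simp
  interpret QQ: prob_space "Q \<kappa>" by (rule prob_Q[OF \<kappa>0])
  interpret PS: pair_sampling "D \<kappa>" \<Lambda> n by (rule pair_sampling[OF \<kappa>0 n])
  define m where "m = (\<integral>x. cov B k l x \<partial>Q \<kappa>)"
  have bd: "\<bar>cov B k l x\<bar> \<le> B\<^sup>2" if "regular x" for x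
    using that B by (intro cov_bound) (auto simp: regular_def)
  have "\<bar>m\<bar> \<le> (\<integral>x. \<bar>cov B k l x\<bar> \<partial>Q \<kappa>)" unfolding m_def by (rule integral_abs_bound)
  also have "\<dots> \<le> (\<integral>x. B\<^sup>2 \<partial>Q \<kappa>)"
    using AE_regular[OF \<kappa>0] integrable_cov[OF \<kappa> B]
    by (intro integral_mono_AE) (auto elim!: eventually_mono intro: bd)
  finally have m: "\<bar>m\<bar> \<le> B\<^sup>2" by (simp add: QQ.prob_space)
  show ?thesis unfolding m_def[symmetric]
  proof (rule PS.offdiag_tail[where F="\<lambda>x. s * (cov B k l x - m)", OF _ _ _ _ \<eta>])
    show "(\<lambda>x. s * (cov B k l x - m)) \<in> borel_measurable (Q \<kappa>)" by (intro measurable_Q[OF \<kappa>0]) measurable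
    have "(\<integral>\<^sup>+x. ennreal (exp (2 * \<bar>s * (cov B k l x - m)\<bar>)) \<partial>Q \<kappa>) \<le> (\<integral>\<^sup>+x. ennreal (exp (4 * B\<^sup>2)) \<partial>Q \<kappa>)"
    proof (rule nn_integral_mono_AE)
      show "AE x in Q \<kappa>. ennreal (exp (2 * \<bar>s * (cov B k l x - m)\<bar>)) \<le> ennreal (exp (4 * B\<^sup>2))"
        using AE_regular[OF \<kappa>0]
      proof eventually_elim
        case (elim x)
        have "\<bar>s * (cov B k l x - m)\<bar> \<le> 2 * B\<^sup>2" using bd[OF elim] m s by (simp add: abs_mult)
        then show ?case by (intro ennreal_leI) simp
      qed
    qed
    then show "(\<integral>\<^sup>+x. ennreal (exp (2 * \<bar>s * (cov B k l x - m)\<bar>)) \<partial>Q \<kappa>) \<le> ennreal (exp (4 * B\<^sup>2))"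
      by (simp add: QQ.emeasure_space_1)
    show "(\<integral>x. s * (cov B k l x - m) \<partial>Q \<kappa>) = 0"
      using integrable_cov[OF \<kappa> B, of k l] by (simp add: QQ.prob_space m_def)
  qed simp
qed

text \<open>With labels 0 and 1 the sigmoid is off by at most 1, so the norm of the point dominates.
  The threshold is linear in \<open>n\<close>, against the multiple of \<open>n^2\<close> that the
  diagonal terms may reach.\<close>

lemma label_err_tail:
  assumes \<kappa>: "1 \<le> \<kappa>" and n: "2 \<le> n"
    and K: "(\<integral>\<^sup>+z. ennreal (exp (1 * norm (fst z))) \<partial>D \<kappa>) \<le> ennreal K" "1 \<le> K"
  shows "measure (pair_sampling.Pr (D \<kappa>) \<Lambda> n) {\<omega> \<in> space (pair_sampling.Pr (D \<kappa>) \<Lambda> n).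
      (ln K + 1) * n \<le> (\<Sum>i<n. label_err w (fst \<omega> i))} \<le> exp (- real n)"
proof -
  have \<kappa>0: "0 < \<kappa>" using \<kappa> by simp
  interpret PS: pair_sampling "D \<kappa>" \<Lambda> n by (rule pair_sampling[OF \<kappa>0 n])
  show ?thesis
  proof (rule PS.iid_tail[OF _ _ K(2)])
    show "label_err w \<in> borel_measurable (D \<kappa>)"
      unfolding label_err_def by (intro measurable_D[OF \<kappa>0]) measurable
    have "(\<integral>\<^sup>+z. ennreal (exp (label_err w z)) \<partial>D \<kappa>) \<le> (\<integral>\<^sup>+z. ennreal (exp (1 * norm (fst z))) \<partial>D \<kappa>)"
    proof (rule nn_integral_mono_AE)
      show "AE z in D \<kappa>. ennreal (exp (label_err w z)) \<le> ennreal (exp (1 * norm (fst z)))"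
        using AE_data_dist_label[OF \<Sigma>_pd \<kappa>0]
      proof eventually_elim
        case (elim z)
        have "\<bar>sigmoid (w \<bullet> fst z) - snd z\<bar> \<le> 1"
          using elim sigmoid_bounds[of "w \<bullet> fst z"] by (auto simp: abs_le_iff)
        then have "label_err w z \<le> 1 * norm (fst z)" unfolding label_err_def by (intro mult_right_mono) auto
        then show ?case by (intro ennreal_leI) simp
      qed
    qed
    then show "(\<integral>\<^sup>+z. ennreal (exp (label_err w z)) \<partial>D \<kappa>) \<le> ennreal K" using K(1) by (rule order_trans)
  qed
qed

end

section \<open>The union bound\<close>

context mixup_setting
begin

text \<open>The bad events are two signs for each of \<open>d\<close> gradient components and of
  \<open>d^2\<close> second moment entries, and one event for the diagonal, which explains
  \<open>2 * d + 2 * d^2 + 1\<close>. The constant \<theta> is a common rate for the three kinds of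
  tail. Condition \<open>n1\<close> makes the diagonal negligible; \<open>n2\<close> brings each
  tail down to \<delta> divided by the number of events.\<close>

lemma success_probability:
  fixes \<kappa> B q c0 c1 c \<epsilon> \<delta> K Kd \<theta> :: real and n :: nat
  defines "\<tau> \<equiv> exp (- ((c1 * norm dir + 1) * B)) / 8 * (q / 4)"
    and "\<omega> \<equiv> min 1 (c0 * norm dir)"
    and "d \<equiv> real CARD('d)"
  assumes n: "2 \<le> n" and \<kappa>: "1 \<le> \<kappa>" and c: "0 < c0" "c0 \<le> c" "c \<le> c1" and B: "0 < B" and q: "0 < q" "q \<le> 1"
    and moment: "\<And>v. q / \<kappa> * (norm v)\<^sup>2 \<le> (\<integral>x. trunc B x * (v \<bullet> xt x)\<^sup>2 \<partial>Q \<kappa>)"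
    and crit: "(\<integral>x. grad_term (c *\<^sub>R dir) x \<partial>Q \<kappa>) = 0"
    and K: "(\<integral>\<^sup>+x. ennreal (exp (2 * pair_norm x)) \<partial>Q \<kappa>) \<le> ennreal K" "1 \<le> K"
    and Kd: "(\<integral>\<^sup>+z. ennreal (exp (1 * norm (fst z))) \<partial>D \<kappa>) \<le> ennreal Kd" "1 \<le> Kd"
    and \<epsilon>: "0 < \<epsilon>" "\<epsilon> < 1" and \<delta>: "0 < \<delta>" "\<delta> < 1"
    and \<theta>: "0 < \<theta>" "\<theta> \<le> 1" "\<theta> \<le> (\<tau> * \<omega> / (8 * d))\<^sup>2 / (32 * K)" "\<theta> \<le> (q / (4 * d\<^sup>2))\<^sup>2 / (32 * exp (4 * B\<^sup>2))"
    and n1: "8 * (ln Kd + 1) / (\<tau> * \<omega>) * \<kappa> / \<epsilon> \<le> n"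
    and n2: "(ln (2 * d + 2 * d\<^sup>2 + 1) + ln (1 / \<delta>)) / \<theta> * \<kappa>\<^sup>2 / \<epsilon>\<^sup>2 \<le> n"
  shows "1 - \<delta> \<le> measure (mixup_space n \<mu> \<Sigma> \<kappa> \<Lambda>) {\<omega> \<in> space (mixup_space n \<mu> \<Sigma> \<kappa> \<Lambda>).
     \<exists>w. (\<forall>v. is_arg_min (mixup_loss g n (fst \<omega>) (snd \<omega>)) (\<lambda>_. True) v \<longleftrightarrow> v = w) \<and> w \<noteq> 0 \<and> sim w dir \<ge> 1 - \<epsilon>}"
proof -
  have \<kappa>0: "0 < \<kappa>" using \<kappa> by simp
  interpret PS: pair_sampling "D \<kappa>" \<Lambda> n by (rule pair_sampling[OF \<kappa>0 n])
  note Pr = Pr_eq_mixup_space[OF \<kappa>0 n]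
  have d: "1 \<le> d" by (simp add: d_def Suc_le_eq)
  have d2: "1 \<le> d\<^sup>2" using d by simp
  have \<tau>: "0 < \<tau>" "\<tau> \<le> 1"
  proof -
    show "0 < \<tau>" using q by (simp add: \<tau>_def)
    have "0 \<le> (c1 * norm dir + 1) * B" using c B by (intro mult_nonneg_nonneg) auto
    then have "exp (- ((c1 * norm dir + 1) * B)) \<le> 1" by (simp only: exp_le_one_iff neg_le_0_iff_le)
    then have "exp (- ((c1 * norm dir + 1) * B)) / 8 \<le> 1" by linarith
    then have "exp (- ((c1 * norm dir + 1) * B)) / 8 * (q / 4) \<le> 1 * 1" using q by (intro mult_mono) auto
    then show "\<tau> \<le> 1" by (simp add: \<tau>_def)
  qed
  have \<omega>: "0 < \<omega>" "\<omega> \<le> 1" "\<omega> \<le> c0 * norm dir" using c dir_nz by (auto simp: \<omega>_def)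
  \<comment> \<open>\<omega> keeps the radius below 1, as the quadratic lower bound requires, and
    below \<open>\<epsilon> / 2\<close> times the least possible norm of the population critical
    point.\<close>
  define \<rho> where "\<rho> = \<omega> * \<epsilon> / 2"
  \<comment> \<open>\<gamma> and \<eta> are the tolerances of \<open>good_event\<close>, namely
    \<open>\<tau> * \<rho> / (4 * d * \<kappa>)\<close> with \<rho> inserted and
    \<open>q / (4 * d^2 * \<kappa>)\<close>; the dependence on \<kappa> is written as a separate
    factor for the comparison with \<open>t\<close>.\<close>
  define \<gamma> where "\<gamma> = \<tau> * \<omega> / (8 * d) * (\<epsilon> / \<kappa>)"
  define \<eta> where "\<eta> = q / (4 * d\<^sup>2) * (1 / \<kappa>)"
  define t where "t = exp (- \<theta> * (\<epsilon> / \<kappa>)\<^sup>2 * n)"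
  have \<rho>: "0 < \<rho>" "\<rho> \<le> 1" "\<rho> \<le> \<epsilon> / 2 * (c0 * norm dir)"
  proof -
    show "0 < \<rho>" using \<omega> \<epsilon> by (simp add: \<rho>_def)
    have "\<omega> * \<epsilon> \<le> 1 * 1" using \<omega> \<epsilon> by (intro mult_mono) auto
    then show "\<rho> \<le> 1" by (simp add: \<rho>_def)
    show "\<rho> \<le> \<epsilon> / 2 * (c0 * norm dir)" using \<omega>(3) \<epsilon> by (simp add: \<rho>_def mult_ac)
  qed
  have \<epsilon>\<kappa>: "0 < \<epsilon> / \<kappa>" "\<epsilon> / \<kappa> \<le> 1" using \<epsilon> \<kappa> by (auto simp: field_simps)
  have \<gamma>: "0 < \<gamma>" "\<gamma> \<le> 1"
  proof -
    show "0 < \<gamma>" unfolding \<gamma>_def using \<tau> \<omega> d \<epsilon> \<kappa>0 by (intro mult_pos_pos divide_pos_pos) auto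
    have "\<tau> * \<omega> \<le> 1 * 1" using \<tau> \<omega> by (intro mult_mono) auto
    then have "\<tau> * \<omega> / (8 * d) \<le> 1" using d by (simp add: field_simps)
    then have "\<tau> * \<omega> / (8 * d) * (\<epsilon> / \<kappa>) \<le> 1 * 1" using \<epsilon>\<kappa> by (intro mult_mono) auto
    then show "\<gamma> \<le> 1" by (simp add: \<gamma>_def)
  qed
  have \<eta>: "0 < \<eta>" "\<eta> \<le> 1"
  proof -
    show "0 < \<eta>" unfolding \<eta>_def using q d \<kappa>0 by (intro mult_pos_pos divide_pos_pos) auto
    have "q \<le> 4 * d\<^sup>2" using q(2) d2 by linarith
    then have "q / (4 * d\<^sup>2) \<le> 1" using d2 by (subst divide_le_eq_1_pos) auto
    then have "q / (4 * d\<^sup>2) * (1 / \<kappa>) \<le> 1 * 1" using \<kappa> by (intro mult_mono) auto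
    then show "\<eta> \<le> 1" by (simp add: \<eta>_def)
  qed
  have tail_\<gamma>: "exp (- \<gamma>\<^sup>2 * n / (32 * K)) \<le> t"
  proof -
    have "\<theta> * (\<epsilon> / \<kappa>)\<^sup>2 \<le> (\<tau> * \<omega> / (8 * d))\<^sup>2 / (32 * K) * (\<epsilon> / \<kappa>)\<^sup>2"
      using \<theta>(3) by (intro mult_right_mono) auto
    also have "\<dots> = \<gamma>\<^sup>2 / (32 * K)" unfolding \<gamma>_def power_mult_distrib[of _ "\<epsilon> / \<kappa>"] by (rule times_divide_eq_left)
    finally have "\<theta> * (\<epsilon> / \<kappa>)\<^sup>2 * n \<le> \<gamma>\<^sup>2 / (32 * K) * n" by (rule mult_right_mono) simp
    then show ?thesis by (simp add: t_def)
  qed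
  have tail_\<eta>: "exp (- \<eta>\<^sup>2 * n / (32 * exp (4 * B\<^sup>2))) \<le> t"
  proof -
    have "(\<epsilon> / \<kappa>)\<^sup>2 \<le> (1 / \<kappa>)\<^sup>2" using \<epsilon> \<kappa>0 by (intro power_mono divide_right_mono) auto
    then have "\<theta> * (\<epsilon> / \<kappa>)\<^sup>2 \<le> (q / (4 * d\<^sup>2))\<^sup>2 / (32 * exp (4 * B\<^sup>2)) * (1 / \<kappa>)\<^sup>2"
      using \<theta>(1,4) by (intro mult_mono) auto
    also have "\<dots> = \<eta>\<^sup>2 / (32 * exp (4 * B\<^sup>2))" unfolding \<eta>_def power_mult_distrib[of _ "1 / \<kappa>"] by (rule times_divide_eq_left)
    finally have "\<theta> * (\<epsilon> / \<kappa>)\<^sup>2 * n \<le> \<eta>\<^sup>2 / (32 * exp (4 * B\<^sup>2)) * n" by (rule mult_right_mono) simp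
    then show ?thesis by (simp add: t_def)
  qed
  have tail_1: "exp (- real n) \<le> t"
  proof -
    have "(\<epsilon> / \<kappa>)\<^sup>2 \<le> 1\<^sup>2" using \<epsilon>\<kappa> by (intro power_mono) auto
    then have "\<theta> * (\<epsilon> / \<kappa>)\<^sup>2 \<le> 1 * 1" using \<theta> by (intro mult_mono) auto
    then have "\<theta> * (\<epsilon> / \<kappa>)\<^sup>2 * n \<le> 1 * real n" by (intro mult_right_mono) auto
    then show ?thesis by (simp add: t_def)
  qed
  define N where "N = 2 * d + 2 * d\<^sup>2 + 1"
  have N: "0 < N" unfolding N_def using d d2 by linarith
  \<comment> \<open>Inserting \<open>n2\<close> cancels \<theta> and the powers of \<epsilon> and
    \<kappa> in the exponent of \<open>t\<close>, which leaves \<open>\<delta> / N\<close>.\<close>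
  have total: "N * t \<le> \<delta>"
  proof -
    have "\<theta> * (\<epsilon> / \<kappa>)\<^sup>2 * ((ln N + ln (1 / \<delta>)) / \<theta> * \<kappa>\<^sup>2 / \<epsilon>\<^sup>2) \<le> \<theta> * (\<epsilon> / \<kappa>)\<^sup>2 * n"
      using n2 \<theta>(1) unfolding N_def by (intro mult_left_mono) auto
    moreover have "\<theta> * (\<epsilon> / \<kappa>)\<^sup>2 * ((ln N + ln (1 / \<delta>)) / \<theta> * \<kappa>\<^sup>2 / \<epsilon>\<^sup>2) = ln N + ln (1 / \<delta>)"
      using \<theta>(1) \<epsilon> \<kappa>0 by (simp add: power_divide)
    ultimately have "- \<theta> * (\<epsilon> / \<kappa>)\<^sup>2 * n \<le> - (ln N + ln (1 / \<delta>))" by simp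
    then have "t \<le> exp (- (ln N + ln (1 / \<delta>)))" by (simp add: t_def)
    also have "\<dots> = inverse (exp (ln N) * exp (ln (1 / \<delta>)))" by (simp only: exp_minus exp_add)
    also have "exp (ln N) = N" using N by simp
    also have "exp (ln (1 / \<delta>)) = 1 / \<delta>" using \<delta> by (intro exp_ln) simp
    also have "inverse (N * (1 / \<delta>)) = \<delta> / N" by simp
    finally show ?thesis using N by (simp add: field_simps)
  qed
  let ?w = "c *\<^sub>R dir"
  define Bg where "Bg = (\<lambda>(k, s). {\<omega> \<in> space PS.Pr. \<gamma> * (real n)\<^sup>2 \<le> (\<Sum>p\<in>PS.offdiag. s * grad_term ?w (PS.entry \<omega> p) $ k)})"
  define Bh where "Bh = (\<lambda>(k, l, s). {\<omega> \<in> space PS.Pr. \<eta> * (real n)\<^sup>2 \<le> (\<Sum>p\<in>PS.offdiag. s * (cov B k l (PS.entry \<omega> p) - (\<integral>x. cov B k l x \<partial>Q \<kappa>)))})"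
  define Bd where "Bd = {\<omega> \<in> space PS.Pr. (ln Kd + 1) * n \<le> (\<Sum>i<n. label_err ?w (fst \<omega> i))}"
  let ?S = "{1, - 1 :: real}"
  have msum: "(\<lambda>\<omega>. \<Sum>p\<in>PS.offdiag. F (PS.entry \<omega> p)) \<in> borel_measurable PS.Pr"
    if "F \<in> borel_measurable sample_alg" for F :: "_ \<Rightarrow> real"
    by (intro borel_measurable_sum measurable_compose[OF PS.measurable_entry_offdiag] measurable_Q[OF \<kappa>0] that)
  have Bg: "Bg i \<in> sets PS.Pr" for i
  proof -
    obtain k s where i: "i = (k, s)" by (cases i)
    have "(\<lambda>\<omega>. \<Sum>p\<in>PS.offdiag. s * grad_term ?w (PS.entry \<omega> p) $ k) \<in> borel_measurable PS.Pr"
      by (rule msum) measurable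
    then show ?thesis by (simp add: Bg_def i)
  qed
  have Bh: "Bh i \<in> sets PS.Pr" for i
  proof -
    obtain k l s where i: "i = (k, l, s)" by (cases i)
    have "(\<lambda>\<omega>. \<Sum>p\<in>PS.offdiag. s * (cov B k l (PS.entry \<omega> p) - (\<integral>x. cov B k l x \<partial>Q \<kappa>))) \<in> borel_measurable PS.Pr"
      by (rule msum) measurable
    then show ?thesis by (simp add: Bh_def i)
  qed
  have Bd: "Bd \<in> sets PS.Pr"
  proof -
    have "label_err ?w \<in> borel_measurable (D \<kappa>)"
      unfolding label_err_def by (intro measurable_D[OF \<kappa>0]) measurable
    then have "(\<lambda>\<omega>. \<Sum>i<n. label_err ?w (fst \<omega> i)) \<in> borel_measurable PS.Pr"
      by (intro borel_measurable_sum measurable_compose[OF PS.measurable_fst_Pr]) auto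
    then show ?thesis by (simp add: Bd_def)
  qed
  have pg: "PS.Pr.prob (Bg i) \<le> t" if mem: "i \<in> UNIV \<times> ?S" for i
  proof -
    obtain k s where i: "i = (k, s)" "\<bar>s\<bar> = 1" using mem by auto
    show ?thesis using gradient_tail[OF \<kappa> n K crit i(2) \<gamma>, of k] tail_\<gamma> by (simp add: Bg_def i(1))
  qed
  have ph: "PS.Pr.prob (Bh i) \<le> t" if mem: "i \<in> UNIV \<times> UNIV \<times> ?S" for i
  proof -
    obtain k l s where i: "i = (k, l, s)" "\<bar>s\<bar> = 1" using mem by auto
    show ?thesis using cov_tail[OF \<kappa> n less_imp_le[OF B] i(2) \<eta>, of k l] tail_\<eta> by (simp add: Bh_def i(1))
  qed
  have pd: "PS.Pr.prob Bd \<le> t"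
    using label_err_tail[OF \<kappa> n Kd, of ?w] tail_1 by (simp add: Bd_def)
  define Bad where "Bad = (\<Union>i\<in>UNIV \<times> ?S. Bg i) \<union> (\<Union>i\<in>UNIV \<times> UNIV \<times> ?S. Bh i) \<union> Bd"
  have Ug: "(\<Union>i\<in>UNIV \<times> ?S. Bg i) \<in> sets PS.Pr" and Uh: "(\<Union>i\<in>UNIV \<times> UNIV \<times> ?S. Bh i) \<in> sets PS.Pr"
    using Bg Bh by (auto intro!: sets.finite_UN)
  have Bad: "Bad \<in> sets PS.Pr" unfolding Bad_def using Ug Uh Bd by auto
  have c2: "card ?S = 2" by simp
  have "PS.Pr.prob (\<Union>i\<in>UNIV \<times> ?S. Bg i) \<le> (\<Sum>i\<in>(UNIV::'d set) \<times> ?S. PS.Pr.prob (Bg i))"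
    using Bg by (intro PS.Pr.finite_measure_subadditive_finite) auto
  also have "\<dots> \<le> (\<Sum>i\<in>(UNIV::'d set) \<times> ?S. t)" by (intro sum_mono pg)
  also have "\<dots> = 2 * d * t" unfolding sum_constant card_cartesian_product c2 by (simp add: d_def)
  finally have Pg: "PS.Pr.prob (\<Union>i\<in>UNIV \<times> ?S. Bg i) \<le> 2 * d * t" .
  have "PS.Pr.prob (\<Union>i\<in>UNIV \<times> UNIV \<times> ?S. Bh i) \<le> (\<Sum>i\<in>(UNIV::'d set) \<times> (UNIV::'d set) \<times> ?S. PS.Pr.prob (Bh i))"
    using Bh by (intro PS.Pr.finite_measure_subadditive_finite) auto
  also have "\<dots> \<le> (\<Sum>i\<in>(UNIV::'d set) \<times> (UNIV::'d set) \<times> ?S. t)" by (intro sum_mono ph)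
  also have "\<dots> = 2 * d\<^sup>2 * t" unfolding sum_constant card_cartesian_product c2 by (simp add: d_def power2_eq_square)
  finally have Ph: "PS.Pr.prob (\<Union>i\<in>UNIV \<times> UNIV \<times> ?S. Bh i) \<le> 2 * d\<^sup>2 * t" .
  have "PS.Pr.prob Bad \<le> PS.Pr.prob ((\<Union>i\<in>UNIV \<times> ?S. Bg i) \<union> (\<Union>i\<in>UNIV \<times> UNIV \<times> ?S. Bh i)) + PS.Pr.prob Bd"
    unfolding Bad_def using Ug Uh Bd by (intro measure_Un_le) auto
  also have "PS.Pr.prob ((\<Union>i\<in>UNIV \<times> ?S. Bg i) \<union> (\<Union>i\<in>UNIV \<times> UNIV \<times> ?S. Bh i)) \<le>
      PS.Pr.prob (\<Union>i\<in>UNIV \<times> ?S. Bg i) + PS.Pr.prob (\<Union>i\<in>UNIV \<times> UNIV \<times> ?S. Bh i)"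
    by (rule measure_Un_le[OF Ug Uh])
  also have "\<dots> + PS.Pr.prob Bd \<le> (2 * d * t + 2 * d\<^sup>2 * t) + t"
    by (intro add_mono Pg Ph pd)
  also have "\<dots> = N * t" by (simp add: N_def algebra_simps)
  finally have pBad: "PS.Pr.prob Bad \<le> \<delta>" using total by simp
  let ?E = "{\<omega> \<in> space PS.Pr.
     \<exists>w. (\<forall>v. is_arg_min (mixup_loss g n (fst \<omega>) (snd \<omega>)) (\<lambda>_. True) v \<longleftrightarrow> v = w) \<and> w \<noteq> 0 \<and> sim w dir \<ge> 1 - \<epsilon>}"
  have "space PS.Pr - Bad \<subseteq> ?E"
  proof
    fix x assume x: "x \<in> space PS.Pr - Bad"
    have g1: "(\<Sum>p\<in>PS.offdiag. s * grad_term ?w (PS.entry x p) $ k) < \<gamma> * (real n)\<^sup>2" if "s \<in> ?S" for s k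
    proof -
      have "x \<notin> Bg (k, s)" using x that by (auto simp: Bad_def)
      then show ?thesis using x by (simp add: Bg_def not_le)
    qed
    have h1: "(\<Sum>p\<in>PS.offdiag. s * (cov B k l (PS.entry x p) - (\<integral>x. cov B k l x \<partial>Q \<kappa>))) < \<eta> * (real n)\<^sup>2" if "s \<in> ?S" for s k l
    proof -
      have "x \<notin> Bh (k, l, s)" using x that by (auto simp: Bad_def)
      then show ?thesis using x by (simp add: Bh_def not_le)
    qed
    have d1: "(\<Sum>i<n. label_err ?w (fst x i)) \<le> (ln Kd + 1) * n"
      using x by (auto simp: Bad_def Bd_def not_le)
    have "\<exists>w. (\<forall>v. is_arg_min (mixup_loss g n (fst x) (snd x)) (\<lambda>_. True) v \<longleftrightarrow> v = w) \<and> w \<noteq> 0 \<and> sim w dir \<ge> 1 - \<epsilon>"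
    proof (rule good_event[OF n \<kappa> c B q(1) moment _ \<epsilon> \<rho>])
      show "snd x (i, j) \<in> {0..1}" if "i < n" "j < n" for i j
      proof -
        have "snd x \<in> space (\<Pi>\<^sub>M ij\<in>{..<n} \<times> {..<n}. \<Lambda>)"
          using x by (auto simp: PS.Pr_def space_pair_measure)
        then have "snd x (i, j) \<in> space \<Lambda>" using that by (auto simp: space_PiM PiE_def Pi_def)
        then show ?thesis by simp
      qed
      show "\<bar>\<Sum>p\<in>{(i, j). i < n \<and> j < n \<and> i \<noteq> j}. grad_term ?w (fst x (fst p), fst x (snd p), snd x p) $ k\<bar> \<le>
          exp (- ((c1 * norm dir + 1) * B)) / 8 * (q / 4) * \<rho> / (4 * real CARD('d) * \<kappa>) * (real n)\<^sup>2" for k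
      proof -
        have "exp (- ((c1 * norm dir + 1) * B)) / 8 * (q / 4) * \<rho> / (4 * real CARD('d) * \<kappa>) = \<gamma>"
          unfolding \<tau>_def[symmetric] d_def[symmetric] by (simp add: \<gamma>_def \<rho>_def)
        moreover have "\<bar>\<Sum>p\<in>PS.offdiag. grad_term ?w (PS.entry x p) $ k\<bar> \<le> \<gamma> * (real n)\<^sup>2"
          using g1[of 1 k] g1[of "- 1" k] by (simp add: sum_negf abs_le_iff)
        ultimately show ?thesis by (simp only: PS.offdiag_def PS.entry_def)
      qed
      show "\<bar>\<Sum>p\<in>{(i, j). i < n \<and> j < n \<and> i \<noteq> j}. cov B k l (fst x (fst p), fst x (snd p), snd x p) - (\<integral>x. cov B k l x \<partial>Q \<kappa>)\<bar> \<le>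
          q / (4 * (real CARD('d))\<^sup>2 * \<kappa>) * (real n)\<^sup>2" for k l
      proof -
        have "q / (4 * (real CARD('d))\<^sup>2 * \<kappa>) = \<eta>" by (simp add: \<eta>_def d_def)
        moreover have "\<bar>\<Sum>p\<in>PS.offdiag. cov B k l (PS.entry x p) - (\<integral>x. cov B k l x \<partial>Q \<kappa>)\<bar> \<le> \<eta> * (real n)\<^sup>2"
        proof -
          define m where "m = (\<integral>x. cov B k l x \<partial>Q \<kappa>)"
          have "(\<Sum>p\<in>PS.offdiag. - 1 * (cov B k l (PS.entry x p) - m)) = - (\<Sum>p\<in>PS.offdiag. cov B k l (PS.entry x p) - m)"
            by (simp only: sum_distrib_left[symmetric])
          then show ?thesis using h1[of 1 k l] h1[of "- 1" k l] unfolding m_def[symmetric] by (simp add: abs_le_iff)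
        qed
        ultimately show ?thesis by (simp only: PS.offdiag_def PS.entry_def)
      qed
      show "(\<Sum>i<n. label_err ?w (fst x i)) \<le> exp (- ((c1 * norm dir + 1) * B)) / 8 * (q / 4) * \<rho> / (4 * \<kappa>) * (real n)\<^sup>2"
      proof -
        \<comment> \<open>The diagonal sum is linear in \<open>n\<close> and its tolerance
          quadratic, so the surplus factor \<open>n\<close> is what \<open>n1\<close> bounds from
          below.\<close>
        have "0 < \<tau> * \<omega> * \<epsilon> / (8 * \<kappa>)" using \<tau> \<omega> \<epsilon> \<kappa>0 by simp
        from mult_left_mono[OF n1 less_imp_le[OF this]]
        have "\<tau> * \<omega> * \<epsilon> / (8 * \<kappa>) * (8 * (ln Kd + 1) / (\<tau> * \<omega>) * \<kappa> / \<epsilon>) \<le> \<tau> * \<omega> * \<epsilon> / (8 * \<kappa>) * n" .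
        also have "\<tau> * \<omega> * \<epsilon> / (8 * \<kappa>) * (8 * (ln Kd + 1) / (\<tau> * \<omega>) * \<kappa> / \<epsilon>) = ln Kd + 1"
          using \<tau> \<omega> \<epsilon> \<kappa>0 by (simp add: field_simps)
        finally have "(ln Kd + 1) * n \<le> \<tau> * \<omega> * \<epsilon> / (8 * \<kappa>) * n * n" by (rule mult_right_mono) simp
        also have "\<dots> = \<tau> * \<rho> / (4 * \<kappa>) * (real n)\<^sup>2" by (simp add: \<rho>_def power2_eq_square)
        finally have "(ln Kd + 1) * n \<le> \<tau> * \<rho> / (4 * \<kappa>) * (real n)\<^sup>2" .
        then show ?thesis using d1 unfolding \<tau>_def by linarith
      qed
    qed
    then show "x \<in> ?E" using x by simp
  qed
  then have "PS.Pr.prob (space PS.Pr - Bad) \<le> PS.Pr.prob ?E"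
    using sets_success[OF \<kappa>0 n, of \<epsilon>] unfolding Pr by (intro PS.Pr.finite_measure_mono[unfolded Pr]) auto
  moreover have "PS.Pr.prob (space PS.Pr - Bad) = 1 - PS.Pr.prob Bad" by (rule PS.Pr.prob_compl[OF Bad])
  ultimately show ?thesis using pBad unfolding Pr by linarith
qed

end

section \<open>Choice of the constants\<close>

theorem theorem4p4:
  fixes \<mu> :: "real^'d" and \<Sigma> :: "real^'d^'d"
    and \<Lambda> :: "real measure" and g :: "real \<Rightarrow> real"
  assumes "\<mu> \<noteq> 0" and "pos_def \<Sigma>"
    and "(norm \<mu>)\<^sup>2 = onorm ((*v) \<Sigma>)"
    and "prob_space \<Lambda>" and "sets \<Lambda> = sets (restrict_space borel {0..1})"
    and "g \<in> {0..1} \<rightarrow> {0..1}"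
    and "g \<in> borel_measurable (restrict_space borel {0..1})"
    and "\<forall>z\<in>{0..1}. g z > 1/2 \<longleftrightarrow> z > 1/2"
    and "\<P>(l in \<Lambda>. l \<notin> {0, 1} \<and> g l \<noteq> 1/2) > 0"
  shows "\<exists>\<kappa>0>1. \<exists>C>0. \<exists>p::nat. \<forall>\<kappa>\<ge>\<kappa>0. \<forall>\<epsilon>\<in>{0<..<1}. \<forall>\<delta>\<in>{0<..<1}. \<forall>n\<ge>2.
    real n \<ge> C * \<kappa>\<^sup>2 * (ln \<kappa>) ^ p / \<epsilon> ^ 4 * (1 + ln (1 / \<epsilon>) + ln (1 / \<delta>)) \<longrightarrow>
    \<P>((S, lam) in mixup_space n \<mu> \<Sigma> \<kappa> \<Lambda>.
        \<exists>w. (\<forall>v. is_arg_min (mixup_loss g n S lam) (\<lambda>_. True) v \<longleftrightarrow> v = w) \<and>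
            w \<noteq> 0 \<and> sim w (matrix_inv \<Sigma> *v \<mu>) \<ge> 1 - \<epsilon>) \<ge> 1 - \<delta>"
proof -
  interpret mixup_setting \<mu> \<Sigma> \<Lambda> g by (rule mixup_setting.intro) (rule assms)+
  obtain \<kappa>0 c0 c1 where \<kappa>0: "1 < \<kappa>0" and c0: "0 < c0"
    and crit: "\<And>\<kappa>. \<kappa>0 \<le> \<kappa> \<Longrightarrow> \<exists>c. c0 \<le> c \<and> c \<le> c1 \<and> (\<integral>x. grad_term (c *\<^sub>R dir) x \<partial>Q \<kappa>) = 0"
    using population_critical_point by blast
  obtain B q0 where B: "0 < B" and q0: "0 < q0"
    and moment0: "\<And>\<kappa> v. 1 \<le> \<kappa> \<Longrightarrow> q0 / \<kappa> * (norm v)\<^sup>2 \<le> (\<integral>x. trunc B x * (v \<bullet> xt x)\<^sup>2 \<partial>Q \<kappa>)"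
    using second_moment_lower by blast
  \<comment> \<open>Capped at 1 so that the deviation levels \<gamma> and \<eta> do not exceed 1,
    the range of the tail bounds.\<close>
  define q where "q = min q0 1"
  have q: "0 < q" "q \<le> 1" "q \<le> q0" using q0 by (auto simp: q_def)
  have moment: "q / \<kappa> * (norm v)\<^sup>2 \<le> (\<integral>x. trunc B x * (v \<bullet> xt x)\<^sup>2 \<partial>Q \<kappa>)" if "1 \<le> \<kappa>" for \<kappa> v
  proof -
    have "q / \<kappa> * (norm v)\<^sup>2 \<le> q0 / \<kappa> * (norm v)\<^sup>2" using q that by (intro mult_right_mono divide_right_mono) auto
    then show ?thesis using moment0[OF that, of v] by linarith
  qed
  obtain K where K: "1 \<le> K" "\<And>\<kappa>. 1 \<le> \<kappa> \<Longrightarrow> (\<integral>\<^sup>+x. ennreal (exp (2 * pair_norm x)) \<partial>Q \<kappa>) \<le> ennreal K"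
    using Q_exp_moment[of 2] by auto
  obtain Kd where Kd: "1 \<le> Kd" "\<And>\<kappa>. 1 \<le> \<kappa> \<Longrightarrow> (\<integral>\<^sup>+z. ennreal (exp (1 * norm (fst z))) \<partial>D \<kappa>) \<le> ennreal Kd"
    using data_dist_exp_moment[OF assms(2) zero_le_one] by blast
  define d where "d = real CARD('d)"
  define \<tau> where "\<tau> = exp (- ((c1 * norm dir + 1) * B)) / 8 * (q / 4)"
  define \<omega> where "\<omega> = min 1 (c0 * norm dir)"
  define \<theta> where "\<theta> = min 1 (min ((\<tau> * \<omega> / (8 * d))\<^sup>2 / (32 * K)) ((q / (4 * d\<^sup>2))\<^sup>2 / (32 * exp (4 * B\<^sup>2))))"
  define N where "N = 2 * d + 2 * d\<^sup>2 + 1"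
  define C1 where "C1 = 8 * (ln Kd + 1) / (\<tau> * \<omega>)"
  \<comment> \<open>\<open>C1\<close> answers the condition from the diagonal terms and
    \<open>C2\<close> the one from the union bound; their sum serves both.\<close>
  define C2 where "C2 = (1 + ln N) / \<theta>"
  have d: "1 \<le> d" by (simp add: d_def Suc_le_eq)
  have pos: "0 < \<tau>" "0 < \<omega>" using q c0 dir_nz by (auto simp: \<tau>_def \<omega>_def)
  have \<theta>: "0 < \<theta>" using pos d q K by (simp add: \<theta>_def)
  have "1 \<le> N" using d by (simp add: N_def)
  then have lnN: "0 \<le> ln N" by simp
  have C1: "0 < C1" using Kd pos unfolding C1_def by (intro divide_pos_pos mult_pos_pos add_nonneg_pos) auto
  have C2: "0 < C2" using lnN \<theta> by (simp add: C2_def)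
  have main: "1 - \<delta> \<le> measure (mixup_space n \<mu> \<Sigma> \<kappa> \<Lambda>) {\<omega> \<in> space (mixup_space n \<mu> \<Sigma> \<kappa> \<Lambda>).
     \<exists>w. (\<forall>v. is_arg_min (mixup_loss g n (fst \<omega>) (snd \<omega>)) (\<lambda>_. True) v \<longleftrightarrow> v = w) \<and> w \<noteq> 0 \<and> sim w dir \<ge> 1 - \<epsilon>}"
    if \<kappa>: "\<kappa>0 \<le> \<kappa>" and \<epsilon>: "0 < \<epsilon>" "\<epsilon> < 1" and \<delta>: "0 < \<delta>" "\<delta> < 1" and n: "2 \<le> n"
      and big: "(C1 + C2) * \<kappa>\<^sup>2 * (ln \<kappa>) ^ 0 / \<epsilon> ^ 4 * (1 + ln (1 / \<epsilon>) + ln (1 / \<delta>)) \<le> real n" for \<kappa> \<epsilon> \<delta> n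
  proof -
    have \<kappa>1: "1 \<le> \<kappa>" using \<kappa> \<kappa>0 by simp
    obtain c where c: "c0 \<le> c" "c \<le> c1" "(\<integral>x. grad_term (c *\<^sub>R dir) x \<partial>Q \<kappa>) = 0" using crit[OF \<kappa>] by blast
    have ln\<epsilon>: "0 \<le> ln (1 / \<epsilon>)" and ln\<delta>: "0 \<le> ln (1 / \<delta>)" using \<epsilon> \<delta> by auto
    \<comment> \<open>Since \<open>\<epsilon> < 1\<close>, the assumed bound with
      \<open>\<epsilon> ^ 4\<close> dominates one with \<open>\<epsilon>^2\<close>, the power that a
      squared tolerance of order \<open>\<epsilon>/\<kappa>\<close> calls for.\<close>
    have \<epsilon>4: "\<epsilon> ^ 4 \<le> \<epsilon>\<^sup>2" using \<epsilon> by (intro power_decreasing) auto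
    have "(C1 + C2) * \<kappa>\<^sup>2 / \<epsilon>\<^sup>2 * (1 + ln (1 / \<delta>)) \<le> (C1 + C2) * \<kappa>\<^sup>2 / \<epsilon> ^ 4 * (1 + ln (1 / \<epsilon>) + ln (1 / \<delta>))"
      using C1 C2 \<epsilon>4 \<epsilon> ln\<epsilon> ln\<delta> by (intro mult_mono divide_left_mono) auto
    then have n0: "(C1 + C2) * \<kappa>\<^sup>2 / \<epsilon>\<^sup>2 * (1 + ln (1 / \<delta>)) \<le> n" using big by simp
    have n1: "C1 * \<kappa> / \<epsilon> \<le> n"
    proof -
      have "\<kappa> \<le> \<kappa>\<^sup>2" "\<epsilon>\<^sup>2 \<le> \<epsilon>" using \<kappa>1 \<epsilon> by (auto simp: power2_eq_square mult_left_le)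
      then have "C1 * \<kappa> / \<epsilon> \<le> C1 * \<kappa>\<^sup>2 / \<epsilon>\<^sup>2" using C1 \<kappa>1 \<epsilon> by (intro frac_le mult_left_mono) auto
      also have "\<dots> \<le> (C1 + C2) * \<kappa>\<^sup>2 / \<epsilon>\<^sup>2" using C2 by (intro divide_right_mono mult_right_mono) auto
      also have "\<dots> = (C1 + C2) * \<kappa>\<^sup>2 / \<epsilon>\<^sup>2 * 1" by simp
      also have "\<dots> \<le> (C1 + C2) * \<kappa>\<^sup>2 / \<epsilon>\<^sup>2 * (1 + ln (1 / \<delta>))" using C1 C2 ln\<delta> by (intro mult_left_mono) auto
      finally show ?thesis using n0 by linarith
    qed
    have n2: "(ln N + ln (1 / \<delta>)) / \<theta> * \<kappa>\<^sup>2 / \<epsilon>\<^sup>2 \<le> n"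
    proof -
      \<comment> \<open>The sum is replaced by a product so that the dimension and \<delta> separate
        and \<open>C2\<close> is free of \<delta>.\<close>
      have "ln N + ln (1 / \<delta>) \<le> (1 + ln N) * (1 + ln (1 / \<delta>))" using lnN ln\<delta> by (simp add: algebra_simps)
      then have "(ln N + ln (1 / \<delta>)) / \<theta> * \<kappa>\<^sup>2 / \<epsilon>\<^sup>2 \<le> (1 + ln N) * (1 + ln (1 / \<delta>)) / \<theta> * \<kappa>\<^sup>2 / \<epsilon>\<^sup>2"
        using \<theta> by (intro divide_right_mono mult_right_mono) auto
      also have "\<dots> = C2 * \<kappa>\<^sup>2 / \<epsilon>\<^sup>2 * (1 + ln (1 / \<delta>))" by (simp add: C2_def)
      also have "\<dots> \<le> (C1 + C2) * \<kappa>\<^sup>2 / \<epsilon>\<^sup>2 * (1 + ln (1 / \<delta>))"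
        using C1 ln\<delta> by (intro mult_right_mono divide_right_mono) auto
      finally show ?thesis using n0 by linarith
    qed
    show ?thesis
      by (rule success_probability[where c="c" and B=B and q=q and ?c0.0=c0 and ?c1.0=c1 and K=K and Kd=Kd and \<theta>=\<theta>])
        (use n \<kappa>1 c0 c B q moment K Kd \<epsilon> \<delta> \<theta> n1 n2 in \<open>simp_all add: \<theta>_def \<tau>_def \<omega>_def d_def N_def C1_def\<close>)
  qed
  have "0 < C1 + C2" using C1 C2 by simp
  show ?thesis
  proof (rule exI[of _ \<kappa>0], rule conjI[OF \<kappa>0], rule exI[of _ "C1 + C2"], rule conjI[OF \<open>0 < C1 + C2\<close>],
      rule exI[of _ 0], intro allI ballI impI)
    fix \<kappa> \<epsilon> \<delta> :: real and n :: nat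
    assume "\<kappa>0 \<le> \<kappa>" "\<epsilon> \<in> {0<..<1}" "\<delta> \<in> {0<..<1}" "2 \<le> n"
      "(C1 + C2) * \<kappa>\<^sup>2 * (ln \<kappa>) ^ 0 / \<epsilon> ^ 4 * (1 + ln (1 / \<epsilon>) + ln (1 / \<delta>)) \<le> real n"
    then show "1 - \<delta> \<le> \<P>((S, lam) in mixup_space n \<mu> \<Sigma> \<kappa> \<Lambda>.
        \<exists>w. (\<forall>v. is_arg_min (mixup_loss g n S lam) (\<lambda>_. True) v \<longleftrightarrow> v = w) \<and>
            w \<noteq> 0 \<and> sim w (matrix_inv \<Sigma> *v \<mu>) \<ge> 1 - \<epsilon>)"
      using main[of \<kappa> \<epsilon> \<delta> n] by (simp add: dir_def case_prod_unfold)
  qed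
qed

end
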